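(* Let $0<\alpha_0\le\alpha<2$, $c_l,c_U,c_H>0$, let $\Omega\subset\mathbb{R}^d$ be bounded and open, and assume that $k$ satisfies condition (E$_\ge$) with constant $c_l$ and condition (U1) with constant $c_U$, and that the Green function $G$ on $\Omega$ satisfies condition (H) with constant $c_H$. Then $$G(x,y)\ge C|x-y|^{\alpha-d}\quad\text{for all }x,y\in\Omega\text{ with }0<|x-y|\le\operatorname{dist}(y,\partial\Omega)/2,$$ for some constant $C>0$ depending only on $d$, $c_l$, $c_U$, $c_H$ and $\alpha_0$ (and not on $\alpha$ or $\Omega$).
   Context: Throughout, $d\ge 3$ and $k:(\mathbb{R}^d\times\mathbb{R}^d)\setminus\{x=y\}\to[0,\infty)$ is a measurable function with $k(x,y)=k(y,x)$ and $\sup_{x\in\mathbb{R}^d}\int_{\mathbb{R}^d}(1\wedge|y-x|^2)k(x,y)\,dy<\infty$. For an open set $U\subset\mathbb{R}^d$ and measurable $u,v$, $\mathcal{E}_U(u,v)=\int_U\int_U(u(y)-u(x))(v(y)-v(x))k(x,y)\,dy\,dx$ (when finite), and $\mathcal{E}=\mathcal{E}_{\mathbb{R}^d}$. For $0<\alpha<2$ let $k^{(\alpha)}(x,y)=\frac{2^\alpha\Gamma((d+\alpha)/2)}{\pi^{d/2}|\Gamma(-\alpha/2)|}|y-x|^{-d-\alpha}$ and let $\mathcal{E}^\alpha_U$, $\mathcal{E}^\alpha$ denote the same forms with $k$ replaced by $k^{(\alpha)}$. $H(\mathbb{R}^d;k)=\{u\in L^2(\mathbb{R}^d):\mathcal{E}(u,u)<\infty\}$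 and, for open $\Omega$, $H_\Omega(\mathbb{R}^d;k)=\{u\in H(\mathbb{R}^d;k): u=0\text{ a.e. on }\mathbb{R}^d\setminus\Omega\}$; $\langle f,g\rangle=\int fg\,dx$. Condition (E$_\ge$) with constant $c_l>0$: for every ball $B=B_r(x_0)\subset\mathbb{R}^d$ and every $u\in L^2(B)$, $\mathcal{E}_B(u,u)\ge c_l\,\mathcal{E}^\alpha_B(u,u)$. Condition (U1) with constant $c_U>0$: for all $r>0$, $\sup_{x\in\mathbb{R}^d}\int_{\mathbb{R}^d}(r^2\wedge|y-x|^2)k(x,y)\,dy\le c_U r^{2-\alpha}$. Green function: for a bounded open $\Omega\subset\mathbb{R}^d$, a measurable $G:\mathbb{R}^d\times\mathbb{R}^d\to[0,\infty]$ is a Green function on $\Omega$ if $G(\cdot,y)\in L^1(\Omega)$ for each $y\in\Omega$, $G=0$ a.e. on $(\mathbb{R}^d\times\mathbb{R}^d)\setminus(\Omega\times\Omega)$, and $\int_{\mathbb{R}^d}G(x,y)\psi(x)\,dx=\varphi(y)$ for every $y\in\Omega$, every $\varphi\in H_\Omega(\mathbb{R}^d;k)\cap C(\Omega)$ and every $\psi\in L^\infty(\Omega)$ such that $\mathcal{E}(\varphi,v)=\langle\psi,v\rangle$ for all $v\in H_\Omega(\mathbb{R}^d;k)$. Under (E$_\ge$) and (U1) it exists and is unique. Condition (H) (annulus Harnack inequality) with constant $c_H>0$: for every $y\in\Omega$ and every ball $B_{2r}(y)\Subset\Omega$, $\sup_{B_{2r}(y)\setminus B_r(y)}G(\cdot,y)\le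 c_H\inf_{B_{2r}(y)\setminus B_r(y)}G(\cdot,y)$. *)

theory Defs
  imports "HOL-Analysis.Analysis"
begin

text \<open>Ambient space: R^d is modelled by a Euclidean space type 'a with d = DIM('a).
  Measurability of functions on R^d x R^d means Lebesgue measurability, i.e. w.r.t. the
  completion of the Borel product measure.\<close>

definition leb2 :: "('a::euclidean_space \<times> 'a) measure" where
  "leb2 = completion (lborel \<Otimes>\<^sub>M lborel)"

definition kernel_ok :: "('a::euclidean_space \<Rightarrow> 'a \<Rightarrow> real) \<Rightarrow> bool" where
  "kernel_ok k \<longleftrightarrow>
     (\<lambda>p. k (fst p) (snd p)) \<in> borel_measurable leb2 \<and>
     (\<forall>x y. x \<noteq> y \<longrightarrow> k x y \<ge> 0 \<and> k x y = k y x) \<and>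
     (\<exists>M::real. \<forall>x. (\<integral>\<^sup>+ y. ennreal (min 1 ((dist y x)\<^sup>2) * k x y) \<partial>lebesgue) \<le> ennreal M)"

definition energy_nn :: "'a::euclidean_space set \<Rightarrow> ('a \<Rightarrow> 'a \<Rightarrow> real) \<Rightarrow> ('a \<Rightarrow> real) \<Rightarrow> ennreal" where
  "energy_nn U k u =
     (\<integral>\<^sup>+ x. indicator U x * (\<integral>\<^sup>+ y. indicator U y * ennreal ((u y - u x)\<^sup>2 * k x y) \<partial>lebesgue) \<partial>lebesgue)"

text \<open>Bilinear form E(u,v) = E_{R^d}(u,v) (used for u, v in H, where it is finite).\<close>
definition energy_form :: "('a::euclidean_space \<Rightarrow> 'a \<Rightarrow> real) \<Rightarrow> ('a \<Rightarrow> real) \<Rightarrow> ('a \<Rightarrow> real) \<Rightarrow> real" where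
  "energy_form k u v =
     (\<integral> x. (\<integral> y. (u y - u x) * (v y - v x) * k x y \<partial>lebesgue) \<partial>lebesgue)"

definition frac_kernel :: "real \<Rightarrow> 'a::euclidean_space \<Rightarrow> 'a \<Rightarrow> real" where
  "frac_kernel \<alpha> x y =
     2 powr \<alpha> * Gamma ((real DIM('a) + \<alpha>) / 2)
       / (pi powr (real DIM('a) / 2) * \<bar>Gamma (- \<alpha> / 2)\<bar>)
       * dist y x powr (- real DIM('a) - \<alpha>)"

definition L2_on :: "'a::euclidean_space set \<Rightarrow> ('a \<Rightarrow> real) \<Rightarrow> bool" where
  "L2_on U u \<longleftrightarrow> u \<in> borel_measurable lebesgue \<and>
     (\<integral>\<^sup>+ x. indicator U x * ennreal ((u x)\<^sup>2) \<partial>lebesgue) < \<infinity>"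

definition in_H :: "('a::euclidean_space \<Rightarrow> 'a \<Rightarrow> real) \<Rightarrow> ('a \<Rightarrow> real) \<Rightarrow> bool" where
  "in_H k u \<longleftrightarrow> L2_on UNIV u \<and> energy_nn UNIV k u < \<infinity>"

definition in_H0 :: "('a::euclidean_space \<Rightarrow> 'a \<Rightarrow> real) \<Rightarrow> 'a set \<Rightarrow> ('a \<Rightarrow> real) \<Rightarrow> bool" where
  "in_H0 k \<Omega> u \<longleftrightarrow> in_H k u \<and> (AE x in lebesgue. x \<notin> \<Omega> \<longrightarrow> u x = 0)"

definition cond_E_ge :: "real \<Rightarrow> real \<Rightarrow> ('a::euclidean_space \<Rightarrow> 'a \<Rightarrow> real) \<Rightarrow> bool" where
  "cond_E_ge \<alpha> c_l k \<longleftrightarrow>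
     (\<forall>x0 r u. r > 0 \<longrightarrow> L2_on (ball x0 r) u \<longrightarrow>
        energy_nn (ball x0 r) k u \<ge> ennreal c_l * energy_nn (ball x0 r) (frac_kernel \<alpha>) u)"

definition cond_U1 :: "real \<Rightarrow> real \<Rightarrow> ('a::euclidean_space \<Rightarrow> 'a \<Rightarrow> real) \<Rightarrow> bool" where
  "cond_U1 \<alpha> c_U k \<longleftrightarrow>
     (\<forall>r>0. \<forall>x. (\<integral>\<^sup>+ y. ennreal (min (r\<^sup>2) ((dist y x)\<^sup>2) * k x y) \<partial>lebesgue)
                  \<le> ennreal (c_U * r powr (2 - \<alpha>)))"

text \<open>L^\<infinity>(\<Omega>) functions, regarded as functions on R^d vanishing (a.e.) outside \<Omega>.\<close>
definition Linf_on :: "'a::euclidean_space set \<Rightarrow> ('a \<Rightarrow> real) \<Rightarrow> bool" where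
  "Linf_on \<Omega> \<psi> \<longleftrightarrow> \<psi> \<in> borel_measurable lebesgue \<and>
     (\<exists>M. AE x in lebesgue. \<bar>\<psi> x\<bar> \<le> M) \<and> (AE x in lebesgue. x \<notin> \<Omega> \<longrightarrow> \<psi> x = 0)"

definition green_function ::
  "('a::euclidean_space \<Rightarrow> 'a \<Rightarrow> real) \<Rightarrow> 'a set \<Rightarrow> ('a \<Rightarrow> 'a \<Rightarrow> ennreal) \<Rightarrow> bool" where
  "green_function k \<Omega> G \<longleftrightarrow>
     (\<lambda>p. G (fst p) (snd p)) \<in> borel_measurable leb2 \<and>
     (\<forall>y\<in>\<Omega>. (\<lambda>x. G x y) \<in> borel_measurable lebesgue \<and>
             (\<integral>\<^sup>+ x. indicator \<Omega> x * G x y \<partial>lebesgue) < \<infinity>) \<and>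
     (AE p in leb2. p \<notin> \<Omega> \<times> \<Omega> \<longrightarrow> G (fst p) (snd p) = 0) \<and>
     (\<forall>y\<in>\<Omega>. \<forall>\<phi> \<psi>. in_H0 k \<Omega> \<phi> \<longrightarrow> continuous_on \<Omega> \<phi> \<longrightarrow> Linf_on \<Omega> \<psi> \<longrightarrow>
        (\<forall>v. in_H0 k \<Omega> v \<longrightarrow> energy_form k \<phi> v = (\<integral> x. \<psi> x * v x \<partial>lebesgue)) \<longrightarrow>
        (\<integral> x. enn2real (G x y) * \<psi> x \<partial>lebesgue) = \<phi> y)"

definition cond_H :: "real \<Rightarrow> 'a::euclidean_space set \<Rightarrow> ('a \<Rightarrow> 'a \<Rightarrow> ennreal) \<Rightarrow> bool" where
  "cond_H c_H \<Omega> G \<longleftrightarrow>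
     (\<forall>y\<in>\<Omega>. \<forall>r>0. cball y (2 * r) \<subseteq> \<Omega> \<longrightarrow>
        (SUP x\<in>ball y (2 * r) - ball y r. G x y)
          \<le> ennreal c_H * (INF x\<in>ball y (2 * r) - ball y r. G x y))"

end

theory Submission
  imports Defs
begin

text \<open>
  The Green function is only tested against continuous weak solutions, so such solutions have to be
  produced first. Fix \<open>y\<close>, put \<open>r = |x - y|\<close> and let \<open>A\<close> be the annulus \<open>B\<^sub>r(y) - B\<^bsub>\<epsilon>r\<^esub>(y)\<close>. Minimising the
  energy gives \<open>\<phi>\<close> with \<open>L \<phi> + r\<^bsup>-\<alpha>\<^esup> \<phi> = 1\<^sub>A\<close> in \<open>\<Omega>\<close> and \<open>0 \<le> \<phi> \<le> r\<^bsup>\<alpha>\<^esup>\<close>. Testing with \<open>\<eta>\<^sup>2 / (\<phi> + s)\<close> and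
  using Picone's identity bounds \<open>\<integral>\<^sub>A \<eta>\<^sup>2 / (\<phi> + s)\<close> by the energy of the cutoff \<open>\<eta>\<close>, so \<open>\<phi> \<ge> \<kappa> r\<^bsup>\<alpha>\<^esup>\<close> on all but a
  small part of \<open>B\<^bsub>r/2\<^esub>(y)\<close> when \<open>\<kappa>\<close> and \<open>\<epsilon>\<close> are small, and De Giorgi's first lemma turns this into a pointwise
  bound on \<open>B\<^bsub>r/4\<^esub>(y)\<close>. The De Giorgi iteration only needs a Faber-Krahn inequality whose constant stays
  bounded as \<open>\<alpha>\<close> tends to 2. Continuity of \<open>\<phi>\<close> follows from the same lemma and the logarithmic form of
  Picone's identity: if the oscillation at a point did not vanish, then at small scales \<open>\<phi>\<close> or \<open>-\<phi>\<close> would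
  improve its essential bounds by a fixed fraction. Since \<open>L \<phi> \<le> 1\<^sub>A\<close>, the integral of \<open>G(\<cdot>, y)\<close> over \<open>A\<close> is at
  least \<open>\<phi>(y) \<ge> \<kappa> r\<^bsup>\<alpha>\<^esup> / 2\<close>, and finitely many annulus Harnack inequalities compare \<open>G(\<cdot>, y)\<close> on \<open>A\<close> with
  \<open>G(x, y)\<close>.
\<close>

section \<open>The energy form of a symmetric jump kernel\<close>

text \<open>No pointwise bound on \<open>k\<close> is at hand beyond nonnegativity, so uniformity in
  \<alpha> rests on two integrated facts: (U1) bounds the energy of a cutoff of width h through
  h^(-\<alpha>), and (E_\<ge>) yields the Faber-Krahn constant. The quantitative chain draws on
  these alone, so \<open>eps0\<close>, \<open>\<kappa>\<close> and \<open>\<epsilon>\<close> do not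
  see \<alpha>. Continuity is wanted only qualitatively, to make a solution admissible, and its
  constants may degenerate as \<alpha> tends to 2. The obstacle of a nonlocal De Giorgi argument is
  the tail: far values enter local estimates. In the quantitative bound the solution is nonnegative
  everywhere and no tail appears; in the continuity proof the tail acts as a bounded source, which
  loses against \<rho>^(-\<alpha>) as \<rho> tends to 0. A ball around the pole is cut out of the
  source because finitely many annuli never reach the pole. The exponent \<alpha> - d is the height
  r^\<alpha> of the solution over the volume r^d of the annulus.\<close>

definition incr :: "('a \<Rightarrow> real) \<Rightarrow> 'a \<times> 'a \<Rightarrow> real" where
  "incr u p = u (snd p) - u (fst p)"

lemma incr_measurable [measurable]:
  fixes u :: "'a::euclidean_space \<Rightarrow> real"
  assumes [measurable]: "u \<in> borel_measurable borel"
  shows "incr u \<in> borel_measurable borel"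
proof -
  have "(\<lambda>p. u (snd p) - u (fst p)) \<in> borel_measurable (borel \<Otimes>\<^sub>M borel)"
    by measurable
  then show ?thesis by (simp add: incr_def[abs_def] borel_prod)
qed

lemma borel_measurable_fst [measurable]: "fst \<in> (borel :: ('a::euclidean_space \<times> 'a) measure) \<rightarrow>\<^sub>M borel"
  and borel_measurable_snd [measurable]: "snd \<in> (borel :: ('a::euclidean_space \<times> 'a) measure) \<rightarrow>\<^sub>M borel"
  by (simp_all add: borel_prod[symmetric])

lemma sets_borel_ball [measurable]: "ball (x :: 'a::euclidean_space) r \<in> sets borel"
  and sets_borel_cball [measurable]: "cball (x :: 'a::euclidean_space) r \<in> sets borel"
  by simp_all

locale symmetric_kernel =
  fixes k :: "'a::euclidean_space \<Rightarrow> 'a \<Rightarrow> real"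
  assumes k_measurable [measurable]: "(\<lambda>p. k (fst p) (snd p)) \<in> borel_measurable borel"
    and k_nonneg: "k x y \<ge> 0"
    and k_sym: "k x y = k y x"
begin

text \<open>Absorbing the kernel into a measure turns \<open>form\<close> into the L^2 inner product
  of increments, so bilinearity, integrability and Fatou are those of a single measure
  space.\<close>

definition jump :: "('a \<times> 'a) measure" where
  "jump = density lborel (\<lambda>p. ennreal (k (fst p) (snd p)))"

lemma sets_jump [simp, measurable_cong]: "sets jump = sets borel"
  and space_jump [simp]: "space jump = UNIV"
  by (simp_all add: jump_def)

lemma k_section [measurable]: "(\<lambda>y. k x y) \<in> borel_measurable borel"
proof -
  have "(\<lambda>p. k (fst p) (snd p)) \<in> borel_measurable (borel \<Otimes>\<^sub>M borel)"
    by (simp add: borel_prod)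
  then show ?thesis
    using measurable_compose[OF measurable_Pair1'[of x borel borel], of "\<lambda>p. k (fst p) (snd p)" borel]
    by simp
qed

lemma nn_integral_jump:
  assumes [measurable]: "f \<in> borel_measurable borel"
  shows "(\<integral>\<^sup>+p. f p \<partial>jump) = (\<integral>\<^sup>+x. \<integral>\<^sup>+y. ennreal (k x y) * f (x, y) \<partial>lborel \<partial>lborel)"
proof -
  have "(\<integral>\<^sup>+p. f p \<partial>jump) = (\<integral>\<^sup>+p. ennreal (k (fst p) (snd p)) * f p \<partial>(lborel \<Otimes>\<^sub>M lborel))"
    unfolding jump_def by (subst nn_integral_density) (simp_all add: lborel_prod)
  also have "\<dots> = (\<integral>\<^sup>+x. \<integral>\<^sup>+y. ennreal (k x y) * f (x, y) \<partial>lborel \<partial>lborel)"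
    by (subst lborel.nn_integral_fst[symmetric]) (simp_all add: lborel_prod)
  finally show ?thesis .
qed

lemma nn_integral_jump':
  assumes [measurable]: "f \<in> borel_measurable borel"
  shows "(\<integral>\<^sup>+p. f p \<partial>jump) = (\<integral>\<^sup>+y. \<integral>\<^sup>+x. ennreal (k y x) * f (x, y) \<partial>lborel \<partial>lborel)"
proof -
  have "(\<integral>\<^sup>+p. f p \<partial>jump) = (\<integral>\<^sup>+p. ennreal (k (fst p) (snd p)) * f p \<partial>(lborel \<Otimes>\<^sub>M lborel))"
    unfolding jump_def by (subst nn_integral_density) (simp_all add: lborel_prod)
  also have "\<dots> = (\<integral>\<^sup>+y. \<integral>\<^sup>+x. ennreal (k x y) * f (x, y) \<partial>lborel \<partial>lborel)"
    by (subst lborel_pair.nn_integral_snd[symmetric]) (simp_all add: lborel_prod)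
  finally show ?thesis by (subst k_sym) simp
qed

definition energy :: "('a \<Rightarrow> real) \<Rightarrow> ennreal" where
  "energy u = (\<integral>\<^sup>+p. ennreal ((incr u p)\<^sup>2) \<partial>jump)"

definition finite_energy :: "('a \<Rightarrow> real) \<Rightarrow> bool" where
  "finite_energy u \<longleftrightarrow> u \<in> borel_measurable borel \<and> energy u < \<infinity>"

definition form :: "('a \<Rightarrow> real) \<Rightarrow> ('a \<Rightarrow> real) \<Rightarrow> real" where
  "form u v = (\<integral>p. incr u p * incr v p \<partial>jump)"

lemma finite_energy_measurable [measurable_dest]: "finite_energy u \<Longrightarrow> u \<in> borel_measurable borel"
  by (simp add: finite_energy_def)

lemma finite_energy_integrable: "finite_energy u \<longleftrightarrow> u \<in> borel_measurable borel \<and> integrable jump (\<lambda>p. (incr u p)\<^sup>2)"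
proof (cases "u \<in> borel_measurable borel")
  case True
  then have [measurable]: "u \<in> borel_measurable borel" .
  have "(\<lambda>p. (incr u p)\<^sup>2) \<in> borel_measurable jump" by measurable
  then show ?thesis using True unfolding finite_energy_def energy_def
    by (subst integrable_iff_bounded) (auto simp: top.not_eq_extremum)
qed (simp add: finite_energy_def)

lemma energy_eq_form: "finite_energy u \<Longrightarrow> energy u = ennreal (form u u)"
  unfolding energy_def form_def finite_energy_integrable
  by (subst nn_integral_eq_integral) (auto simp: power2_eq_square)

lemma form_self_nonneg: "form u u \<ge> 0"
  unfolding form_def by (intro Bochner_Integration.integral_nonneg) auto

lemma integrable_incr_mult:
  assumes "finite_energy u" "finite_energy v"
  shows "integrable jump (\<lambda>p. incr u p * incr v p)"
proof (rule Bochner_Integration.integrable_bound)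
  show "integrable jump (\<lambda>p. (incr u p)\<^sup>2 + (incr v p)\<^sup>2)"
    using assms by (auto simp: finite_energy_integrable)
  have [measurable]: "u \<in> borel_measurable borel" "v \<in> borel_measurable borel"
    using assms by (auto simp: finite_energy_def)
  show "(\<lambda>p. incr u p * incr v p) \<in> borel_measurable jump" by measurable
  show "AE p in jump. norm (incr u p * incr v p) \<le> norm ((incr u p)\<^sup>2 + (incr v p)\<^sup>2)"
  proof (intro AE_I2)
    fix p
    have "2 * \<bar>incr u p * incr v p\<bar> \<le> (incr u p)\<^sup>2 + (incr v p)\<^sup>2"
      using sum_squares_bound[of "\<bar>incr u p\<bar>" "\<bar>incr v p\<bar>"] by (simp add: abs_mult)
    then show "norm (incr u p * incr v p) \<le> norm ((incr u p)\<^sup>2 + (incr v p)\<^sup>2)" by simp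
  qed
qed

text \<open>Contractions, products of bounded functions and reciprocals of functions bounded away
  from 0 all have increments of this shape; the truncations and quotients used as test functions get
  their finite energy from here.\<close>

lemma finite_energy_bound:
  assumes [measurable]: "u \<in> borel_measurable borel" and "finite_energy v" "finite_energy w"
    and "\<And>p. \<bar>incr u p\<bar> \<le> c * \<bar>incr v p\<bar> + d * \<bar>incr w p\<bar>"
  shows "finite_energy u"
proof -
  have "integrable jump (\<lambda>p. (incr u p)\<^sup>2)"
  proof (rule Bochner_Integration.integrable_bound)
    show "integrable jump (\<lambda>p. 2 * c\<^sup>2 * (incr v p)\<^sup>2 + 2 * d\<^sup>2 * (incr w p)\<^sup>2)"
      using assms by (auto simp: finite_energy_integrable)
    show "(\<lambda>p. (incr u p)\<^sup>2) \<in> borel_measurable jump" by measurable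
    show "AE p in jump. norm ((incr u p)\<^sup>2) \<le> norm (2 * c\<^sup>2 * (incr v p)\<^sup>2 + 2 * d\<^sup>2 * (incr w p)\<^sup>2)"
    proof (intro AE_I2)
      fix p
      let ?a = "c * \<bar>incr v p\<bar>" and ?b = "d * \<bar>incr w p\<bar>"
      have "(incr u p)\<^sup>2 \<le> (?a + ?b)\<^sup>2"
        using power_mono[OF assms(4)[of p], of 2] by simp
      also have "\<dots> \<le> 2 * ?a\<^sup>2 + 2 * ?b\<^sup>2"
        using zero_le_power2[of "?a - ?b"] unfolding power2_sum power2_diff by linarith
      also have "\<dots> = 2 * c\<^sup>2 * (incr v p)\<^sup>2 + 2 * d\<^sup>2 * (incr w p)\<^sup>2"
        by (simp add: power_mult_distrib)
      finally show "norm ((incr u p)\<^sup>2) \<le> norm (2 * c\<^sup>2 * (incr v p)\<^sup>2 + 2 * d\<^sup>2 * (incr w p)\<^sup>2)"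
        by simp
    qed
  qed
  then show ?thesis by (simp add: finite_energy_integrable)
qed

lemma finite_energy_lipschitz:
  assumes "u \<in> borel_measurable borel" and "finite_energy v"
    and "\<And>x y. \<bar>u x - u y\<bar> \<le> c * \<bar>v x - v y\<bar>"
  shows "finite_energy u"
  by (rule finite_energy_bound[of u v v c 0]) (use assms in \<open>auto simp: incr_def\<close>)

lemma finite_energy_zero: "finite_energy (\<lambda>x. 0)"
  by (simp add: finite_energy_def energy_def incr_def)

lemma finite_energy_add: "finite_energy u \<Longrightarrow> finite_energy v \<Longrightarrow> finite_energy (\<lambda>x. u x + v x)"
  by (rule finite_energy_bound[of _ u v 1 1]) (auto simp: finite_energy_def incr_def)

lemma finite_energy_cmult: "finite_energy u \<Longrightarrow> finite_energy (\<lambda>x. c * u x)"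
  by (rule finite_energy_lipschitz[of _ u "\<bar>c\<bar>"])
     (auto simp: finite_energy_def right_diff_distrib[symmetric] abs_mult)

lemma finite_energy_mult:
  assumes "finite_energy u" "finite_energy v" and "\<And>x. \<bar>u x\<bar> \<le> a" "\<And>x. \<bar>v x\<bar> \<le> b"
  shows "finite_energy (\<lambda>x. u x * v x)"
proof (rule finite_energy_bound[of _ u v b a])
  fix p :: "'a \<times> 'a"
  have "incr (\<lambda>x. u x * v x) p = v (snd p) * incr u p + u (fst p) * incr v p"
    by (simp add: incr_def algebra_simps)
  also have "\<bar>\<dots>\<bar> \<le> \<bar>v (snd p)\<bar> * \<bar>incr u p\<bar> + \<bar>u (fst p)\<bar> * \<bar>incr v p\<bar>"
    by (metis abs_mult abs_triangle_ineq)
  also have "\<dots> \<le> b * \<bar>incr u p\<bar> + a * \<bar>incr v p\<bar>"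
    using assms by (intro add_mono mult_right_mono) auto
  finally show "\<bar>incr (\<lambda>x. u x * v x) p\<bar> \<le> b * \<bar>incr u p\<bar> + a * \<bar>incr v p\<bar>" .
qed (use assms in \<open>auto simp: finite_energy_def\<close>)

lemma form_sym: "form u v = form v u"
  by (simp add: form_def mult.commute)

lemma form_add_right:
  assumes "finite_energy u" "finite_energy v" "finite_energy w"
  shows "form u (\<lambda>x. v x + w x) = form u v + form u w"
proof -
  have "form u (\<lambda>x. v x + w x) = (\<integral>p. incr u p * incr v p + incr u p * incr w p \<partial>jump)"
    unfolding form_def by (rule Bochner_Integration.integral_cong) (auto simp: incr_def algebra_simps)
  then show ?thesis using assms by (simp add: integrable_incr_mult form_def)
qed

lemma form_cmult_right: "form u (\<lambda>x. c * v x) = c * form u v"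
proof -
  have "form u (\<lambda>x. c * v x) = (\<integral>p. c * (incr u p * incr v p) \<partial>jump)"
    unfolding form_def by (rule Bochner_Integration.integral_cong) (auto simp: incr_def algebra_simps)
  then show ?thesis by (simp add: form_def)
qed

lemma form_add_left:
  "finite_energy u \<Longrightarrow> finite_energy v \<Longrightarrow> finite_energy w \<Longrightarrow> form (\<lambda>x. u x + v x) w = form u w + form v w"
  using form_add_right[of w u v] by (simp add: form_sym)

lemma form_cmult_left: "form (\<lambda>x. c * u x) v = c * form u v"
  using form_cmult_right[of v c u] by (simp add: form_sym)

text \<open>Only increments enter, so constants may be added even though they leave L^2.\<close>

lemma form_cong_incr:
  assumes "\<And>x y. u x - u y = u' x - u' y" "\<And>x y. v x - v y = v' x - v' y"
  shows "form u v = form u' v'"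
  unfolding form_def incr_def using assms by (intro Bochner_Integration.integral_cong) simp_all

end

section \<open>Truncated second moments and cutoff functions\<close>

lemma powr_two_minus_div:
  fixes h \<alpha> :: real assumes "h > 0"
  shows "c * h powr (2 - \<alpha>) / h\<^sup>2 = c * h powr (- \<alpha>)"
proof -
  have "h powr (2 - \<alpha>) = h powr 2 * h powr (- \<alpha>)"
    by (simp add: powr_add[symmetric])
  then show ?thesis using assms by (simp add: field_simps)
qed

locale bounded_kernel = symmetric_kernel k for k :: "'a::euclidean_space \<Rightarrow> 'a \<Rightarrow> real" +
  fixes \<alpha> c_U :: real
  assumes U1: "cond_U1 \<alpha> c_U k" and c_U_nonneg: "c_U \<ge> 0"
begin

text \<open>(U1) at radius h, divided by h^2, bounds the integral of \<open>trunc h\<close> against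
  k(x, .) by c_U h^(-\<alpha>). The same function dominates the squared increments of a cutoff of
  width h and equals 1 on jumps of length at least h, so it serves both cutoff energies and
  tails.\<close>

definition trunc :: "real \<Rightarrow> 'a \<times> 'a \<Rightarrow> real" where
  "trunc h p = min 1 ((dist (snd p) (fst p))\<^sup>2 / h\<^sup>2)"

lemma trunc_measurable [measurable]: "trunc h \<in> borel_measurable borel"
  unfolding trunc_def[abs_def] by measurable

lemma trunc_nonneg: "trunc h p \<ge> 0"
  by (simp add: trunc_def)

lemma trunc_section:
  assumes "h > 0"
  shows "(\<integral>\<^sup>+y. ennreal (k x y) * ennreal (trunc h (x, y)) \<partial>lborel) \<le> ennreal (c_U * h powr (- \<alpha>))"
proof -
  have eq: "ennreal (k x y) * ennreal (trunc h (x, y))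
      = ennreal (1 / h\<^sup>2) * ennreal (min (h\<^sup>2) ((dist y x)\<^sup>2) * k x y)" for y
  proof -
    have "trunc h (x, y) = 1 / h\<^sup>2 * min (h\<^sup>2) ((dist y x)\<^sup>2)"
      using assms by (auto simp: trunc_def min_def field_simps)
    then show ?thesis using k_nonneg[of x y]
      by (simp add: ennreal_mult[symmetric] trunc_nonneg mult_ac)
  qed
  have "(\<integral>\<^sup>+y. ennreal (k x y) * ennreal (trunc h (x, y)) \<partial>lborel)
     = ennreal (1 / h\<^sup>2) * (\<integral>\<^sup>+y. ennreal (min (h\<^sup>2) ((dist y x)\<^sup>2) * k x y) \<partial>lborel)"
    unfolding eq by (intro nn_integral_cmult) measurable
  also have "\<dots> \<le> ennreal (1 / h\<^sup>2) * ennreal (c_U * h powr (2 - \<alpha>))"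
    using U1 assms unfolding cond_U1_def nn_integral_completion by (intro mult_left_mono) auto
  also have "\<dots> = ennreal (c_U * h powr (- \<alpha>))"
    using powr_two_minus_div[OF assms, of c_U \<alpha>] c_U_nonneg by (simp add: ennreal_mult[symmetric])
  finally show ?thesis .
qed

lemma nn_integral_trunc_fst:
  assumes "h > 0" and [measurable]: "f \<in> borel_measurable borel"
  shows "(\<integral>\<^sup>+p. f (fst p) * ennreal (trunc h p) \<partial>jump)
      \<le> ennreal (c_U * h powr (- \<alpha>)) * (\<integral>\<^sup>+x. f x \<partial>lborel)"
proof -
  have [measurable]: "(\<lambda>y. trunc h (x, y)) \<in> borel_measurable borel" for x
    unfolding trunc_def by simp
  have "(\<integral>\<^sup>+p. f (fst p) * ennreal (trunc h p) \<partial>jump)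
     = (\<integral>\<^sup>+x. \<integral>\<^sup>+y. ennreal (k x y) * (f x * ennreal (trunc h (x, y))) \<partial>lborel \<partial>lborel)"
    by (subst nn_integral_jump) simp_all
  also have "\<dots> = (\<integral>\<^sup>+x. f x * (\<integral>\<^sup>+y. ennreal (k x y) * ennreal (trunc h (x, y)) \<partial>lborel) \<partial>lborel)"
    by (subst nn_integral_cmult[symmetric]) (auto simp: mult_ac)
  also have "\<dots> \<le> (\<integral>\<^sup>+x. f x * ennreal (c_U * h powr (- \<alpha>)) \<partial>lborel)"
    by (intro nn_integral_mono mult_left_mono trunc_section assms) auto
  also have "\<dots> = ennreal (c_U * h powr (- \<alpha>)) * (\<integral>\<^sup>+x. f x \<partial>lborel)"
    by (subst nn_integral_multc) (auto simp: mult_ac)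
  finally show ?thesis .
qed

lemma nn_integral_trunc_snd:
  assumes "h > 0" and [measurable]: "f \<in> borel_measurable borel"
  shows "(\<integral>\<^sup>+p. f (snd p) * ennreal (trunc h p) \<partial>jump)
      \<le> ennreal (c_U * h powr (- \<alpha>)) * (\<integral>\<^sup>+x. f x \<partial>lborel)"
proof -
  have "(\<integral>\<^sup>+p. f (snd p) * ennreal (trunc h p) \<partial>jump)
      = (\<integral>\<^sup>+y. \<integral>\<^sup>+x. ennreal (k y x) * (f y * ennreal (trunc h (x, y))) \<partial>lborel \<partial>lborel)"
    by (subst nn_integral_jump') simp_all
  also have "\<dots> = (\<integral>\<^sup>+p. f (fst p) * ennreal (trunc h p) \<partial>jump)"
    by (subst nn_integral_jump) (simp_all add: trunc_def dist_commute)
  finally show ?thesis using nn_integral_trunc_fst[OF assms] by simp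
qed

text \<open>One endpoint of every contributing jump lies in S; integrating out the other endpoint by
  (U1) leaves the volume of S. The factor 2 counts the two possible endpoints.\<close>

lemma nn_integral_trunc_set:
  assumes "h > 0" and [measurable]: "S \<in> sets borel" "g \<in> borel_measurable borel"
    and g: "\<And>p. g p \<noteq> 0 \<Longrightarrow> fst p \<in> S \<or> snd p \<in> S" "\<And>p. g p \<le> c * trunc h p" and "c \<ge> 0"
  shows "(\<integral>\<^sup>+p. ennreal (g p) \<partial>jump) \<le> ennreal (2 * c * c_U * h powr (- \<alpha>)) * emeasure lborel S"
proof -
  have "(\<integral>\<^sup>+p. ennreal (g p) \<partial>jump) \<le> (\<integral>\<^sup>+p. ennreal c * (indicator S (fst p) * ennreal (trunc h p))
          + ennreal c * (indicator S (snd p) * ennreal (trunc h p)) \<partial>jump)"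
  proof (intro nn_integral_mono)
    fix p :: "'a \<times> 'a"
    have "ennreal (g p) \<le> ennreal c * ennreal (trunc h p)"
      using g(2)[of p] \<open>c \<ge> 0\<close> by (simp add: ennreal_mult[symmetric] trunc_nonneg ennreal_leI)
    moreover have "fst p \<notin> S \<Longrightarrow> snd p \<notin> S \<Longrightarrow> g p = 0" using g(1)[of p] by auto
    ultimately show "ennreal (g p) \<le> ennreal c * (indicator S (fst p) * ennreal (trunc h p))
          + ennreal c * (indicator S (snd p) * ennreal (trunc h p))"
      by (auto simp: indicator_def intro: order_trans add_increasing2)
  qed
  also have "\<dots> = ennreal c * (\<integral>\<^sup>+p. indicator S (fst p) * ennreal (trunc h p) \<partial>jump)
          + ennreal c * (\<integral>\<^sup>+p. indicator S (snd p) * ennreal (trunc h p) \<partial>jump)"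
    by (subst nn_integral_add) (simp_all add: nn_integral_cmult)
  also have "\<dots> \<le> ennreal c * (ennreal (c_U * h powr (- \<alpha>)) * (\<integral>\<^sup>+x. indicator S x \<partial>lborel))
          + ennreal c * (ennreal (c_U * h powr (- \<alpha>)) * (\<integral>\<^sup>+x. indicator S x \<partial>lborel))"
    by (intro add_mono mult_left_mono nn_integral_trunc_fst nn_integral_trunc_snd assms) auto
  also have "\<dots> = ennreal (2 * c * c_U * h powr (- \<alpha>)) * emeasure lborel S"
  proof -
    have "ennreal (2 * c * c_U * h powr (- \<alpha>)) = 2 * (ennreal c * ennreal (c_U * h powr (- \<alpha>)))"
      using \<open>c \<ge> 0\<close> c_U_nonneg by (simp add: ennreal_mult mult_ac)
    then show ?thesis by (simp only: mult_2 distrib_right mult.assoc nn_integral_indicator sets_lborel assms)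
  qed
  finally show ?thesis .
qed

end

definition cutoff :: "'a::euclidean_space \<Rightarrow> real \<Rightarrow> real \<Rightarrow> 'a \<Rightarrow> real" where
  "cutoff x0 R h x = max 0 (min 1 ((R - dist x x0) / h))"

lemma cutoff_bounds: "0 \<le> cutoff x0 R h x" "cutoff x0 R h x \<le> 1"
  by (simp_all add: cutoff_def)

lemma cutoff_eq_0: "h > 0 \<Longrightarrow> x \<notin> ball x0 R \<Longrightarrow> cutoff x0 R h x = 0"
  by (auto simp: cutoff_def dist_commute not_less intro!: max_absorb1 min.coboundedI2 divide_nonpos_pos)

lemma cutoff_eq_1: "h > 0 \<Longrightarrow> x \<in> ball x0 (R - h) \<Longrightarrow> cutoff x0 R h x = 1"
  by (auto simp: cutoff_def dist_commute max_def min_def field_simps)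

lemma cutoff_measurable [measurable]: "cutoff x0 R h \<in> borel_measurable borel"
  unfolding cutoff_def[abs_def]
  by (cases "h = 0") (auto intro!: borel_measurable_continuous_onI continuous_intros)

lemma cutoff_lipschitz:
  assumes "h > 0"
  shows "\<bar>cutoff x0 R h y - cutoff x0 R h x\<bar> \<le> min 1 (dist y x / h)"
proof -
  have "\<bar>cutoff x0 R h y - cutoff x0 R h x\<bar> \<le> \<bar>(R - dist y x0) / h - (R - dist x x0) / h\<bar>"
    by (auto simp: cutoff_def max_def min_def)
  also have "\<dots> = \<bar>dist x x0 - dist y x0\<bar> / h"
    using assms by (simp add: diff_divide_distrib[symmetric])
  also have "\<dots> \<le> dist y x / h"
    using assms abs_dist_diff_le[of x x0 y] by (intro divide_right_mono) (auto simp: dist_commute)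
  finally show ?thesis using cutoff_bounds[of x0 R h x] cutoff_bounds[of x0 R h y] by auto
qed

context bounded_kernel begin

lemma incr_cutoff_le_trunc:
  assumes "h > 0"
  shows "(incr (cutoff x0 R h) p)\<^sup>2 \<le> trunc h p"
proof -
  have "(incr (cutoff x0 R h) p)\<^sup>2 \<le> (min 1 (dist (snd p) (fst p) / h))\<^sup>2"
    using power_mono[OF cutoff_lipschitz[OF assms, of x0 R "snd p" "fst p"], of 2]
    by (simp add: incr_def)
  also have "\<dots> \<le> trunc h p"
    using assms by (auto simp: trunc_def min_def power_divide field_simps)
  finally show ?thesis .
qed

lemma energy_cutoff:
  assumes "h > 0"
  shows "energy (cutoff x0 R h) \<le> ennreal (2 * c_U * h powr (- \<alpha>)) * emeasure lborel (ball x0 R)"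
proof -
  have "(incr (cutoff x0 R h) p)\<^sup>2 \<noteq> 0 \<Longrightarrow> fst p \<in> ball x0 R \<or> snd p \<in> ball x0 R" for p
    using cutoff_eq_0[OF assms, of "fst p" x0 R] cutoff_eq_0[OF assms, of "snd p" x0 R]
    by (cases "fst p \<in> ball x0 R"; cases "snd p \<in> ball x0 R") (auto simp: incr_def)
  then show ?thesis
    unfolding energy_def
    using nn_integral_trunc_set[of h "ball x0 R" "\<lambda>p. (incr (cutoff x0 R h) p)\<^sup>2" 1]
      assms incr_cutoff_le_trunc[OF assms] by simp
qed

lemma finite_energy_cutoff: "h > 0 \<Longrightarrow> finite_energy (cutoff x0 R h)"
  using energy_cutoff[of h x0 R] emeasure_lborel_ball_finite[of x0 R]
  by (auto simp: finite_energy_def ennreal_mult_less_top intro: le_less_trans)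

end

section \<open>A Faber-Krahn inequality uniform in the order\<close>

lemma nn_integral_lborel_translate:
  fixes f :: "'a::euclidean_space \<Rightarrow> ennreal"
  assumes [measurable]: "f \<in> borel_measurable borel"
  shows "(\<integral>\<^sup>+x. f (c + x) \<partial>lborel) = (\<integral>\<^sup>+x. f x \<partial>lborel)"
proof -
  have "(\<integral>\<^sup>+x. f x \<partial>lborel) = (\<integral>\<^sup>+x. f x \<partial>distr lborel borel ((+) c))"
    by (simp add: lborel_distr_plus)
  also have "\<dots> = (\<integral>\<^sup>+x. f (c + x) \<partial>lborel)"
    by (subst nn_integral_distr) auto
  finally show ?thesis by simp
qed

lemma nn_integral_lborel_scale:
  fixes f :: "'a::euclidean_space \<Rightarrow> ennreal"
  assumes [measurable]: "f \<in> borel_measurable borel" and "c > 0"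
  shows "(\<integral>\<^sup>+x. f x \<partial>lborel) = ennreal (c ^ DIM('a)) * (\<integral>\<^sup>+x. f (c *\<^sub>R x) \<partial>lborel)"
  using assms(2)
  by (subst lborel_affine[of c 0])
     (simp_all add: nn_integral_density nn_integral_distr nn_integral_cmult)

text \<open>Substituting y = x + h writes the fractional energy as an integral of |h|^(-d-\<alpha>)
  times this squared L^2 modulus of translation.\<close>

definition shift_energy :: "('a::euclidean_space \<Rightarrow> real) \<Rightarrow> 'a \<Rightarrow> ennreal" where
  "shift_energy u h = (\<integral>\<^sup>+x. ennreal ((u (x + h) - u x)\<^sup>2) \<partial>lborel)"

definition frac_const :: "real \<Rightarrow> real \<Rightarrow> real" where
  "frac_const d \<alpha> = 2 powr \<alpha> * Gamma ((d + \<alpha>) / 2) / (pi powr (d / 2) * \<bar>Gamma (- \<alpha> / 2)\<bar>)"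

context
  fixes u :: "'a::euclidean_space \<Rightarrow> real"
  assumes u [measurable]: "u \<in> borel_measurable borel"
begin

lemma shift_energy_measurable [measurable]: "shift_energy u \<in> borel_measurable borel"
proof -
  have "(\<lambda>(h, x). ennreal ((u (x + h) - u x)\<^sup>2)) \<in> borel_measurable (borel \<Otimes>\<^sub>M lborel)"
    by measurable
  from lborel.borel_measurable_nn_integral[OF this] show ?thesis
    by (simp add: shift_energy_def[abs_def])
qed

text \<open>The triangle inequality over two successive shifts. The factor 4 is the quadratic growth
  of a smooth modulus, and it is what competes with the weight |h|^(-d-\<alpha>) for \<alpha> below
  2.\<close>

lemma shift_energy_double: "shift_energy u (2 *\<^sub>R h) \<le> 4 * shift_energy u h"
proof -
  have "shift_energy u (2 *\<^sub>R h) \<le> (\<integral>\<^sup>+x. 2 * ennreal ((u (h + x + h) - u (h + x))\<^sup>2) + 2 * ennreal ((u (x + h) - u x)\<^sup>2) \<partial>lborel)"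
    unfolding shift_energy_def
  proof (intro nn_integral_mono)
    fix x
    let ?a = "u (x + 2 *\<^sub>R h)" and ?b = "u (h + x)" and ?c = "u x"
    have "(?a - ?c)\<^sup>2 \<le> 2 * (?a - ?b)\<^sup>2 + 2 * (?b - ?c)\<^sup>2"
      using zero_le_power2[of "(?a - ?b) - (?b - ?c)"] by (simp add: power2_eq_square algebra_simps)
    then have "ennreal ((?a - ?c)\<^sup>2) \<le> ennreal (2 * (?a - ?b)\<^sup>2 + 2 * (?b - ?c)\<^sup>2)"
      by (rule ennreal_leI)
    then show "ennreal ((?a - ?c)\<^sup>2)
        \<le> 2 * ennreal ((u (h + x + h) - u (h + x))\<^sup>2) + 2 * ennreal ((u (x + h) - u x)\<^sup>2)"
      by (simp add: ennreal_mult scaleR_2 add_ac)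
  qed
  also have "\<dots> = 2 * (\<integral>\<^sup>+x. ennreal ((u (h + x + h) - u (h + x))\<^sup>2) \<partial>lborel) + 2 * shift_energy u h"
    by (subst nn_integral_add) (simp_all add: nn_integral_cmult shift_energy_def)
  also have "(\<integral>\<^sup>+x. ennreal ((u (h + x + h) - u (h + x))\<^sup>2) \<partial>lborel) = shift_energy u h"
    unfolding shift_energy_def by (rule nn_integral_lborel_translate) measurable
  also have "2 * shift_energy u h + 2 * shift_energy u h = 4 * shift_energy u h"
    by (simp add: distrib_right[symmetric])
  finally show ?thesis .
qed

text \<open>For fixed x, every shift that moves x out of S contributes the full value u(x)^2, and
  the shifts that fail to do so fill only a translate of S.\<close>

lemma shift_energy_annulus:
  assumes [measurable]: "S \<in> sets borel" "A \<in> sets borel" and S: "\<And>x. x \<notin> S \<Longrightarrow> u x = 0"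
    and fin: "emeasure lborel S < \<infinity>"
  shows "(emeasure lborel A - emeasure lborel S) * (\<integral>\<^sup>+x. ennreal ((u x)\<^sup>2) \<partial>lborel)
     \<le> (\<integral>\<^sup>+h. indicator A h * shift_energy u h \<partial>lborel)"
proof -
  have "(emeasure lborel A - emeasure lborel S) * (\<integral>\<^sup>+x. ennreal ((u x)\<^sup>2) \<partial>lborel)
      = (\<integral>\<^sup>+x. (emeasure lborel A - emeasure lborel S) * ennreal ((u x)\<^sup>2) \<partial>lborel)"
    by (simp add: nn_integral_cmult)
  also have "\<dots> \<le> (\<integral>\<^sup>+x. \<integral>\<^sup>+h. indicator A h * ennreal ((u (x + h) - u x)\<^sup>2) \<partial>lborel \<partial>lborel)"
  proof (intro nn_integral_mono)
    fix x
    define S' where "S' = (\<lambda>h. x + h) -` S"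
    have S'm [measurable]: "S' \<in> sets borel"
    proof -
      have "(\<lambda>h. x + h) \<in> borel_measurable borel" by measurable
      from measurable_sets[OF this assms(1)] show ?thesis unfolding S'_def space_borel Int_UNIV_right .
    qed
    have "emeasure lborel S' = (\<integral>\<^sup>+h. indicator S (x + h) \<partial>lborel)"
      by (subst nn_integral_indicator[symmetric], simp)
         (auto simp: S'_def indicator_def intro!: nn_integral_cong)
    also have "\<dots> = emeasure lborel S"
      by (subst nn_integral_lborel_translate) auto
    finally have eS: "emeasure lborel S' = emeasure lborel S" .
    have "(emeasure lborel A - emeasure lborel S) * ennreal ((u x)\<^sup>2)
        \<le> emeasure lborel (A - S') * ennreal ((u x)\<^sup>2)"
    proof (rule mult_right_mono)
      have "emeasure lborel A \<le> emeasure lborel (A - S') + emeasure lborel S"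
        unfolding eS[symmetric]
        by (rule order_trans[OF emeasure_mono[of A "(A - S') \<union> S'"] emeasure_subadditive]) auto
      then show "emeasure lborel A - emeasure lborel S \<le> emeasure lborel (A - S')"
        using fin by (auto simp: ennreal_minus_le_iff add.commute)
    qed simp
    also have "\<dots> = (\<integral>\<^sup>+h. indicator (A - S') h * ennreal ((u x)\<^sup>2) \<partial>lborel)"
      by (subst nn_integral_multc) auto
    also have "\<dots> \<le> (\<integral>\<^sup>+h. indicator A h * ennreal ((u (x + h) - u x)\<^sup>2) \<partial>lborel)"
      using S by (intro nn_integral_mono) (auto simp: indicator_def S'_def)
    finally show "(emeasure lborel A - emeasure lborel S) * ennreal ((u x)\<^sup>2)
       \<le> (\<integral>\<^sup>+h. indicator A h * ennreal ((u (x + h) - u x)\<^sup>2) \<partial>lborel)" .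
  qed
  also have "\<dots> = (\<integral>\<^sup>+h. \<integral>\<^sup>+x. indicator A h * ennreal ((u (x + h) - u x)\<^sup>2) \<partial>lborel \<partial>lborel)"
    by (rule lborel_pair.Fubini') measurable
  also have "\<dots> = (\<integral>\<^sup>+h. indicator A h * shift_energy u h \<partial>lborel)"
    by (simp add: nn_integral_cmult shift_energy_def)
  finally show ?thesis .
qed

definition radial_energy :: "real \<Rightarrow> 'a set \<Rightarrow> ennreal" where
  "radial_energy \<alpha> A = (\<integral>\<^sup>+h. indicator A h * (ennreal (norm h powr (- real DIM('a) - \<alpha>)) * shift_energy u h) \<partial>lborel)"

text \<open>Halving the radius loses only the factor \<^term>\<open>2 powr (\<alpha> - 2)\<close>, which is what
  turns the factor \<^term>\<open>2 - \<alpha>\<close> of the normalised kernel into an estimate uniform as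
  \<^term>\<open>\<alpha>\<close> tends to 2.\<close>
lemma radial_energy_halve:
  assumes "R > 0"
  shows "ennreal (2 powr (\<alpha> - 2)) * radial_energy \<alpha> (cball 0 R) \<le> radial_energy \<alpha> (cball 0 (R / 2))"
proof -
  let ?d = "real DIM('a)"
  have "ennreal (2 powr (\<alpha> - 2)) * radial_energy \<alpha> (cball 0 R)
      = ennreal (2 powr (\<alpha> - 2)) * (\<integral>\<^sup>+h. indicator (cball 0 R) h * (ennreal (norm h powr (- ?d - \<alpha>)) * shift_energy u h) \<partial>lborel)"
    by (simp add: radial_energy_def)
  also have "\<dots> = (\<integral>\<^sup>+h. indicator (cball 0 R) h * (ennreal (2 powr (\<alpha> - 2) * norm h powr (- ?d - \<alpha>)) * shift_energy u h) \<partial>lborel)"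
    by (subst nn_integral_cmult[symmetric], measurable) (simp add: ennreal_mult mult_ac)
  also have "\<dots> \<le> (\<integral>\<^sup>+h. ennreal ((1/2) ^ DIM('a)) * (indicator (cball 0 (R/2)) ((1/2) *\<^sub>R h) * (ennreal (norm ((1/2) *\<^sub>R h) powr (- ?d - \<alpha>)) * shift_energy u ((1/2) *\<^sub>R h))) \<partial>lborel)"
  proof (intro nn_integral_mono)
    fix h :: 'a
    have "shift_energy u h \<le> 4 * shift_energy u ((1/2) *\<^sub>R h)"
      using shift_energy_double[of "(1/2) *\<^sub>R h"] by simp
    then have "ennreal (2 powr (\<alpha> - 2) * norm h powr (- ?d - \<alpha>)) * shift_energy u h
      \<le> ennreal (2 powr (\<alpha> - 2) * norm h powr (- ?d - \<alpha>)) * (4 * shift_energy u ((1/2) *\<^sub>R h))"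
      by (rule mult_left_mono) simp
    also have "\<dots> = ennreal (2 powr (\<alpha> - 2) * norm h powr (- ?d - \<alpha>) * 4) * shift_energy u ((1/2) *\<^sub>R h)"
      by (simp add: ennreal_mult mult_ac)
    \<comment> \<open>The factor (1/2)^d is split off as the Jacobian of the scaling by 1/2 that
      ends the proof.\<close>
    also have "2 powr (\<alpha> - 2) * norm h powr (- ?d - \<alpha>) * 4
       = (1/2) ^ DIM('a) * norm ((1/2) *\<^sub>R h) powr (- ?d - \<alpha>)"
    proof -
      have 1: "norm ((1/2) *\<^sub>R h) powr (- ?d - \<alpha>) = (1/2) powr (- ?d - \<alpha>) * norm h powr (- ?d - \<alpha>)"
        by (simp add: powr_mult[symmetric])
      have "(1/2) ^ DIM('a) * (1/2) powr (- ?d - \<alpha>) = (1/2 :: real) powr (- \<alpha>)"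
        by (subst powr_realpow[symmetric]) (simp_all add: powr_add[symmetric])
      also have "\<dots> = 2 powr (\<alpha> - 2) * 4"
        by (simp add: powr_diff powr_divide powr_minus field_simps)
      finally have 2: "(1/2) ^ DIM('a) * (1/2) powr (- ?d - \<alpha>) = 2 powr (\<alpha> - 2) * 4" .
      show ?thesis unfolding 1 mult.assoc[symmetric] 2 by (simp only: mult_ac)
    qed
    finally have "ennreal (2 powr (\<alpha> - 2) * norm h powr (- ?d - \<alpha>)) * shift_energy u h
        \<le> ennreal ((1/2) ^ DIM('a)) * (ennreal (norm ((1/2) *\<^sub>R h) powr (- ?d - \<alpha>)) * shift_energy u ((1/2) *\<^sub>R h))"
      by (simp add: ennreal_mult mult.assoc)
    then show "indicator (cball 0 R) h * (ennreal (2 powr (\<alpha> - 2) * norm h powr (- ?d - \<alpha>)) * shift_energy u h)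
      \<le> ennreal ((1/2) ^ DIM('a)) * (indicator (cball 0 (R/2)) ((1/2) *\<^sub>R h) * (ennreal (norm ((1/2) *\<^sub>R h) powr (- ?d - \<alpha>)) * shift_energy u ((1/2) *\<^sub>R h)))"
      by (auto simp: indicator_def)
  qed
  also have "\<dots> = radial_energy \<alpha> (cball 0 (R / 2))"
    unfolding radial_energy_def
    by (subst nn_integral_lborel_scale[of _ "1/2"]) (auto simp: nn_integral_cmult)
  finally show ?thesis .
qed

text \<open>Here the factor 2 - \<alpha> appears. By \<open>radial_energy_halve\<close> the inner
  ball carries at least the share 2^(\<alpha>-2) of the energy, so the annulus carries at most the
  share 1 - 2^(\<alpha>-2), and convexity of the exponential bounds this by (2 - \<alpha>) ln 2
  \<le> 2 - \<alpha>.\<close>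

lemma radial_energy_annulus:
  assumes "R > 0" "\<alpha> < 2"
  shows "radial_energy \<alpha> (cball 0 R - cball 0 (R/2)) \<le> ennreal (2 - \<alpha>) * radial_energy \<alpha> (cball 0 R)"
proof (cases "radial_energy \<alpha> (cball 0 R) = \<infinity>")
  case True
  then show ?thesis using assms by (simp add: ennreal_mult_top)
next
  case False
  then obtain T where T: "radial_energy \<alpha> (cball 0 R) = ennreal T" "T \<ge> 0"
    by (cases "radial_energy \<alpha> (cball 0 R)") auto
  let ?I = "radial_energy \<alpha> (cball 0 R - cball 0 (R/2))"
  have "radial_energy \<alpha> (cball 0 R) = ?I + radial_energy \<alpha> (cball 0 (R/2))"
    unfolding radial_energy_def using assms
    by (subst nn_integral_add[symmetric]) (auto simp: indicator_def intro!: nn_integral_cong)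
  then have *: "?I + ennreal (2 powr (\<alpha> - 2)) * radial_energy \<alpha> (cball 0 R) \<le> radial_energy \<alpha> (cball 0 R)"
    using radial_energy_halve[OF assms(1), of \<alpha>] by (metis add_left_mono)
  then have "?I \<le> ennreal T" unfolding T(1)[symmetric] by (rule order_trans[rotated]) simp
  then obtain I where I: "?I = ennreal I" "I \<ge> 0"
    by (cases ?I) (auto simp: top_unique)
  have "I + 2 powr (\<alpha> - 2) * T \<le> T"
    using * T I by (simp add: ennreal_mult[symmetric] ennreal_plus[symmetric] del: ennreal_plus)
  moreover have "1 - 2 powr (\<alpha> - 2) \<le> 2 - \<alpha>"
  proof -
    have "1 + (\<alpha> - 2) * ln 2 \<le> 2 powr (\<alpha> - 2)"
      using exp_ge_add_one_self[of "(\<alpha> - 2) * ln 2"] by (simp add: powr_def)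
    moreover have "(2 - \<alpha>) * ln 2 \<le> (2 - \<alpha>) * 1"
      using assms ln_le_minus_one[of 2] by (intro mult_left_mono) auto
    ultimately show ?thesis by (simp add: algebra_simps)
  qed
  then have "(1 - 2 powr (\<alpha> - 2)) * T \<le> (2 - \<alpha>) * T" using T by (intro mult_right_mono)
  ultimately have "I \<le> (2 - \<alpha>) * T" by (simp add: algebra_simps)
  then show ?thesis using I T assms by (simp add: ennreal_mult[symmetric] ennreal_leI)
qed

lemma radial_energy_lower:
  assumes [measurable]: "S \<in> sets borel" and S: "\<And>x. x \<notin> S \<Longrightarrow> u x = 0"
    and fin: "emeasure lborel S < \<infinity>" and "R > 0" "0 < \<alpha>" "\<alpha> < 2"
  shows "ennreal (R powr (- real DIM('a) - \<alpha>)) * ((emeasure lborel (cball 0 R - cball 0 (R/2) :: 'a set) - emeasure lborel S) * (\<integral>\<^sup>+x. ennreal ((u x)\<^sup>2) \<partial>lborel))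
     \<le> ennreal (2 - \<alpha>) * radial_energy \<alpha> UNIV"
proof -
  let ?A = "cball 0 R - cball 0 (R/2) :: 'a set"
  have "ennreal (R powr (- real DIM('a) - \<alpha>)) * ((emeasure lborel ?A - emeasure lborel S) * (\<integral>\<^sup>+x. ennreal ((u x)\<^sup>2) \<partial>lborel))
     \<le> ennreal (R powr (- real DIM('a) - \<alpha>)) * (\<integral>\<^sup>+h. indicator ?A h * shift_energy u h \<partial>lborel)"
    by (intro mult_left_mono shift_energy_annulus assms) auto
  also have "\<dots> = (\<integral>\<^sup>+h. indicator ?A h * (ennreal (R powr (- real DIM('a) - \<alpha>)) * shift_energy u h) \<partial>lborel)"
    by (subst nn_integral_cmult[symmetric], measurable) (simp add: mult_ac)
  also have "\<dots> \<le> radial_energy \<alpha> ?A"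
    unfolding radial_energy_def
  proof (intro nn_integral_mono)
    fix h :: 'a
    have "h \<in> ?A \<Longrightarrow> R powr (- real DIM('a) - \<alpha>) \<le> norm h powr (- real DIM('a) - \<alpha>)"
      using assms by (intro powr_mono2') auto
    then show "indicator ?A h * (ennreal (R powr (- real DIM('a) - \<alpha>)) * shift_energy u h)
       \<le> indicator ?A h * (ennreal (norm h powr (- real DIM('a) - \<alpha>)) * shift_energy u h)"
      by (auto simp: indicator_def intro!: mult_right_mono ennreal_leI)
  qed
  also have "\<dots> \<le> ennreal (2 - \<alpha>) * radial_energy \<alpha> (cball 0 R)"
    by (rule radial_energy_annulus) fact+
  also have "\<dots> \<le> ennreal (2 - \<alpha>) * radial_energy \<alpha> UNIV"
    unfolding radial_energy_def
    by (intro mult_left_mono nn_integral_mono) (auto simp: indicator_def)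
  finally show ?thesis .
qed

lemma energy_nn_frac_kernel:
  assumes "\<alpha> > 0"
  shows "energy_nn UNIV (frac_kernel \<alpha>) u = ennreal (frac_const (real DIM('a)) \<alpha>) * radial_energy \<alpha> UNIV"
proof -
  let ?d = "real DIM('a)"
  have c0: "frac_const (real DIM('a)) \<alpha> \<ge> 0" using assms
    unfolding frac_const_def by (intro divide_nonneg_nonneg mult_nonneg_nonneg) (auto intro!: less_imp_le[OF Gamma_real_pos])
  have fk: "frac_kernel \<alpha> x y = frac_const (real DIM('a)) \<alpha> * dist y x powr (- ?d - \<alpha>)" for x y :: 'a
    by (simp add: frac_kernel_def frac_const_def)
  have "energy_nn UNIV (frac_kernel \<alpha>) u
     = (\<integral>\<^sup>+x. \<integral>\<^sup>+y. ennreal ((u y - u x)\<^sup>2 * (frac_const (real DIM('a)) \<alpha> * dist y x powr (- ?d - \<alpha>))) \<partial>lborel \<partial>lborel)"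
    by (simp add: energy_nn_def nn_integral_completion fk)
  also have "\<dots> = (\<integral>\<^sup>+x. \<integral>\<^sup>+h. ennreal ((u (x + h) - u x)\<^sup>2 * (frac_const (real DIM('a)) \<alpha> * dist (x + h) x powr (- ?d - \<alpha>))) \<partial>lborel \<partial>lborel)"
    by (intro nn_integral_cong nn_integral_lborel_translate[symmetric]) measurable
  also have "\<dots> = (\<integral>\<^sup>+x. \<integral>\<^sup>+h. ennreal (frac_const (real DIM('a)) \<alpha>) * (ennreal (norm h powr (- ?d - \<alpha>)) * ennreal ((u (x + h) - u x)\<^sup>2)) \<partial>lborel \<partial>lborel)"
    using c0 by (simp add: ennreal_mult mult_ac dist_norm)
  also have "\<dots> = (\<integral>\<^sup>+h. \<integral>\<^sup>+x. ennreal (frac_const (real DIM('a)) \<alpha>) * (ennreal (norm h powr (- ?d - \<alpha>)) * ennreal ((u (x + h) - u x)\<^sup>2)) \<partial>lborel \<partial>lborel)"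
    by (rule lborel_pair.Fubini') measurable
  also have "\<dots> = ennreal (frac_const (real DIM('a)) \<alpha>) * radial_energy \<alpha> UNIV"
    by (simp add: radial_energy_def shift_energy_def nn_integral_cmult)
  finally show ?thesis .
qed

end

text \<open>The zero of the constant at \<alpha> = 2 comes from the pole of Gamma at -1. The
  functional equation extracts it: with a = \<alpha>/2, |Gamma(-a)| = Gamma(2 - a) / (a (1 - a)),
  and a (1 - a) = (\<alpha>/4) (2 - \<alpha>). What remains is continuous and positive on the
  compact interval from \<alpha>0 to 2, endpoint included, and its minimum is the constant.\<close>

lemma frac_const_lower:
  fixes d \<alpha>0 :: real
  assumes "d > 0" "0 < \<alpha>0" "\<alpha>0 < 2"
  shows "\<exists>c>0. \<forall>\<alpha>. \<alpha>0 \<le> \<alpha> \<longrightarrow> \<alpha> < 2 \<longrightarrow> c * (2 - \<alpha>) \<le> frac_const d \<alpha>"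
proof -
  define g where "g \<alpha> = 2 powr \<alpha> * Gamma ((d + \<alpha>) / 2) * (\<alpha> / 4) / (pi powr (d / 2) * Gamma (2 - \<alpha> / 2))" for \<alpha> :: real
  have not_nonpos: "x > 0 \<Longrightarrow> x \<notin> \<int>\<^sub>\<le>\<^sub>0" for x :: real
    by (auto elim!: nonpos_Ints_cases)
  have gpos: "g \<alpha> > 0" if "\<alpha>0 \<le> \<alpha>" "\<alpha> \<le> 2" for \<alpha>
    unfolding g_def using that assms by (intro divide_pos_pos mult_pos_pos Gamma_real_pos) auto
  have "continuous_on {\<alpha>0..2} g"
    unfolding g_def using assms
    by (intro continuous_intros continuous_on_compose2[OF continuous_on_Gamma[of "{0<..}"]])
       (auto simp: Gamma_eq_zero_iff not_nonpos)
  then obtain m where m: "m \<in> {\<alpha>0..2}" "\<And>\<alpha>. \<alpha> \<in> {\<alpha>0..2} \<Longrightarrow> g m \<le> g \<alpha>"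
    using continuous_attains_inf[of "{\<alpha>0..2}" g] assms by auto
  have eq: "frac_const d \<alpha> = g \<alpha> * (2 - \<alpha>)" if "\<alpha>0 \<le> \<alpha>" "\<alpha> < 2" for \<alpha>
  proof -
    define a where "a = \<alpha> / 2"
    have a: "0 < a" "a < 1" using that assms by (auto simp: a_def)
    have "- a \<notin> \<int>\<^sub>\<le>\<^sub>0"
      using a by (auto elim!: nonpos_Ints_cases simp: minus_equation_iff[of a])
    then have "Gamma (1 - a) = - a * Gamma (- a)" using Gamma_plus1[of "-a"] by simp
    moreover have "Gamma (2 - a) = (1 - a) * Gamma (1 - a)"
      using Gamma_plus1[of "1 - a"] not_nonpos[of "1 - a"] a by simp
    moreover have "Gamma (1 - a) > 0" using a by (intro Gamma_real_pos) auto
    ultimately have "\<bar>Gamma (- a)\<bar> = Gamma (2 - a) / (a * (1 - a))"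
      using a by (simp add: field_simps abs_if zero_less_mult_iff mult_less_0_iff)
    then have "frac_const d \<alpha> = 2 powr \<alpha> * Gamma ((d + \<alpha>) / 2) / (pi powr (d / 2) * (Gamma (2 - a) / (a * (1 - a))))"
      by (simp add: frac_const_def a_def)
    also have "\<dots> = g \<alpha> * (2 - \<alpha>)"
      using a by (simp add: g_def a_def divide_simps) 
    finally show ?thesis .
  qed
  show ?thesis
    using gpos[of m] m by (intro exI[of _ "g m"]) (auto simp: eq intro!: mult_right_mono)
qed

text \<open>(E_\<ge>) speaks of balls only; the balls of radius n exhaust the space and monotone
  convergence carries the inequality over.\<close>

lemma energy_nn_UNIV_mono:
  fixes u :: "'a::euclidean_space \<Rightarrow> real"
  assumes [measurable]: "u \<in> borel_measurable borel" and "(\<integral>\<^sup>+x. ennreal ((u x)\<^sup>2) \<partial>lborel) < \<infinity>"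
    and E: "cond_E_ge \<alpha> c_l k"
  shows "ennreal c_l * energy_nn UNIV (frac_kernel \<alpha>) u \<le> energy_nn UNIV k u"
proof -
  define g :: "'a \<Rightarrow> 'a \<Rightarrow> ennreal" where "g x y = ennreal ((u y - u x)\<^sup>2 * frac_kernel \<alpha> x y)" for x y
  have [measurable]: "(\<lambda>(x, y). g x y) \<in> borel_measurable (borel \<Otimes>\<^sub>M borel)"
    unfolding g_def frac_kernel_def by measurable
  define f where "f n p = indicator (ball 0 (real n)) (fst p) * indicator (ball 0 (real n)) (snd p) * g (fst p) (snd p)" for n p
  have f_meas [measurable]: "f n \<in> borel_measurable (lborel \<Otimes>\<^sub>M lborel)" for n
    unfolding f_def by measurable
  have f_eq: "energy_nn (ball 0 (real n)) (frac_kernel \<alpha>) u = (\<integral>\<^sup>+p. f n p \<partial>(lborel \<Otimes>\<^sub>M lborel))" for n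
  proof -
    have "(\<integral>\<^sup>+p. f n p \<partial>(lborel \<Otimes>\<^sub>M lborel)) = (\<integral>\<^sup>+x. \<integral>\<^sup>+y. f n (x, y) \<partial>lborel \<partial>lborel)"
      by (rule lborel.nn_integral_fst[symmetric]) measurable
    also have "\<dots> = (\<integral>\<^sup>+x. indicator (ball 0 (real n)) x * (\<integral>\<^sup>+y. indicator (ball 0 (real n)) y * g x y \<partial>lborel) \<partial>lborel)"
      unfolding f_def fst_conv snd_conv mult.assoc
      by (intro nn_integral_cong nn_integral_cmult) measurable
    finally show ?thesis by (simp add: energy_nn_def nn_integral_completion g_def)
  qed
  have "incseq f"
    by (auto simp: incseq_def le_fun_def f_def indicator_def)
  have "(SUP n. f n p) = g (fst p) (snd p)" for p
  proof (rule antisym)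
    show "(SUP n. f n p) \<le> g (fst p) (snd p)"
      by (rule SUP_least) (auto simp: f_def indicator_def)
    obtain n :: nat where "max (norm (fst p)) (norm (snd p)) < real n" using reals_Archimedean2 by blast
    then have "f n p = g (fst p) (snd p)" by (simp add: f_def)
    then show "g (fst p) (snd p) \<le> (SUP n. f n p)" by (metis SUP_upper UNIV_I)
  qed
  then have "(\<integral>\<^sup>+p. g (fst p) (snd p) \<partial>(lborel \<Otimes>\<^sub>M lborel)) = (SUP n. \<integral>\<^sup>+p. f n p \<partial>(lborel \<Otimes>\<^sub>M lborel))"
    using nn_integral_monotone_convergence_SUP[OF \<open>incseq f\<close>, of "lborel \<Otimes>\<^sub>M lborel"] by simp
  also have "(\<integral>\<^sup>+p. g (fst p) (snd p) \<partial>(lborel \<Otimes>\<^sub>M lborel)) = energy_nn UNIV (frac_kernel \<alpha>) u"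
    by (subst lborel.nn_integral_fst[symmetric], measurable) (simp add: energy_nn_def nn_integral_completion g_def)
  finally have "ennreal c_l * energy_nn UNIV (frac_kernel \<alpha>) u
      = (SUP n. ennreal c_l * energy_nn (ball 0 (real n)) (frac_kernel \<alpha>) u)"
    by (simp add: f_eq SUP_mult_left_ennreal)
  also have "\<dots> \<le> energy_nn UNIV k u"
  proof (rule SUP_least)
    fix n :: nat
    show "ennreal c_l * energy_nn (ball 0 (real n)) (frac_kernel \<alpha>) u \<le> energy_nn UNIV k u"
    \<comment> \<open>The ball of radius 0 is empty and outside the scope of (E_\<ge>), which asks
      for r > 0.\<close>
    proof (cases "n = 0")
      case True then show ?thesis by (simp add: energy_nn_def)
    next
      case False
      have "L2_on (ball 0 (real n)) u"
        unfolding L2_on_def nn_integral_completion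
        using assms(2) by (auto intro!: measurable_completion le_less_trans[OF nn_integral_mono assms(2)[unfolded infinity_ennreal_def]] simp: indicator_def)
      then have "ennreal c_l * energy_nn (ball 0 (real n)) (frac_kernel \<alpha>) u \<le> energy_nn (ball 0 (real n)) k u"
        using E False unfolding cond_E_ge_def by auto
      also have "\<dots> \<le> energy_nn UNIV k u"
        unfolding energy_nn_def by (intro nn_integral_mono mult_mono) (auto simp: indicator_def)
      finally show ?thesis .
    qed
  qed
  finally show ?thesis .
qed

lemma annulus_volume:
  assumes "R > 0"
  shows "emeasure lborel (cball 0 R - cball 0 (R/2) :: 'a::euclidean_space set)
     = ennreal (unit_ball_vol (real DIM('a)) * (1 - (1/2) ^ DIM('a)) * R ^ DIM('a))"
proof -
  have "emeasure lborel (cball 0 R - cball 0 (R/2) :: 'a set) = emeasure lborel (cball 0 R :: 'a set) - emeasure lborel (cball 0 (R/2) :: 'a set)"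
    using assms by (intro emeasure_Diff) (auto simp: emeasure_cball)
  also have "\<dots> = ennreal (unit_ball_vol (real DIM('a)) * R ^ DIM('a) - unit_ball_vol (real DIM('a)) * (R/2) ^ DIM('a))"
    using assms by (simp add: emeasure_cball ennreal_minus)
  also have "unit_ball_vol (real DIM('a)) * R ^ DIM('a) - unit_ball_vol (real DIM('a)) * (R/2) ^ DIM('a)
     = unit_ball_vol (real DIM('a)) * (1 - (1/2) ^ DIM('a)) * R ^ DIM('a)"
    by (simp add: power_divide algebra_simps)
  finally show ?thesis .
qed

text \<open>Take R so that the annulus of outer radius R has twice the volume of S. Then
  \<open>radial_energy_lower\<close> controls |S| times the squared L^2 norm by (2 - \<alpha>) times
  the radial energy, and this factor cancels against the lower bound c (2 - \<alpha>) for the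
  normalising constant. What is left is free of \<alpha>.\<close>

lemma faber_krahn:
  fixes \<alpha>0 c_l :: real
  assumes "0 < \<alpha>0" "\<alpha>0 < 2" "c_l > 0"
  shows "\<exists>C>0. \<forall>\<alpha> (k :: 'a \<Rightarrow> 'a \<Rightarrow> real) (u :: 'a::euclidean_space \<Rightarrow> real) S. \<alpha>0 \<le> \<alpha> \<longrightarrow> \<alpha> < 2 \<longrightarrow> cond_E_ge \<alpha> c_l k \<longrightarrow>
     u \<in> borel_measurable borel \<longrightarrow> S \<in> sets borel \<longrightarrow> (\<forall>x. x \<notin> S \<longrightarrow> u x = 0) \<longrightarrow>
     emeasure lborel S < \<infinity> \<longrightarrow> measure lborel S > 0 \<longrightarrow> (\<integral>\<^sup>+x. ennreal ((u x)\<^sup>2) \<partial>lborel) < \<infinity> \<longrightarrow>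
     (\<integral>\<^sup>+x. ennreal ((u x)\<^sup>2) \<partial>lborel)
       \<le> ennreal (C * measure lborel S powr (\<alpha> / real DIM('a))) * energy_nn UNIV k u"
proof -
  let ?d = "real DIM('a)"
  obtain c where c: "c > 0" "\<And>\<alpha>. \<alpha>0 \<le> \<alpha> \<Longrightarrow> \<alpha> < 2 \<Longrightarrow> c * (2 - \<alpha>) \<le> frac_const ?d \<alpha>"
    using frac_const_lower[of ?d \<alpha>0] assms by auto
  define \<omega> where "\<omega> = unit_ball_vol ?d * (1 - (1/2) ^ DIM('a))"
  have \<omega>: "\<omega> > 0" unfolding \<omega>_def by (intro mult_pos_pos) (auto simp: power_less_one_iff)
  \<comment> \<open>K^2 dominates (2 / \<omega>)^(\<alpha>/d) for all \<alpha> < 2 at once.\<close>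
  define K where "K = max 1 (2 / \<omega>)"
  have K: "K \<ge> 1" by (simp add: K_def)
  define C where "C = 2 * K powr 2 / (c_l * c * \<omega>)"
  have C: "C > 0" using assms c \<omega> K by (simp add: C_def)
  show ?thesis
  proof (intro exI[of _ C] conjI C allI impI)
    fix \<alpha> :: real and k :: "'a \<Rightarrow> 'a \<Rightarrow> real" and u :: "'a \<Rightarrow> real" and S
    assume \<alpha>: "\<alpha>0 \<le> \<alpha>" "\<alpha> < 2" and E: "cond_E_ge \<alpha> c_l k" and [measurable]: "u \<in> borel_measurable borel" "S \<in> sets borel"
      and S: "\<forall>x. x \<notin> S \<longrightarrow> u x = 0" "emeasure lborel S < \<infinity>" "measure lborel S > 0"
      and fin: "(\<integral>\<^sup>+x. ennreal ((u x)\<^sup>2) \<partial>lborel) < \<infinity>"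
    let ?I = "\<integral>\<^sup>+x. ennreal ((u x)\<^sup>2) \<partial>lborel"
    define m where "m = measure lborel S"
    have m: "m > 0" "emeasure lborel S = ennreal m" using S by (simp_all add: m_def emeasure_eq_ennreal_measure)
    define R where "R = (2 * m / \<omega>) powr (1 / ?d)"
    have R: "R > 0" using m \<omega> by (simp add: R_def)
    have Rd: "\<omega> * R ^ DIM('a) = 2 * m"
      using m \<omega> by (simp add: R_def powr_realpow[symmetric] powr_powr)
    have "ennreal (R powr (- ?d - \<alpha>)) * ((emeasure lborel (cball 0 R - cball 0 (R/2) :: 'a set) - emeasure lborel S) * ?I)
        \<le> ennreal (2 - \<alpha>) * radial_energy u \<alpha> UNIV"
      using S R \<alpha> assms by (intro radial_energy_lower) auto
    also have "emeasure lborel (cball 0 R - cball 0 (R/2) :: 'a set) - emeasure lborel S = ennreal m"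
      using R Rd m by (simp add: annulus_volume \<omega>_def ennreal_minus)
    finally have 1: "ennreal (R powr (- ?d - \<alpha>)) * (ennreal m * ?I) \<le> ennreal (2 - \<alpha>) * radial_energy u \<alpha> UNIV" .
    have "ennreal (c_l * c * (R powr (- ?d - \<alpha>) * m)) * ?I = ennreal c_l * (ennreal c * (ennreal (R powr (- ?d - \<alpha>)) * (ennreal m * ?I)))"
      using assms c m by (simp add: ennreal_mult mult.assoc)
    also have "\<dots> \<le> ennreal c_l * (ennreal c * (ennreal (2 - \<alpha>) * radial_energy u \<alpha> UNIV))"
      by (intro mult_left_mono 1) auto
    also have "\<dots> = ennreal c_l * (ennreal (c * (2 - \<alpha>)) * radial_energy u \<alpha> UNIV)"
      using c \<alpha> by (simp add: ennreal_mult mult.assoc)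
    also have "\<dots> \<le> ennreal c_l * (ennreal (frac_const ?d \<alpha>) * radial_energy u \<alpha> UNIV)"
      using c(2)[OF \<alpha>] by (intro mult_left_mono mult_right_mono ennreal_leI) auto
    also have "\<dots> = ennreal c_l * energy_nn UNIV (frac_kernel \<alpha>) u"
      using \<alpha> assms by (subst energy_nn_frac_kernel) auto
    also have "\<dots> \<le> energy_nn UNIV k u"
      by (rule energy_nn_UNIV_mono) (use fin E in auto)
    finally have 2: "ennreal (c_l * c * (R powr (- ?d - \<alpha>) * m)) * ?I \<le> energy_nn UNIV k u" .
    have Rm: "R powr (- ?d - \<alpha>) * m = R powr (- \<alpha>) * (\<omega> / 2)"
    proof -
      have "m = \<omega> / 2 * R powr ?d" using Rd R by (simp add: powr_realpow)
      then have "R powr (- ?d - \<alpha>) * m = \<omega> / 2 * (R powr ?d * R powr (- ?d - \<alpha>))" by simp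
      then show ?thesis by (simp add: powr_add[symmetric])
    qed
    have 3: "C * m powr (\<alpha> / ?d) * (c_l * c * (R powr (- ?d - \<alpha>) * m)) = K powr 2 * (m powr (\<alpha> / ?d) * R powr (- \<alpha>))"
      unfolding Rm using assms c \<omega> by (simp add: C_def)
    have "m powr (\<alpha> / ?d) * R powr (- \<alpha>) = (2 / \<omega>) powr (- \<alpha> / ?d)"
      using m \<omega> by (simp add: R_def powr_powr powr_mult powr_divide powr_minus field_simps)
    also have "\<dots> = inverse ((2 / \<omega>) powr (\<alpha> / ?d))" by (simp add: powr_minus)
    also have "\<dots> \<ge> inverse (K powr 2)"
    proof -
      have "(2 / \<omega>) powr (\<alpha> / ?d) \<le> K powr (\<alpha> / ?d)"
        using \<omega> \<alpha> assms by (intro powr_mono2) (auto simp: K_def)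
      also have "\<dots> \<le> K powr 2"
      proof (rule powr_mono[OF _ K])
        have "\<alpha> / ?d \<le> \<alpha> / 1" using \<alpha> assms by (intro divide_left_mono) auto
        then show "\<alpha> / ?d \<le> 2" using \<alpha> by simp
      qed
      finally show ?thesis using \<omega> by (intro le_imp_inverse_le) auto
    qed
    finally have "1 \<le> K powr 2 * (m powr (\<alpha> / ?d) * R powr (- \<alpha>))"
      using K by (simp add: field_simps)
    then have 4: "1 \<le> C * m powr (\<alpha> / ?d) * (c_l * c * (R powr (- ?d - \<alpha>) * m))" by (simp only: 3)
    have "?I = 1 * ?I" by simp
    also have "\<dots> \<le> ennreal (C * m powr (\<alpha> / ?d) * (c_l * c * (R powr (- ?d - \<alpha>) * m))) * ?I"
      using 4 by (intro mult_right_mono) (auto simp: ennreal_1[symmetric] simp del: ennreal_1 intro!: ennreal_leI)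
    also have "\<dots> = ennreal (C * m powr (\<alpha> / ?d)) * (ennreal (c_l * c * (R powr (- ?d - \<alpha>) * m)) * ?I)"
      using C assms c m by (subst ennreal_mult) (auto simp: mult.assoc)
    also have "\<dots> \<le> ennreal (C * m powr (\<alpha> / ?d)) * energy_nn UNIV k u"
      by (intro mult_left_mono 2) auto
    finally show "?I \<le> ennreal (C * measure lborel S powr (\<alpha> / ?d)) * energy_nn UNIV k u"
      by (simp add: m_def)
  qed
qed

section \<open>The first De Giorgi lemma\<close>

text \<open>The threshold below which a_(i+1) \<le> C 16^i a_i^(1+\<beta>) forces decay like
  \<gamma>^i with \<gamma> = 16^(-1/\<beta>): it solves C \<epsilon>^\<beta> = \<gamma>, and 16
  \<gamma>^\<beta> = 1 then reproduces the bound at each step. The cap at 1 lets a power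
  a^(\<alpha>/d) of a scaled measure be replaced by a^(\<alpha>0/d).\<close>

definition degiorgi_eps :: "real \<Rightarrow> real \<Rightarrow> real" where
  "degiorgi_eps C \<beta> = min 1 ((16 powr (- 1 / \<beta>) / C) powr (1 / \<beta>))"

lemma degiorgi_eps_pos: "C > 0 \<Longrightarrow> degiorgi_eps C \<beta> > 0"
  by (simp add: degiorgi_eps_def)

lemma degiorgi_iteration:
  fixes a :: "nat \<Rightarrow> real"
  assumes "C > 0" "\<beta> > 0" and nonneg: "\<And>i. a i \<ge> 0"
    and step: "\<And>i. a (Suc i) \<le> C * 16 ^ i * a i powr (1 + \<beta>)"
    and "a 0 \<le> degiorgi_eps C \<beta>"
  shows "a \<longlonglongrightarrow> 0"
proof -
  define \<gamma> where "\<gamma> = (16::real) powr (- 1 / \<beta>)"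
  define \<epsilon> where "\<epsilon> = (\<gamma> / C) powr (1 / \<beta>)"
  have \<gamma>: "0 < \<gamma>" "\<gamma> < 1" using \<open>\<beta> > 0\<close> by (auto simp: \<gamma>_def powr_less_one)
  have \<epsilon>: "\<epsilon> > 0" "C * \<epsilon> powr \<beta> = \<gamma>"
    using \<gamma> assms by (auto simp: \<epsilon>_def powr_powr)
  have \<gamma>\<beta>: "16 * \<gamma> powr \<beta> = 1"
    unfolding \<gamma>_def powr_powr using \<open>\<beta> > 0\<close> by simp
  have bound: "a i \<le> \<epsilon> * \<gamma> ^ i" for i
  proof (induction i)
    case 0
    then show ?case using assms(5) by (simp add: degiorgi_eps_def \<epsilon>_def \<gamma>_def)
  next
    case (Suc i)
    have "a (Suc i) \<le> C * 16 ^ i * a i powr (1 + \<beta>)" by (rule step)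
    also have "\<dots> \<le> C * 16 ^ i * (\<epsilon> * \<gamma> ^ i) powr (1 + \<beta>)"
      using assms nonneg Suc by (intro mult_left_mono powr_mono2) auto
    also have "(\<epsilon> * \<gamma> ^ i) powr (1 + \<beta>) = \<epsilon> * \<gamma> ^ i * (\<epsilon> powr \<beta> * (\<gamma> powr \<beta>) ^ i)"
    proof -
      have "(\<gamma> ^ i) powr \<beta> = (\<gamma> powr \<beta>) ^ i"
        using \<gamma> by (simp add: powr_realpow[symmetric] powr_powr mult.commute)
      then show ?thesis using \<gamma> \<epsilon> by (simp add: powr_add powr_mult)
    qed
    also have "C * 16 ^ i * (\<epsilon> * \<gamma> ^ i * (\<epsilon> powr \<beta> * (\<gamma> powr \<beta>) ^ i))
        = \<epsilon> * \<gamma> ^ i * (C * \<epsilon> powr \<beta>) * (16 * \<gamma> powr \<beta>) ^ i"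
      by (simp add: power_mult_distrib)
    also have "\<dots> = \<epsilon> * \<gamma> ^ Suc i" using \<epsilon> \<gamma>\<beta> by simp
    finally show ?case .
  qed
  have "(\<lambda>i. \<epsilon> * \<gamma> ^ i) \<longlonglongrightarrow> \<epsilon> * 0"
    using \<gamma> by (intro tendsto_mult tendsto_const LIMSEQ_power_zero) auto
  then show ?thesis
    by (intro tendsto_sandwich[of "\<lambda>_. 0" a sequentially "\<lambda>i. \<epsilon> * \<gamma> ^ i"]) (use nonneg bound in auto)
qed

section \<open>Picone's identity for the jump form\<close>

context bounded_kernel begin

lemma finite_energy_inverse:
  assumes v: "finite_energy v" and "s > 0" "\<And>x. s \<le> v x"
  shows "finite_energy (\<lambda>x. 1 / v x)"
proof (rule finite_energy_lipschitz[OF _ v, of _ "1 / s\<^sup>2"])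
  show "(\<lambda>x. 1 / v x) \<in> borel_measurable borel" using v by measurable
  fix x y
  have pos: "v x > 0" "v y > 0" using assms(2) assms(3)[of x] assms(3)[of y] by linarith+
  have "\<bar>1 / v x - 1 / v y\<bar> = \<bar>v x - v y\<bar> / (v x * v y)"
    using pos by (simp add: divide_simps abs_mult abs_minus_commute)
  also have "\<dots> \<le> \<bar>v x - v y\<bar> / s\<^sup>2"
    using assms pos by (intro divide_left_mono) (auto simp: power2_eq_square intro!: mult_mono)
  finally show "\<bar>1 / v x - 1 / v y\<bar> \<le> 1 / s\<^sup>2 * \<bar>v x - v y\<bar>" by simp
qed

text \<open>Clearing denominators shows pointwise that \<open>Q p\<close> is (incr \<eta>)^2 - incr
  v * incr \<zeta>; the bound s keeps 1 / v Lipschitz in v, so that \<open>\<zeta>\<close> has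
  finite energy. Testing a supersolution with \<open>\<zeta>\<close> thus costs only the energy of
  the cutoff. Where \<eta> is 1 at both ends, Q is (v(x) - v(y))^2 / (v(x) v(y)), which dominates
  the squared increment of ln v.\<close>

lemma picone:
  assumes v: "finite_energy v" and "s > 0" and sv: "\<And>x. s \<le> v x" and \<eta>: "finite_energy \<eta>" "\<And>x. \<bar>\<eta> x\<bar> \<le> 1"
  defines "\<zeta> \<equiv> \<lambda>x. (\<eta> x)\<^sup>2 / v x"
    and "Q \<equiv> \<lambda>p. (\<eta> (snd p) * v (fst p) - \<eta> (fst p) * v (snd p))\<^sup>2 / (v (fst p) * v (snd p))"
  shows "finite_energy \<zeta>" "integrable jump Q" "form v \<zeta> + (\<integral>p. Q p \<partial>jump) = form \<eta> \<eta>"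
proof -
  have inv: "finite_energy (\<lambda>x. 1 / v x)" by (rule finite_energy_inverse[OF v \<open>s > 0\<close> sv])
  have pos: "v x > 0" for x using \<open>s > 0\<close> sv[of x] by linarith
  have "finite_energy (\<lambda>x. \<eta> x * (\<eta> x * (1 / v x)))"
  proof (intro finite_energy_mult[where b = "1 / s" and a = 1] \<eta> inv)
    show *: "\<bar>1 / v x\<bar> \<le> 1 / s" for x
      using pos[of x] sv[of x] \<open>s > 0\<close> by (simp add: divide_simps)
    show "\<bar>\<eta> x * (1 / v x)\<bar> \<le> 1 / s" for x
      unfolding abs_mult using mult_mono[OF \<eta>(2)[of x] *[of x]] by simp
  qed
  then show finite_energy\<zeta>: "finite_energy \<zeta>" by (simp add: \<zeta>_def power2_eq_square)
  have Q: "Q p = incr \<eta> p * incr \<eta> p - incr v p * incr \<zeta> p" for p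
    using pos[of "fst p"] pos[of "snd p"]
    by (simp add: Q_def \<zeta>_def incr_def divide_simps) (simp add: power2_eq_square algebra_simps)
  then have Q_eq: "Q = (\<lambda>p. incr \<eta> p * incr \<eta> p - incr v p * incr \<zeta> p)" by auto
  show "integrable jump Q"
    unfolding Q_eq using v finite_energy\<zeta> \<eta>(1) by (simp add: integrable_incr_mult)
  show "form v \<zeta> + (\<integral>p. Q p \<partial>jump) = form \<eta> \<eta>"
    unfolding Q_eq using v finite_energy\<zeta> \<eta>(1) by (simp add: form_def integrable_incr_mult)
qed

end

section \<open>Caccioppoli estimate and level-set iteration\<close>

locale degiorgi_kernel = bounded_kernel k \<alpha> c_U for k :: "'a::euclidean_space \<Rightarrow> 'a \<Rightarrow> real" and \<alpha> c_U +
  fixes \<alpha>0 C_F :: real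
  assumes \<alpha>: "0 < \<alpha>0" "\<alpha>0 \<le> \<alpha>" "\<alpha> < 2" and C_F_pos: "C_F > 0"
    and FK: "u \<in> borel_measurable borel \<Longrightarrow> S \<in> sets borel \<Longrightarrow> (\<And>x. x \<notin> S \<Longrightarrow> u x = 0) \<Longrightarrow>
      emeasure lborel S < \<infinity> \<Longrightarrow> measure lborel S > 0 \<Longrightarrow> (\<integral>\<^sup>+x. ennreal ((u x)\<^sup>2) \<partial>lborel) < \<infinity> \<Longrightarrow>
      (\<integral>\<^sup>+x. ennreal ((u x)\<^sup>2) \<partial>lborel) \<le> ennreal (C_F * measure lborel S powr (\<alpha> / real DIM('a))) * energy u"
begin

text \<open>A function of C_F, c_U, \<alpha>0 and d alone. The number 256 is 16^2, left over from
  (4^(i+2))^2 = 256 * 16^i in the iteration.\<close>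

definition eps0 :: real where
  "eps0 = degiorgi_eps (256 * C_F * (2 * c_U + 1)) (\<alpha>0 / real DIM('a))"

text \<open>Replacing b - a by A - B would turn the inequality into an identity. The error b + B -
  (a + A) is an increment of the maximum of v and l, and it has a favourable sign against each term:
  where B > 0, b + B = l is the smallest value this maximum can take, and likewise for A.\<close>

lemma caccioppoli_pointwise:
  fixes a b e f l :: real
  defines "A \<equiv> max 0 (l - a)" and "B \<equiv> max 0 (l - b)"
  shows "(b - a) * (f * (f * B) - e * (e * A)) + (f * B - e * A)\<^sup>2 \<le> A * B * (f - e)\<^sup>2"
proof -
  have "(b + B - (a + A)) * (f\<^sup>2 * B) \<le> 0"
    by (cases "B = 0") (auto simp: A_def B_def max_def mult_le_0_iff)
  moreover have "(b + B - (a + A)) * (e\<^sup>2 * A) \<ge> 0"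
    by (cases "A = 0") (auto simp: A_def B_def max_def zero_le_mult_iff)
  moreover have "(b - a) * (f * (f * B) - e * (e * A)) + (f * B - e * A)\<^sup>2 - A * B * (f - e)\<^sup>2
      = (b + B - (a + A)) * (f\<^sup>2 * B) - (b + B - (a + A)) * (e\<^sup>2 * A)"
    by (simp add: power2_eq_square algebra_simps)
  ultimately show ?thesis by linarith
qed

text \<open>Test with \<eta>^2 w, where w is the part of v below l1.
  \<open>caccioppoli_pointwise\<close> bounds the energy of \<eta> w by terms carried by S1,
  Faber-Krahn converts that energy into the L^2 norm with a gain |S1|^(\<alpha>/d), and on S2 the
  function \<eta> w is at least s.\<close>

lemma degiorgi_step:
  assumes v: "finite_energy v" and v0: "\<And>x. 0 \<le> v x" and l: "0 < l1" "l1 \<le> l" and "h > 0" "s > 0" and K: "0 \<le> K"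
    and super: "\<And>\<zeta>. finite_energy \<zeta> \<Longrightarrow> (\<And>x. 0 \<le> \<zeta> x) \<Longrightarrow> (\<And>x. \<zeta> x \<le> l) \<Longrightarrow>
        (\<And>x. x \<notin> ball x0 \<rho> \<or> l \<le> v x \<Longrightarrow> \<zeta> x = 0) \<Longrightarrow> form v \<zeta> \<ge> - K * (\<integral>x. \<zeta> x \<partial>lborel)"
    and "\<rho>1 \<le> \<rho>"
  defines "S1 \<equiv> {x. v x < l1} \<inter> ball x0 \<rho>1" and "S2 \<equiv> {x. v x < l1 - s} \<inter> ball x0 (\<rho>1 - h)"
  shows "s\<^sup>2 * measure lborel S2 \<le> C_F * measure lborel S1 powr (\<alpha> / real DIM('a))
     * (measure lborel S1 * (2 * l\<^sup>2 * c_U * h powr (- \<alpha>) + K * l))"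
proof -
  have [measurable]: "v \<in> borel_measurable borel" using v by measurable
  have [measurable]: "S1 \<in> sets borel" "S2 \<in> sets borel" unfolding S1_def S2_def by measurable
  have S21: "S2 \<subseteq> S1" using \<open>h > 0\<close> \<open>s > 0\<close> by (auto simp: S1_def S2_def)
  have S1_fin: "emeasure lborel S1 < \<infinity>"
    using emeasure_mono[of S1 "ball x0 \<rho>1" lborel] emeasure_lborel_ball_finite[of x0 \<rho>1]
    by (auto simp: S1_def)
  have S2_fin: "emeasure lborel S2 < \<infinity>"
    using emeasure_mono[OF S21, of lborel] S1_fin by auto
  define m where "m = measure lborel S1"
  have m: "emeasure lborel S1 = ennreal m" using S1_fin by (simp add: m_def emeasure_eq_ennreal_measure)
  have m0: "m \<ge> 0" by (simp add: m_def)
  show ?thesis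
  proof (cases "m = 0")
    \<comment> \<open>Faber-Krahn asks for a support of positive measure.\<close>
    case True
    have "measure lborel S2 \<le> m"
      unfolding m_def using S21 S1_fin by (intro measure_mono_fmeasurable) (auto simp: fmeasurable_def)
    then have "measure lborel S2 = 0" using True by (simp add: measure_le_0_iff)
    then show ?thesis using True by (simp add: m_def)
  next
    case False
    define \<eta> where "\<eta> = cutoff x0 \<rho>1 h"
    define w where "w x = max 0 (l1 - v x)" for x
    have \<eta>: "finite_energy \<eta>" "\<And>x. 0 \<le> \<eta> x" "\<And>x. \<eta> x \<le> 1" "\<And>x. x \<notin> ball x0 \<rho>1 \<Longrightarrow> \<eta> x = 0"
      using finite_energy_cutoff[OF \<open>h > 0\<close>] cutoff_bounds cutoff_eq_0[OF \<open>h > 0\<close>] by (auto simp: \<eta>_def)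
    have w01: "0 \<le> w x" "w x \<le> l" for x using v0[of x] l by (auto simp: w_def)
    have w: "finite_energy w"
      by (rule finite_energy_lipschitz[OF _ v, of _ 1]) (auto simp: w_def[abs_def])
    have ab: "\<bar>\<eta> x\<bar> \<le> 1" "\<bar>w x\<bar> \<le> l" for x using \<eta> w01 by (auto simp: abs_of_nonneg)
    have \<eta>w: "finite_energy (\<lambda>x. \<eta> x * w x)" by (rule finite_energy_mult[OF \<eta>(1) w ab])
    have \<eta>w01: "0 \<le> \<eta> x * w x" "\<eta> x * w x \<le> l" for x
      using mult_mono[OF \<eta>(3)[of x] w01(2)[of x]] w01[of x] \<eta>(2)[of x] by auto
    have \<zeta>: "finite_energy (\<lambda>x. \<eta> x * (\<eta> x * w x))"
      by (rule finite_energy_mult[OF \<eta>(1) \<eta>w ab(1), of l]) (use \<eta>w01 in \<open>auto simp: abs_of_nonneg\<close>)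
    have \<zeta>01: "0 \<le> \<eta> x * (\<eta> x * w x)" "\<eta> x * (\<eta> x * w x) \<le> l" for x
      using mult_mono[OF \<eta>(3)[of x] \<eta>w01(2)[of x]] \<eta>w01[of x] \<eta>(2)[of x] by auto
    have supp: "\<eta> x * w x = 0" if "x \<notin> S1" for x
      using that \<eta>(4)[of x] by (auto simp: S1_def w_def)
    have super\<zeta>: "form v (\<lambda>x. \<eta> x * (\<eta> x * w x)) \<ge> - K * (\<integral>x. \<eta> x * (\<eta> x * w x) \<partial>lborel)"
    proof (rule super[OF \<zeta> \<zeta>01])
      fix x assume "x \<notin> ball x0 \<rho> \<or> l \<le> v x"
      then have "x \<notin> S1" using l \<open>\<rho>1 \<le> \<rho>\<close> by (auto simp: S1_def)
      then show "\<eta> x * (\<eta> x * w x) = 0" using supp by simp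
    qed
    have "(\<integral>x. \<eta> x * (\<eta> x * w x) \<partial>lborel) \<le> (\<integral>x. l * indicator S1 x \<partial>lborel)"
    proof (rule integral_mono')
      show "integrable lborel (\<lambda>x. l * indicator S1 x :: real)" using S1_fin by simp
      show "\<eta> x * (\<eta> x * w x) \<le> l * indicator S1 x" for x
        using \<zeta>01(2)[of x] supp[of x] by (auto simp: indicator_def)
      show "0 \<le> l * indicator S1 x" for x using l by auto
    qed
    also have "\<dots> = l * m" by (simp add: m_def)
    finally have int\<zeta>: "K * (\<integral>x. \<eta> x * (\<eta> x * w x) \<partial>lborel) \<le> K * (l * m)"
      using K by (rule mult_left_mono)
    \<comment> \<open>Because v is nonnegative everywhere, w is at most l even far from the ball;
      long jumps are then covered by the bound \<open>l\<^sup>2 * trunc h p\<close>, and no separate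
      tail term arises.\<close>
    define g where "g p = w (fst p) * w (snd p) * (incr \<eta> p)\<^sup>2" for p
    have [measurable]: "w \<in> borel_measurable borel" "\<eta> \<in> borel_measurable borel"
      using w \<eta>(1) by measurable
    have g_meas [measurable]: "g \<in> borel_measurable borel" unfolding g_def[abs_def] by measurable
    have g0: "g p \<ge> 0" for p using w01 by (simp add: g_def)
    have "(\<integral>\<^sup>+p. ennreal (g p) \<partial>jump) \<le> ennreal (2 * l\<^sup>2 * c_U * h powr (- \<alpha>)) * emeasure lborel S1"
    proof (rule nn_integral_trunc_set[OF \<open>h > 0\<close>])
      fix p
      show "g p \<le> l\<^sup>2 * trunc h p"
        unfolding g_def power2_eq_square[of l]
        using incr_cutoff_le_trunc[OF \<open>h > 0\<close>, of x0 \<rho>1 p] w01 l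
        by (intro mult_mono) (auto simp: \<eta>_def)
      assume "g p \<noteq> 0"
      then have "w (fst p) \<noteq> 0" "w (snd p) \<noteq> 0" "\<eta> (fst p) \<noteq> 0 \<or> \<eta> (snd p) \<noteq> 0"
        by (auto simp: g_def incr_def)
      then show "fst p \<in> S1 \<or> snd p \<in> S1" using supp by force
    qed auto
    also have "\<dots> = ennreal (2 * l\<^sup>2 * c_U * h powr (- \<alpha>) * m)"
      using m0 c_U_nonneg by (simp add: m ennreal_mult)
    finally have gi: "(\<integral>\<^sup>+p. ennreal (g p) \<partial>jump) \<le> ennreal (2 * l\<^sup>2 * c_U * h powr (- \<alpha>) * m)" .
    have g_int: "integrable jump g"
      using gi g0 by (intro integrableI_nonneg) (auto intro: le_less_trans)
    have g_le: "(\<integral>p. g p \<partial>jump) \<le> 2 * l\<^sup>2 * c_U * h powr (- \<alpha>) * m"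
      using gi g0 m0 c_U_nonneg by (subst integral_eq_nn_integral) (auto intro!: enn2real_leI)
    have "form v (\<lambda>x. \<eta> x * (\<eta> x * w x)) + form (\<lambda>x. \<eta> x * w x) (\<lambda>x. \<eta> x * w x)
       = (\<integral>p. incr v p * incr (\<lambda>x. \<eta> x * (\<eta> x * w x)) p + incr (\<lambda>x. \<eta> x * w x) p * incr (\<lambda>x. \<eta> x * w x) p \<partial>jump)"
      using v \<zeta> \<eta>w by (simp add: form_def integrable_incr_mult)
    also have "\<dots> \<le> (\<integral>p. g p \<partial>jump)"
    proof (rule integral_mono)
      show "integrable jump (\<lambda>p. incr v p * incr (\<lambda>x. \<eta> x * (\<eta> x * w x)) p + incr (\<lambda>x. \<eta> x * w x) p * incr (\<lambda>x. \<eta> x * w x) p)"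
        using v \<zeta> \<eta>w by (simp add: integrable_incr_mult)
      show "integrable jump g" by (rule g_int)
      show "incr v p * incr (\<lambda>x. \<eta> x * (\<eta> x * w x)) p + incr (\<lambda>x. \<eta> x * w x) p * incr (\<lambda>x. \<eta> x * w x) p \<le> g p" for p
        using caccioppoli_pointwise[where a="v (fst p)" and b="v (snd p)" and l=l1 and e="\<eta> (fst p)" and f="\<eta> (snd p)"]
        by (simp add: incr_def g_def w_def power2_eq_square)
    qed
    finally have "form (\<lambda>x. \<eta> x * w x) (\<lambda>x. \<eta> x * w x) \<le> 2 * l\<^sup>2 * c_U * h powr (- \<alpha>) * m + K * (l * m)"
      using g_le super\<zeta> int\<zeta> by linarith
    also have "\<dots> = m * (2 * l\<^sup>2 * c_U * h powr (- \<alpha>) + K * l)" by (simp add: algebra_simps)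
    finally have en: "energy (\<lambda>x. \<eta> x * w x) \<le> ennreal (m * (2 * l\<^sup>2 * c_U * h powr (- \<alpha>) + K * l))"
      by (simp add: energy_eq_form[OF \<eta>w] ennreal_leI)
    have L2: "(\<integral>\<^sup>+x. ennreal ((\<eta> x * w x)\<^sup>2) \<partial>lborel) < \<infinity>"
    proof -
      have "(\<integral>\<^sup>+x. ennreal ((\<eta> x * w x)\<^sup>2) \<partial>lborel) \<le> (\<integral>\<^sup>+x. ennreal (l\<^sup>2) * indicator S1 x \<partial>lborel)"
        using supp \<eta>w01 by (intro nn_integral_mono) (auto simp: indicator_def intro!: ennreal_leI power_mono)
      also have "\<dots> < \<infinity>" using S1_fin by (simp add: nn_integral_cmult ennreal_mult_less_top)
      finally show ?thesis .
    qed
    have "ennreal (s\<^sup>2 * measure lborel S2) = (\<integral>\<^sup>+x. ennreal (s\<^sup>2) * indicator S2 x \<partial>lborel)"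
      using S2_fin by (simp add: nn_integral_cmult ennreal_mult emeasure_eq_ennreal_measure)
    also have "\<dots> \<le> (\<integral>\<^sup>+x. ennreal ((\<eta> x * w x)\<^sup>2) \<partial>lborel)"
    proof (intro nn_integral_mono)
      fix x
      have "x \<in> S2 \<Longrightarrow> s\<^sup>2 \<le> (\<eta> x * w x)\<^sup>2"
        using cutoff_eq_1[OF \<open>h > 0\<close>, of x x0 \<rho>1] \<open>s > 0\<close>
        by (intro power_mono) (auto simp: \<eta>_def S2_def w_def)
      then show "ennreal (s\<^sup>2) * indicator S2 x \<le> ennreal ((\<eta> x * w x)\<^sup>2)"
        by (auto simp: indicator_def intro!: ennreal_leI)
    qed
    also have "\<dots> \<le> ennreal (C_F * measure lborel S1 powr (\<alpha> / real DIM('a))) * energy (\<lambda>x. \<eta> x * w x)"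
      using supp S1_fin False L2 by (intro FK) (auto simp: m_def zero_less_measure_iff)
    also have "\<dots> \<le> ennreal (C_F * measure lborel S1 powr (\<alpha> / real DIM('a))) * ennreal (m * (2 * l\<^sup>2 * c_U * h powr (- \<alpha>) + K * l))"
      by (intro mult_left_mono en) auto
    also have "\<dots> = ennreal (C_F * measure lborel S1 powr (\<alpha> / real DIM('a)) * (m * (2 * l\<^sup>2 * c_U * h powr (- \<alpha>) + K * l)))"
      using C_F_pos m0 c_U_nonneg K l by (intro ennreal_mult[symmetric]) auto
    finally show ?thesis
      using C_F_pos m0 c_U_nonneg K l unfolding m_def by (subst (asm) ennreal_le_iff) auto
  qed
qed

text \<open>Levels and radii shrink together, from l to l/2 and from \<rho> to \<rho>/2. Test
  functions are confined to the sublevel set v < l, so the source bound -K has to hold only there; K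
  \<le> l \<rho>^(-\<alpha>) makes that source scale like the cutoff term.\<close>

lemma degiorgi_lower_bound:
  assumes v: "finite_energy v" and v0: "\<And>x. 0 \<le> v x" and "l > 0" "\<rho> > 0" and K: "0 \<le> K" "K \<le> l * \<rho> powr (- \<alpha>)"
    and super: "\<And>\<zeta>. finite_energy \<zeta> \<Longrightarrow> (\<And>x. 0 \<le> \<zeta> x) \<Longrightarrow> (\<And>x. \<zeta> x \<le> l) \<Longrightarrow>
        (\<And>x. x \<notin> ball x0 \<rho> \<or> l \<le> v x \<Longrightarrow> \<zeta> x = 0) \<Longrightarrow> form v \<zeta> \<ge> - K * (\<integral>x. \<zeta> x \<partial>lborel)"
    and small: "measure lborel ({x. v x < l} \<inter> ball x0 \<rho>) \<le> eps0 * \<rho> ^ DIM('a)"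
  shows "AE x in lborel. x \<in> ball x0 (\<rho> / 2) \<longrightarrow> l / 2 \<le> v x"
proof -
  let ?d = "real DIM('a)"
  have [measurable]: "v \<in> borel_measurable borel" using v by measurable
  \<comment> \<open>\<open>t 0 = 1\<close>, the limit is 1/2, and \<open>t i - t (Suc i)\<close> is
    2^(-(i+2)); this is why h and s below carry the exponent i + 2.\<close>
  define t where "t i = 1/2 + (1/2 :: real) ^ Suc i" for i
  define S where "S i = {x. v x < l * t i} \<inter> ball x0 (\<rho> * t i)" for i
  define a where "a i = measure lborel (S i) / \<rho> ^ DIM('a)" for i
  have [measurable]: "S i \<in> sets borel" for i unfolding S_def by measurable
  have t: "1/2 < t i" "t i \<le> 1" "t i - t (Suc i) = (1/2) ^ (i + 2)" for i
    using power_le_one[of "1/2::real" i] by (auto simp: t_def)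
  have t_anti: "t i \<le> t 0" for i
    using power_le_one[of "1/2::real" i] by (simp add: t_def)
  have S_fin: "emeasure lborel (S i) < \<infinity>" for i
    using emeasure_mono[of "S i" "ball x0 (\<rho> * t i)" lborel] emeasure_lborel_ball_finite[of x0 "\<rho> * t i"]
    by (auto simp: S_def)
  have a_nonneg: "a i \<ge> 0" for i using \<open>\<rho> > 0\<close> by (simp add: a_def)
  have a0: "a 0 \<le> eps0"
    using small \<open>\<rho> > 0\<close> by (simp add: a_def S_def t_def divide_simps)
  have a_le: "a i \<le> 1" for i
  proof -
    have "l * t i \<le> l * t 0" "\<rho> * t i \<le> \<rho> * t 0"
      using t_anti[of i] \<open>l > 0\<close> \<open>\<rho> > 0\<close> by auto
    note * = less_le_trans[OF _ this(1)] less_le_trans[OF _ this(2)]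
    have "S i \<subseteq> S 0"
      by (auto simp: S_def intro: *)
    then have "a i \<le> a 0" unfolding a_def using S_fin[of 0] \<open>\<rho> > 0\<close>
      by (intro divide_right_mono measure_mono_fmeasurable) (auto simp: fmeasurable_def)
    also have "a 0 \<le> 1" using a0 by (simp add: eps0_def degiorgi_eps_def)
    finally show ?thesis .
  qed
  have "a \<longlonglongrightarrow> 0"
  proof (rule degiorgi_iteration)
    show "256 * C_F * (2 * c_U + 1) > 0" "\<alpha>0 / ?d > 0"
      using C_F_pos c_U_nonneg \<alpha> by auto
    show "a 0 \<le> degiorgi_eps (256 * C_F * (2 * c_U + 1)) (\<alpha>0 / ?d)" using a0 by (simp add: eps0_def)
    fix i
    define h where "h = \<rho> * (1/2) ^ (i + 2)"
    define s where "s = l * (1/2) ^ (i + 2)"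
    have hs: "h > 0" "s > 0" using \<open>\<rho> > 0\<close> \<open>l > 0\<close> by (auto simp: h_def s_def)
    have "l * t i - s = l * t (Suc i)" "\<rho> * t i - h = \<rho> * t (Suc i)"
      unfolding s_def h_def t(3)[symmetric] by (simp_all add: right_diff_distrib)
    then have S2: "{x. v x < l * t i - s} \<inter> ball x0 (\<rho> * t i - h) = S (Suc i)" by (simp add: S_def)
    have "s\<^sup>2 * measure lborel ({x. v x < l * t i - s} \<inter> ball x0 (\<rho> * t i - h))
      \<le> C_F * measure lborel (S i) powr (\<alpha> / ?d) * (measure lborel (S i) * (2 * l\<^sup>2 * c_U * h powr (- \<alpha>) + K * l))"
      unfolding S_def
      by (rule degiorgi_step[OF v v0 _ _ hs(1) hs(2) K(1) super])
         (use t[of i] \<open>l > 0\<close> \<open>\<rho> > 0\<close> in \<open>auto simp: mult_le_cancel_left2 zero_less_mult_iff\<close>)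
    then have step: "s\<^sup>2 * measure lborel (S (Suc i))
      \<le> C_F * measure lborel (S i) powr (\<alpha> / ?d) * (measure lborel (S i) * (2 * l\<^sup>2 * c_U * h powr (- \<alpha>) + K * l))"
      by (simp add: S2)
    have mS: "measure lborel (S j) = a j * \<rho> ^ DIM('a)" for j using \<open>\<rho> > 0\<close> by (simp add: a_def)
    have powS: "measure lborel (S i) powr (\<alpha> / ?d) = a i powr (\<alpha> / ?d) * \<rho> powr \<alpha>"
      unfolding mS using \<open>\<rho> > 0\<close> a_nonneg by (simp add: powr_mult powr_realpow[symmetric] powr_powr)
    have "h powr (- \<alpha>) = \<rho> powr (- \<alpha>) * (2 ^ (i + 2)) powr \<alpha>"
      using \<open>\<rho> > 0\<close> by (simp add: h_def powr_mult powr_minus powr_divide power_divide field_simps)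
    \<comment> \<open>One factor 4^(i+2) comes from h^(-\<alpha>) by \<alpha> < 2, the other will
      come from 1 / s^2; together they give the growth 16^i.\<close>
    also have "(2 ^ (i + 2)) powr \<alpha> \<le> (2 ^ (i + 2) :: real) powr 2"
      using \<alpha> one_le_power[of "2::real" "i + 2"] by (intro powr_mono) auto
    also have "(2 ^ (i + 2) :: real) powr 2 = 4 ^ (i + 2)"
      by (simp add: power_mult_distrib[symmetric] power2_eq_square)
    finally have hp: "h powr (- \<alpha>) \<le> \<rho> powr (- \<alpha>) * 4 ^ (i + 2)" by (simp add: mult_left_mono)
    have "2 * l\<^sup>2 * c_U * h powr (- \<alpha>) + K * l \<le> 2 * l\<^sup>2 * c_U * (\<rho> powr (- \<alpha>) * 4 ^ (i + 2)) + l * \<rho> powr (- \<alpha>) * l"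
      using hp K \<open>l > 0\<close> c_U_nonneg by (intro add_mono mult_left_mono mult_right_mono) auto
    also have "\<dots> \<le> 2 * l\<^sup>2 * c_U * (\<rho> powr (- \<alpha>) * 4 ^ (i + 2)) + l * \<rho> powr (- \<alpha>) * l * 4 ^ (i + 2)"
      using mult_left_mono[OF one_le_power[of "4::real" "i + 2"], of "l * \<rho> powr (- \<alpha>) * l"] \<open>l > 0\<close>
      by (intro add_left_mono) simp
    also have "\<dots> = l\<^sup>2 * \<rho> powr (- \<alpha>) * (2 * c_U + 1) * 4 ^ (i + 2)"
      by (simp add: power2_eq_square algebra_simps)
    finally have br: "2 * l\<^sup>2 * c_U * h powr (- \<alpha>) + K * l \<le> l\<^sup>2 * \<rho> powr (- \<alpha>) * (2 * c_U + 1) * 4 ^ (i + 2)" .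
    have "s\<^sup>2 * measure lborel (S (Suc i)) \<le> C_F * (a i powr (\<alpha> / ?d) * \<rho> powr \<alpha>)
        * (a i * \<rho> ^ DIM('a) * (l\<^sup>2 * \<rho> powr (- \<alpha>) * (2 * c_U + 1) * 4 ^ (i + 2)))"
      using step[unfolded powS, unfolded mS[of i]] C_F_pos a_nonneg[of i] \<open>\<rho> > 0\<close>
      by (elim order_trans) (intro mult_left_mono br, auto)
    also have "\<dots> = C_F * (2 * c_U + 1) * 4 ^ (i + 2) * (a i powr (\<alpha> / ?d) * a i) * (l\<^sup>2 * \<rho> ^ DIM('a)) * (\<rho> powr \<alpha> * \<rho> powr (- \<alpha>))"
      by (simp add: mult_ac)
    also have "\<rho> powr \<alpha> * \<rho> powr (- \<alpha>) = 1" using \<open>\<rho> > 0\<close> by (simp add: powr_minus)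
    also have "s\<^sup>2 * measure lborel (S (Suc i)) = a (Suc i) * (l\<^sup>2 * \<rho> ^ DIM('a)) / 4 ^ (i + 2)"
      by (simp add: s_def mS power_mult_distrib power_divide power2_eq_square field_simps flip: power_mult_distrib)
    finally have "a (Suc i) * (l\<^sup>2 * \<rho> ^ DIM('a)) \<le> C_F * (2 * c_U + 1) * 4 ^ (i + 2) * (a i powr (\<alpha> / ?d) * a i) * 4 ^ (i + 2) * (l\<^sup>2 * \<rho> ^ DIM('a))"
      by (simp add: field_simps)
    then have "a (Suc i) \<le> C_F * (2 * c_U + 1) * 4 ^ (i + 2) * (a i powr (\<alpha> / ?d) * a i) * 4 ^ (i + 2)"
      using \<open>l > 0\<close> \<open>\<rho> > 0\<close> by (simp add: mult_le_cancel_right)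
    also have "\<dots> = 256 * C_F * (2 * c_U + 1) * 16 ^ i * (a i powr (\<alpha> / ?d) * a i)"
      by (simp add: power_add power_mult_distrib[symmetric] flip: power_mult_distrib)
    also have "a i powr (\<alpha> / ?d) * a i \<le> a i powr (1 + \<alpha>0 / ?d)"
    proof -
      have "a i powr (\<alpha> / ?d) \<le> a i powr (\<alpha>0 / ?d)"
        using a_nonneg[of i] a_le[of i] \<alpha> by (intro powr_mono') (auto simp: divide_right_mono)
      then show ?thesis using a_nonneg[of i] by (auto simp: powr_add mult.commute intro!: mult_left_mono)
    qed
    finally show "a (Suc i) \<le> 256 * C_F * (2 * c_U + 1) * 16 ^ i * a i powr (1 + \<alpha>0 / ?d)"
      using C_F_pos c_U_nonneg by (simp add: mult_left_mono)
  qed (rule a_nonneg)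
  let ?N = "{x. v x < l / 2} \<inter> ball x0 (\<rho> / 2)"
  have [measurable]: "?N \<in> sets borel" by measurable
  have N_le: "measure lborel ?N / \<rho> ^ DIM('a) \<le> a i" for i
  proof -
    have "?N \<subseteq> S i"
      using mult_strict_left_mono[OF t(1)[of i] \<open>l > 0\<close>] mult_strict_left_mono[OF t(1)[of i] \<open>\<rho> > 0\<close>]
      by (auto simp: S_def)
    then show ?thesis unfolding a_def using S_fin[of i] \<open>\<rho> > 0\<close>
      by (intro divide_right_mono measure_mono_fmeasurable) (auto simp: fmeasurable_def)
  qed
  have "measure lborel ?N / \<rho> ^ DIM('a) \<le> 0"
    using \<open>a \<longlonglongrightarrow> 0\<close> by (rule LIMSEQ_le_const) (use N_le in auto)
  then have "measure lborel ?N = 0"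
    using zero_less_power[OF \<open>\<rho> > 0\<close>, of "DIM('a)"] by (simp add: divide_le_0_iff measure_le_0_iff)
  moreover have "emeasure lborel ?N < \<infinity>"
    using emeasure_mono[of ?N "ball x0 (\<rho> / 2)" lborel] emeasure_lborel_ball_finite[of x0 "\<rho> / 2"] by auto
  ultimately have "?N \<in> null_sets lborel"
    by (simp add: null_sets_def emeasure_eq_ennreal_measure)
  from AE_not_in[OF this] show ?thesis by eventually_elim auto
qed

end

section \<open>Weak solutions by minimisation\<close>

lemma half_square_bound: "2 * \<bar>a * b\<bar> \<le> a\<^sup>2 + (b::real)\<^sup>2"
  using sum_squares_bound[of "\<bar>a\<bar>" "\<bar>b\<bar>"] by (simp add: abs_mult)

lemma integrable_mult_L2:
  fixes u v :: "'a \<Rightarrow> real"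
  assumes [measurable]: "u \<in> borel_measurable M" "v \<in> borel_measurable M"
    and "integrable M (\<lambda>x. (u x)\<^sup>2)" "integrable M (\<lambda>x. (v x)\<^sup>2)"
  shows "integrable M (\<lambda>x. u x * v x)"
proof (rule Bochner_Integration.integrable_bound)
  show "integrable M (\<lambda>x. (u x)\<^sup>2 + (v x)\<^sup>2)" using assms by simp
  show "AE x in M. norm (u x * v x) \<le> norm ((u x)\<^sup>2 + (v x)\<^sup>2)"
    using half_square_bound by (intro AE_I2) (smt (verit) real_norm_def sum_power2_ge_zero)
qed measurable

lemma nn_integral_le_of_AE_tendsto:
  fixes f :: "nat \<Rightarrow> 'a \<Rightarrow> real"
  assumes [measurable]: "\<And>j. f j \<in> borel_measurable M"
    and "AE x in M. (\<lambda>j. f j x) \<longlonglongrightarrow> g x"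
    and "\<forall>\<^sub>F j in sequentially. (\<integral>\<^sup>+x. ennreal (f j x) \<partial>M) \<le> c"
  shows "(\<integral>\<^sup>+x. ennreal (g x) \<partial>M) \<le> c"
proof -
  have "(\<integral>\<^sup>+x. ennreal (g x) \<partial>M) = (\<integral>\<^sup>+x. liminf (\<lambda>j. ennreal (f j x)) \<partial>M)"
  proof (rule nn_integral_cong_AE)
    show "AE x in M. ennreal (g x) = liminf (\<lambda>j. ennreal (f j x))"
      using assms(2) by eventually_elim (auto intro!: lim_imp_Liminf[symmetric] tendsto_ennrealI)
  qed
  also have "\<dots> \<le> liminf (\<lambda>j. \<integral>\<^sup>+x. ennreal (f j x) \<partial>M)"
    by (rule nn_integral_liminf) measurable
  also have "\<dots> \<le> limsup (\<lambda>j. \<integral>\<^sup>+x. ennreal (f j x) \<partial>M)"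
    by (rule Liminf_le_Limsup) simp
  also have "\<dots> \<le> c" using assms(3) by (rule Limsup_bounded)
  finally show ?thesis .
qed

context symmetric_kernel begin

lemma AE_jump_fst: "AE x in lborel. P x \<Longrightarrow> AE p in jump. P (fst p)"
proof -
  assume "AE x in lborel. P x"
  then obtain N where N: "{x. \<not> P x} \<subseteq> N" "N \<in> null_sets lborel"
    unfolding eventually_ae_filter by auto
  then have [measurable]: "N \<in> sets borel" by (auto simp: null_sets_def)
  have "(\<integral>\<^sup>+p. indicator N (fst p) \<partial>jump) = (\<integral>\<^sup>+x. \<integral>\<^sup>+y. ennreal (k x y) * indicator N x \<partial>lborel \<partial>lborel)"
    by (subst nn_integral_jump) auto
  also have "\<dots> = (\<integral>\<^sup>+(x::'a). 0 \<partial>lborel)"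
    using AE_not_in[OF N(2)] by (intro nn_integral_cong_AE) auto
  finally have "(\<integral>\<^sup>+p. indicator N (fst p) \<partial>jump) = 0" by simp
  then have "AE p in jump. indicator N (fst p) = (0::ennreal)"
    by (subst (asm) nn_integral_0_iff_AE) auto
  then show ?thesis by eventually_elim (use N(1) in \<open>auto simp: indicator_def split: if_splits\<close>)
qed

lemma AE_jump_snd: "AE x in lborel. P x \<Longrightarrow> AE p in jump. P (snd p)"
proof -
  assume "AE x in lborel. P x"
  then obtain N where N: "{x. \<not> P x} \<subseteq> N" "N \<in> null_sets lborel"
    unfolding eventually_ae_filter by auto
  then have [measurable]: "N \<in> sets borel" by (auto simp: null_sets_def)
  have "(\<integral>\<^sup>+p. indicator N (snd p) \<partial>jump) = (\<integral>\<^sup>+x. \<integral>\<^sup>+y. ennreal (k x y) * indicator N x \<partial>lborel \<partial>lborel)"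
    by (subst nn_integral_jump') auto
  also have "\<dots> = (\<integral>\<^sup>+(x::'a). 0 \<partial>lborel)"
    using AE_not_in[OF N(2)] by (intro nn_integral_cong_AE) auto
  finally have "(\<integral>\<^sup>+p. indicator N (snd p) \<partial>jump) = 0" by simp
  then have "AE p in jump. indicator N (snd p) = (0::ennreal)"
    by (subst (asm) nn_integral_0_iff_AE) auto
  then show ?thesis by eventually_elim (use N(1) in \<open>auto simp: indicator_def split: if_splits\<close>)
qed

text \<open>Borel functions with a pointwise boundary condition replace Lebesgue functions with an
  almost everywhere one, so that supports can be handled point by point. \<open>H0_imp_in_H0\<close>
  and \<open>in_H0_representative\<close> translate between the two.\<close>

definition H0 :: "'a set \<Rightarrow> ('a \<Rightarrow> real) set" where
  "H0 \<Omega> = {u. finite_energy u \<and> (\<forall>x. x \<notin> \<Omega> \<longrightarrow> u x = 0) \<and> integrable lborel (\<lambda>x. (u x)\<^sup>2)}"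

lemma H0D: "u \<in> H0 \<Omega> \<Longrightarrow> finite_energy u" "u \<in> H0 \<Omega> \<Longrightarrow> x \<notin> \<Omega> \<Longrightarrow> u x = 0"
  "u \<in> H0 \<Omega> \<Longrightarrow> integrable lborel (\<lambda>x. (u x)\<^sup>2)" "u \<in> H0 \<Omega> \<Longrightarrow> u \<in> borel_measurable borel"
  by (auto simp: H0_def finite_energy_def)

lemma H0_cmult: "u \<in> H0 \<Omega> \<Longrightarrow> (\<lambda>x. c * u x) \<in> H0 \<Omega>"
  by (auto simp: H0_def finite_energy_cmult power_mult_distrib)

lemma integrable_H0_mult: "u \<in> H0 \<Omega> \<Longrightarrow> v \<in> H0 \<Omega> \<Longrightarrow> integrable lborel (\<lambda>x. u x * v x)"
  by (rule integrable_mult_L2) (auto simp: H0_def finite_energy_def)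

lemma H0_add: assumes "u \<in> H0 \<Omega>" "v \<in> H0 \<Omega>" shows "(\<lambda>x. u x + v x) \<in> H0 \<Omega>"
proof -
  have "integrable lborel (\<lambda>x. (u x)\<^sup>2 + (v x)\<^sup>2 + 2 * (u x * v x))"
    by (intro Bochner_Integration.integrable_add integrable_mult_right integrable_H0_mult[OF assms]
        H0D(3)[OF assms(1)] H0D(3)[OF assms(2)])
  then show ?thesis using assms by (auto simp: H0_def finite_energy_add power2_sum mult.assoc)
qed

lemma H0_diff: assumes "u \<in> H0 \<Omega>" "v \<in> H0 \<Omega>" shows "(\<lambda>x. u x - v x) \<in> H0 \<Omega>"
  using H0_add[OF assms(1) H0_cmult[OF assms(2), of "-1"]] by simp

lemma H0_zero: "(\<lambda>x. 0) \<in> H0 \<Omega>"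
  by (simp add: H0_def finite_energy_zero)

end

locale resolvent = symmetric_kernel k for k :: "'a::euclidean_space \<Rightarrow> 'a \<Rightarrow> real" +
  fixes \<Omega> A :: "'a set" and q :: real
  assumes \<Omega>_sets [measurable]: "\<Omega> \<in> sets borel" and A_sets [measurable]: "A \<in> sets borel"
    and A_fin: "emeasure lborel A < \<infinity>" and q: "q > 0"
begin

definition b :: "('a \<Rightarrow> real) \<Rightarrow> ('a \<Rightarrow> real) \<Rightarrow> real" where
  "b u v = form u v + q * (\<integral>x. u x * v x \<partial>lborel)"

definition L :: "('a \<Rightarrow> real) \<Rightarrow> real" where
  "L u = (\<integral>x. indicator A x * u x \<partial>lborel)"

definition J :: "('a \<Rightarrow> real) \<Rightarrow> real" where
  "J u = b u u - 2 * L u"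

lemma integrable_L: "u \<in> H0 \<Omega> \<Longrightarrow> integrable lborel (\<lambda>x. indicator A x * u x)"
proof (rule integrable_mult_L2)
  have "(\<lambda>x. (indicator A x)\<^sup>2) = (indicator A :: 'a \<Rightarrow> real)" by (auto simp: indicator_def)
  then show "integrable lborel (\<lambda>x. (indicator A x :: real)\<^sup>2)" using A_fin by simp
qed (auto dest: H0D)

lemma b_sym: "b u v = b v u"
  by (simp add: b_def form_sym mult.commute)

lemma b_add_right: "u \<in> H0 \<Omega> \<Longrightarrow> v \<in> H0 \<Omega> \<Longrightarrow> w \<in> H0 \<Omega> \<Longrightarrow> b u (\<lambda>x. v x + w x) = b u v + b u w"
  by (simp add: b_def form_add_right H0D distrib_left integrable_H0_mult)

lemma b_cmult_right: "b u (\<lambda>x. c * v x) = c * b u v"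
  by (simp add: b_def form_cmult_right algebra_simps)

lemma b_add_left: "u \<in> H0 \<Omega> \<Longrightarrow> v \<in> H0 \<Omega> \<Longrightarrow> w \<in> H0 \<Omega> \<Longrightarrow> b (\<lambda>x. u x + v x) w = b u w + b v w"
  using b_add_right[of w u v] by (simp add: b_sym)

lemma b_cmult_left: "b (\<lambda>x. c * u x) v = c * b u v"
  using b_cmult_right[of v c u] by (simp add: b_sym)

lemma L_add: "u \<in> H0 \<Omega> \<Longrightarrow> v \<in> H0 \<Omega> \<Longrightarrow> L (\<lambda>x. u x + v x) = L u + L v"
  by (simp add: L_def distrib_left integrable_L)

lemma L_cmult: "L (\<lambda>x. c * u x) = c * L u"
  unfolding L_def by (subst integral_mult_right_zero[symmetric]) (simp add: algebra_simps)

lemma b_nonneg: "b u u \<ge> 0"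
  unfolding b_def using q form_self_nonneg[of u]
  by (auto intro!: add_nonneg_nonneg mult_nonneg_nonneg[of q] Bochner_Integration.integral_nonneg)

lemma b_expand:
  assumes "u \<in> H0 \<Omega>" "v \<in> H0 \<Omega>"
  shows "b (\<lambda>x. u x + t * v x) (\<lambda>x. u x + t * v x) = b u u + 2 * t * b u v + t\<^sup>2 * b v v"
  using assms b_sym[of u v]
  by (simp add: b_add_left b_add_right H0_cmult H0_add b_cmult_left b_cmult_right power2_eq_square algebra_simps)

lemma J_expand:
  assumes "u \<in> H0 \<Omega>" "v \<in> H0 \<Omega>"
  shows "J (\<lambda>x. u x + t * v x) = J u + 2 * t * (b u v - L v) + t\<^sup>2 * b v v"
  unfolding J_def b_expand[OF assms] using assms by (simp add: L_add H0_cmult L_cmult algebra_simps)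

lemma b_bound:
  assumes "u \<in> H0 \<Omega>" "v \<in> H0 \<Omega>" "e > 0"
  shows "2 * \<bar>b u v\<bar> \<le> b u u / e + e * b v v"
proof -
  have "0 \<le> b u u + 2 * (- e) * b u v + (- e)\<^sup>2 * b v v" "0 \<le> b u u + 2 * e * b u v + e\<^sup>2 * b v v"
    using b_nonneg[of "\<lambda>x. u x + (- e) * v x"] b_nonneg[of "\<lambda>x. u x + e * v x"]
    unfolding b_expand[OF assms(1,2)] by auto
  then have "2 * \<bar>b u v\<bar> * e \<le> (b u u / e + e * b v v) * e"
    using \<open>e > 0\<close> by (auto simp: abs_if algebra_simps power2_eq_square)
  then show ?thesis using \<open>e > 0\<close> by (simp add: mult_le_cancel_right)
qed

text \<open>Coercivity comes from the zero-order term: q t^2 - 2 t \<ge> -1/q on A by completing the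
  square, and q t^2 \<ge> 0 elsewhere.\<close>

lemma J_lower: assumes "u \<in> H0 \<Omega>" shows "J u \<ge> - measure lborel A / q"
proof -
  have int: "integrable lborel (\<lambda>x. q * (u x * u x) - 2 * (indicator A x * u x))"
    using assms by (simp add: integrable_H0_mult integrable_L)
  have "(\<integral>x. - indicator A x / q \<partial>lborel) \<le> (\<integral>x. q * (u x * u x) - 2 * (indicator A x * u x) \<partial>lborel)"
  proof (rule integral_mono[OF _ int])
    show "integrable lborel (\<lambda>x. - indicator A x / q)" using A_fin by auto
    fix x
    have "(q * u x - 1)\<^sup>2 / q \<ge> 0" using q by simp
    also have "(q * u x - 1)\<^sup>2 / q = q * (u x * u x) - 2 * u x + 1 / q"
      using q by (simp add: power2_eq_square field_simps)
    finally show "- indicator A x / q \<le> q * (u x * u x) - 2 * (indicator A x * u x)"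
      using q by (auto simp: indicator_def)
  qed
  also have "(\<integral>x. q * (u x * u x) - 2 * (indicator A x * u x) \<partial>lborel) = q * (\<integral>x. u x * u x \<partial>lborel) - 2 * L u"
    using assms by (simp add: integrable_H0_mult integrable_L L_def)
  finally show ?thesis using form_self_nonneg[of u] A_fin by (simp add: J_def b_def)
qed

text \<open>Vary by \<delta> v and -\<delta> v: for a defect \<delta>^2 this step length balances
  the defect against the quadratic term.\<close>

lemma approximate_euler_lagrange:
  assumes m: "\<And>w. w \<in> H0 \<Omega> \<Longrightarrow> m \<le> J w" and u: "u \<in> H0 \<Omega>" "J u \<le> m + \<delta>\<^sup>2" and "\<delta> > 0" and v: "v \<in> H0 \<Omega>"
  shows "2 * \<bar>b u v - L v\<bar> \<le> \<delta> * (1 + b v v)"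
proof -
  have "0 \<le> \<delta>\<^sup>2 + 2 * t * (b u v - L v) + t\<^sup>2 * b v v" for t
    using m[of "\<lambda>x. u x + t * v x"] u v unfolding J_expand[OF u(1) v] by (simp add: H0_add H0_cmult)
  from this[of \<delta>] this[of "-\<delta>"]
  have "2 * \<bar>b u v - L v\<bar> * \<delta> \<le> \<delta> * (1 + b v v) * \<delta>"
    using \<open>\<delta> > 0\<close> by (auto simp: abs_if algebra_simps power2_eq_square)
  then show ?thesis using \<open>\<delta> > 0\<close> by (simp add: mult_le_cancel_right)
qed

text \<open>The parallelogram argument: the midpoint of two near-minimisers also has J at least
  m.\<close>

lemma minimizing_sequence_close:
  assumes m: "\<And>w. w \<in> H0 \<Omega> \<Longrightarrow> m \<le> J w" and u: "u \<in> H0 \<Omega>" "J u \<le> m + e" and v: "v \<in> H0 \<Omega>" "J v \<le> m + e"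
  shows "b (\<lambda>x. u x - v x) (\<lambda>x. u x - v x) \<le> 4 * e"
proof -
  let ?w = "\<lambda>x. v x - u x"
  have w: "?w \<in> H0 \<Omega>" using u v by (intro H0_diff)
  have "m \<le> J (\<lambda>x. u x + 1/2 * ?w x)" by (rule m) (intro H0_add H0_cmult u w)
  moreover have "J v = J (\<lambda>x. u x + 1 * ?w x)" by simp
  ultimately have "b ?w ?w \<le> 4 * e"
    using u v unfolding J_expand[OF u(1) w] by (simp add: power2_eq_square)
  moreover have "b (\<lambda>x. u x - v x) (\<lambda>x. u x - v x) = b ?w ?w"
    using b_cmult_left[of "-1" ?w "\<lambda>x. -1 * ?w x"] b_cmult_right[of ?w "-1" ?w] by simp
  ultimately show ?thesis by simp
qed

text \<open>The direct method with explicit limits: a minimising sequence with defect 4^(-n) is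
  Cauchy for b, its limit is taken pointwise, and Fatou returns the Cauchy bounds to the limit.
  Clamping the limit to the interval from 0 to 1/q does not raise J, so the clamped function is
  again a minimiser and solves the same equation.\<close>

lemma solution_exists:
  "\<exists>\<phi>\<in>H0 \<Omega>. (\<forall>x. 0 \<le> \<phi> x \<and> \<phi> x \<le> 1 / q) \<and> (\<forall>v\<in>H0 \<Omega>. b \<phi> v = L v)"
proof -
  define m where "m = Inf (J ` H0 \<Omega>)"
  have bdd: "bdd_below (J ` H0 \<Omega>)" using J_lower by (auto intro!: bdd_belowI2)
  have m: "m \<le> J w" if "w \<in> H0 \<Omega>" for w
    unfolding m_def using that bdd by (intro cInf_lower) auto
  have "\<exists>u\<in>H0 \<Omega>. J u \<le> m + ((1/2) ^ n)\<^sup>2" for n :: nat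
  proof -
    have "Inf (J ` H0 \<Omega>) < m + ((1/2) ^ n)\<^sup>2" by (simp add: m_def)
    from cInf_lessD[OF _ this] show ?thesis using H0_zero by (auto simp: image_iff intro: less_imp_le)
  qed
  then obtain u where u: "\<And>n. u n \<in> H0 \<Omega>" "\<And>n::nat. J (u n) \<le> m + ((1/2) ^ n)\<^sup>2" by metis
  have u_meas [measurable]: "u n \<in> borel_measurable borel" for n using u(1) by (rule H0D)
  have close: "b (\<lambda>x. u j x - u n x) (\<lambda>x. u j x - u n x) \<le> 4 * (1/4) ^ n" if "n \<le> j" for j n
  proof -
    have "((1/2) ^ j)\<^sup>2 \<le> ((1/2) ^ n :: real)\<^sup>2" using that by (intro power_mono power_decreasing) auto
    then have "J (u j) \<le> m + ((1/2) ^ n)\<^sup>2" using u(2)[of j] by linarith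
    from minimizing_sequence_close[OF m u(1) this u(1) u(2)] show ?thesis
      by (simp add: power2_eq_square flip: power_mult_distrib)
  qed
  have closeL2: "q * (\<integral>x. (u j x - u n x)\<^sup>2 \<partial>lborel) \<le> 4 * (1/4) ^ n"
    and closeE: "form (\<lambda>x. u j x - u n x) (\<lambda>x. u j x - u n x) \<le> 4 * (1/4) ^ n" if "n \<le> j" for j n
  proof -
    have "q * (\<integral>x. (u j x - u n x)\<^sup>2 \<partial>lborel) \<ge> 0" using q by (intro mult_nonneg_nonneg Bochner_Integration.integral_nonneg) auto
    then show "q * (\<integral>x. (u j x - u n x)\<^sup>2 \<partial>lborel) \<le> 4 * (1/4) ^ n"
      "form (\<lambda>x. u j x - u n x) (\<lambda>x. u j x - u n x) \<le> 4 * (1/4) ^ n"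
      using close[OF that] form_self_nonneg[of "\<lambda>x. u j x - u n x"] by (auto simp: b_def power2_eq_square)
  qed
  have nnL2: "(\<integral>\<^sup>+x. ennreal ((u j x - u n x)\<^sup>2) \<partial>lborel) \<le> ennreal (4 * (1/4) ^ n / q)" if "n \<le> j" for j n
    using closeL2[OF that] H0D(3)[OF H0_diff[OF u(1)[of j] u(1)[of n]]] q
    by (subst nn_integral_eq_integral) (auto simp: field_simps intro!: ennreal_leI)
  have conv: "AE x in lborel. convergent (\<lambda>n. u n x)"
  proof -
    \<comment> \<open>The weight 2^n still leaves a convergent series of integrals, since the
      squared differences decay like 4^(-n), and it gives |u_(n+1) - u_n| \<le> 2^(-n) + g n
      pointwise.\<close>
    define g where "g n x = 2 ^ n * (u (Suc n) x - u n x)\<^sup>2" for n x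
    have [measurable]: "g n \<in> borel_measurable borel" for n unfolding g_def[abs_def] by measurable
    have gn: "(\<integral>\<^sup>+x. ennreal (g n x) \<partial>lborel) \<le> ennreal (4 / q * (1/2) ^ n)" for n
    proof -
      have "(\<integral>\<^sup>+x. ennreal (g n x) \<partial>lborel) = ennreal (2 ^ n) * (\<integral>\<^sup>+x. ennreal ((u (Suc n) x - u n x)\<^sup>2) \<partial>lborel)"
        by (simp add: g_def ennreal_mult nn_integral_cmult)
      also have "\<dots> \<le> ennreal (2 ^ n) * ennreal (4 * (1/4) ^ n / q)"
        by (intro mult_left_mono nnL2) auto
      also have "\<dots> = ennreal (2 ^ n * (4 * (1/4) ^ n / q))" using q by (intro ennreal_mult[symmetric]) auto
      also have "2 ^ n * (4 * (1/4) ^ n / q) = 4 / q * ((2::real) * (1/4)) ^ n"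
        unfolding power_mult_distrib by simp
      finally show ?thesis by simp
    qed
    have "(\<integral>\<^sup>+x. (\<Sum>n. ennreal (g n x)) \<partial>lborel) = (\<Sum>n. \<integral>\<^sup>+x. ennreal (g n x) \<partial>lborel)"
      by (rule nn_integral_suminf) measurable
    also have "\<dots> \<le> (\<Sum>n. ennreal (4 / q * (1/2) ^ n))" by (intro suminf_le gn) auto
    also have "\<dots> = ennreal (\<Sum>n. 4 / q * (1/2) ^ n)"
      using q by (intro suminf_ennreal2 summable_mult summable_geometric) auto
    also have "\<dots> < \<infinity>" by simp
    finally have "AE x in lborel. (\<Sum>n. ennreal (g n x)) \<noteq> \<infinity>"
      by (intro nn_integral_noteq_infinite) auto
    then show ?thesis
    proof eventually_elim
      fix x assume "(\<Sum>n. ennreal (g n x)) \<noteq> \<infinity>"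
      then have sg: "summable (\<lambda>n. g n x)"
        by (intro summable_suminf_not_top) (auto simp: g_def)
      have "summable (\<lambda>n. u (Suc n) x - u n x)"
      proof (rule summable_comparison_test')
        show "summable (\<lambda>n. (1/2) ^ n + g n x)" by (intro summable_add sg summable_geometric) auto
        fix n
        let ?a = "\<bar>u (Suc n) x - u n x\<bar>"
        show "norm (u (Suc n) x - u n x) \<le> (1/2) ^ n + g n x"
        proof (cases "?a \<le> (1/2) ^ n")
          case False
          then have "1 \<le> 2 ^ n * ?a" by (simp add: power_divide field_simps)
          then have "?a * 1 \<le> ?a * (2 ^ n * ?a)" by (intro mult_left_mono) auto
          also have "\<dots> = 2 ^ n * ?a\<^sup>2" by (simp add: power2_eq_square)
          also have "\<dots> = g n x" by (simp add: g_def)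
          finally show ?thesis by (simp add: add_increasing)
        qed (simp add: g_def add_increasing2)
      qed
      then have "convergent (\<lambda>n. \<Sum>i<n. u (Suc i) x - u i x)" by (simp add: summable_iff_convergent)
      then have "convergent (\<lambda>n. (\<Sum>i<n. u (Suc i) x - u i x) + u 0 x)" by (intro convergent_add convergent_const)
      then show "convergent (\<lambda>n. u n x)" by (simp add: sum_lessThan_telescope[of "\<lambda>i. u i x"])
    qed
  qed
  \<comment> \<open>Outside \<Omega> every term is 0, so \<open>lim\<close> returns 0 at each point
    there; divergence is confined to a null set.\<close>
  define \<phi> where "\<phi> x = lim (\<lambda>n. u n x)" for x
  have \<phi>_meas [measurable]: "\<phi> \<in> borel_measurable borel" unfolding \<phi>_def[abs_def] by measurable
  have lim: "AE x in lborel. (\<lambda>n. u n x) \<longlonglongrightarrow> \<phi> x"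
    using conv by eventually_elim (simp add: \<phi>_def convergent_LIMSEQ_iff)
  have E_\<phi>: "energy (\<lambda>x. \<phi> x - u n x) \<le> ennreal (4 * (1/4) ^ n)" for n
    unfolding energy_def
  proof (rule nn_integral_le_of_AE_tendsto)
    show "(\<lambda>p. (incr (\<lambda>x. u j x - u n x) p)\<^sup>2) \<in> borel_measurable jump" for j by measurable
    show "AE p in jump. (\<lambda>j. (incr (\<lambda>x. u j x - u n x) p)\<^sup>2) \<longlonglongrightarrow> (incr (\<lambda>x. \<phi> x - u n x) p)\<^sup>2"
      using AE_jump_fst[OF lim] AE_jump_snd[OF lim]
      by eventually_elim (auto simp: incr_def intro!: tendsto_intros)
    show "\<forall>\<^sub>F j in sequentially. (\<integral>\<^sup>+p. ennreal ((incr (\<lambda>x. u j x - u n x) p)\<^sup>2) \<partial>jump) \<le> ennreal (4 * (1/4) ^ n)"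
      using eventually_ge_at_top[of n]
    proof eventually_elim
      case (elim j)
      then show ?case
        using closeE[OF elim] energy_eq_form[OF H0D(1)[OF H0_diff[OF u(1)[of j] u(1)[of n]]]]
        by (auto simp: energy_def intro: ennreal_leI)
    qed
  qed
  have L2_\<phi>: "(\<integral>\<^sup>+x. ennreal ((\<phi> x - u n x)\<^sup>2) \<partial>lborel) \<le> ennreal (4 * (1/4) ^ n / q)" for n
  proof (rule nn_integral_le_of_AE_tendsto)
    show "(\<lambda>x. (u j x - u n x)\<^sup>2) \<in> borel_measurable lborel" for j by measurable
    show "AE x in lborel. (\<lambda>j. (u j x - u n x)\<^sup>2) \<longlonglongrightarrow> (\<phi> x - u n x)\<^sup>2"
      using lim by eventually_elim (auto intro!: tendsto_intros)
    show "\<forall>\<^sub>F j in sequentially. (\<integral>\<^sup>+x. ennreal ((u j x - u n x)\<^sup>2) \<partial>lborel) \<le> ennreal (4 * (1/4) ^ n / q)"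
      using eventually_ge_at_top[of n] by eventually_elim (rule nnL2)
  qed
  have d\<phi>: "(\<lambda>x. \<phi> x - u n x) \<in> H0 \<Omega>" for n
  proof -
    have "finite_energy (\<lambda>x. \<phi> x - u n x)" using E_\<phi>[of n] by (auto simp: finite_energy_def intro: le_less_trans)
    moreover have "integrable lborel (\<lambda>x. (\<phi> x - u n x)\<^sup>2)"
      using L2_\<phi>[of n] by (intro integrableI_nonneg) (auto intro: le_less_trans)
    moreover have "\<phi> x - u n x = 0" if "x \<notin> \<Omega>" for x
      using H0D(2)[OF u(1) that] by (simp add: \<phi>_def limI)
    ultimately show ?thesis by (simp add: H0_def)
  qed
  have \<phi>: "\<phi> \<in> H0 \<Omega>" using H0_add[OF d\<phi>[of 0] u(1)[of 0]] by simp
  have bd: "b (\<lambda>x. \<phi> x - u n x) (\<lambda>x. \<phi> x - u n x) \<le> 8 * (1/4) ^ n" for n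
  proof -
    have "form (\<lambda>x. \<phi> x - u n x) (\<lambda>x. \<phi> x - u n x) \<le> 4 * (1/4) ^ n"
      using E_\<phi>[of n] energy_eq_form[OF H0D(1)[OF d\<phi>[of n]]] by simp
    moreover have "(\<integral>x. (\<phi> x - u n x)\<^sup>2 \<partial>lborel) \<le> 4 * (1/4) ^ n / q"
      using L2_\<phi>[of n] H0D(3)[OF d\<phi>[of n]] q by (subst (asm) nn_integral_eq_integral) auto
    then have "q * (\<integral>x. (\<phi> x - u n x)\<^sup>2 \<partial>lborel) \<le> 4 * (1/4) ^ n"
      using q by (simp add: field_simps)
    ultimately show ?thesis by (simp add: b_def power2_eq_square)
  qed
  have EL: "b \<phi> v = L v" if v: "v \<in> H0 \<Omega>" for v
  proof -
    have "2 * \<bar>b \<phi> v - L v\<bar> \<le> (9 + 2 * b v v) * (1/2) ^ n" for n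
    proof -
      have "b \<phi> v = b (\<lambda>x. \<phi> x - u n x) v + b (u n) v"
        using b_add_left[OF d\<phi>[of n] u(1)[of n] v] by simp
      moreover have "2 * \<bar>b (\<lambda>x. \<phi> x - u n x) v\<bar> \<le> 8 * (1/2) ^ n + (1/2) ^ n * b v v"
      proof -
        have "2 * \<bar>b (\<lambda>x. \<phi> x - u n x) v\<bar> \<le> b (\<lambda>x. \<phi> x - u n x) (\<lambda>x. \<phi> x - u n x) / (1/2) ^ n + (1/2) ^ n * b v v"
          by (rule b_bound[OF d\<phi> v]) auto
        also have "b (\<lambda>x. \<phi> x - u n x) (\<lambda>x. \<phi> x - u n x) / (1/2) ^ n \<le> 8 * (1/4) ^ n / (1/2) ^ n"
          by (intro divide_right_mono bd) auto
        also have "8 * (1/4) ^ n / (1/2) ^ n = 8 * ((1/4) / (1/2) :: real) ^ n"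
          by (simp only: power_divide times_divide_eq_right)
        also have "\<dots> = 8 * (1/2 :: real) ^ n" by simp
        finally show ?thesis by simp
      qed
      moreover have "2 * \<bar>b (u n) v - L v\<bar> \<le> (1/2) ^ n * (1 + b v v)"
        by (rule approximate_euler_lagrange[OF m u(1) u(2) _ v]) auto
      ultimately show ?thesis by (simp add: algebra_simps abs_if split: if_splits)
    qed
    moreover have "(\<lambda>n. (9 + 2 * b v v) * (1/2) ^ n) \<longlonglongrightarrow> (9 + 2 * b v v) * 0"
      by (intro tendsto_mult tendsto_const LIMSEQ_power_zero) auto
    ultimately have "2 * \<bar>b \<phi> v - L v\<bar> \<le> (9 + 2 * b v v) * 0"
      by (intro LIMSEQ_le_const[of _ _ "2 * \<bar>b \<phi> v - L v\<bar>"]) auto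
    then show ?thesis by simp
  qed
  \<comment> \<open>The expansion of J at a solution of the equation has no linear term and a
    nonnegative quadratic one.\<close>
  have min: "J \<phi> \<le> J w" if "w \<in> H0 \<Omega>" for w
    using J_expand[OF \<phi> H0_diff[OF that \<phi>], of 1] EL[OF H0_diff[OF that \<phi>]] b_nonneg[of "\<lambda>x. w x - \<phi> x"]
    by simp
  \<comment> \<open>The function q t^2 - 2 t is smallest at 1/q and q t^2 at 0, so clamping lowers
    the zero-order part both on A and off A; being a contraction, it lowers the energy too.\<close>
  define c where "c x = max 0 (min (\<phi> x) (1 / q))" for x
  have c01: "0 \<le> c x" "c x \<le> 1 / q" for x using q by (auto simp: c_def)
  have c_lip: "\<bar>c x - c y\<bar> \<le> 1 * \<bar>\<phi> x - \<phi> y\<bar>" for x y using q by (auto simp: c_def max_def min_def)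
  have c_sq: "(c x)\<^sup>2 \<le> (\<phi> x)\<^sup>2" for x
    using q by (subst abs_le_square_iff[symmetric]) (auto simp: c_def max_def min_def)
  have [measurable]: "c \<in> borel_measurable borel" unfolding c_def[abs_def] by measurable
  have c_fin: "finite_energy c" using finite_energy_lipschitz[OF _ H0D(1)[OF \<phi>] c_lip] by simp
  have c: "c \<in> H0 \<Omega>"
  proof -
    have "integrable lborel (\<lambda>x. (c x)\<^sup>2)"
      by (rule Bochner_Integration.integrable_bound[OF H0D(3)[OF \<phi>]]) (use c_sq in auto)
    moreover have "c x = 0" if "x \<notin> \<Omega>" for x using H0D(2)[OF \<phi> that] q by (simp add: c_def)
    ultimately show ?thesis using c_fin by (simp add: H0_def)
  qed
  have "J c \<le> J \<phi>"
  proof -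
    have "form c c \<le> form \<phi> \<phi>" unfolding form_def
    proof (rule integral_mono)
      show "incr c p * incr c p \<le> incr \<phi> p * incr \<phi> p" for p
        using c_lip[of "snd p" "fst p"] abs_le_square_iff[of "incr c p" "incr \<phi> p"] by (simp add: incr_def power2_eq_square)
    qed (use c_fin \<phi> in \<open>auto intro: integrable_incr_mult dest: H0D\<close>)
    moreover have "(\<integral>x. q * (c x * c x) - 2 * (indicator A x * c x) \<partial>lborel) \<le> (\<integral>x. q * (\<phi> x * \<phi> x) - 2 * (indicator A x * \<phi> x) \<partial>lborel)"
    proof (rule integral_mono)
      fix x
      have "q * (c x * c x) - 2 * c x \<le> q * (\<phi> x * \<phi> x) - 2 * \<phi> x"
      proof -
        have "\<bar>q * c x - 1\<bar> \<le> \<bar>q * \<phi> x - 1\<bar>"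
        proof -
          consider "\<phi> x < 0" | "0 \<le> \<phi> x" "\<phi> x \<le> 1 / q" | "\<phi> x > 1 / q" "1 / q > 0" using q by fastforce
          then show ?thesis
          proof cases
            case 1
            then have "c x = 0" "q * \<phi> x < 0" using q by (auto simp: c_def mult_pos_neg)
            then show ?thesis by simp
          next
            case 2 then show ?thesis by (simp add: c_def)
          next
            case 3 then show ?thesis using q by (simp add: c_def)
          qed
        qed
        then have "(q * c x - 1)\<^sup>2 \<le> (q * \<phi> x - 1)\<^sup>2" by (simp add: abs_le_square_iff)
        then have "q * (q * (c x * c x) - 2 * c x) \<le> q * (q * (\<phi> x * \<phi> x) - 2 * \<phi> x)"
          by (simp add: power2_eq_square algebra_simps)
        then show ?thesis using q by simp
      qed
      moreover have "q * (c x * c x) \<le> q * (\<phi> x * \<phi> x)"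
        using c_sq[of x] q by (simp add: power2_eq_square)
      ultimately show "q * (c x * c x) - 2 * (indicator A x * c x) \<le> q * (\<phi> x * \<phi> x) - 2 * (indicator A x * \<phi> x)"
        by (auto simp: indicator_def)
    qed (use c \<phi> in \<open>simp_all add: integrable_H0_mult integrable_L\<close>)
    ultimately show ?thesis
      using c \<phi> by (simp add: J_def b_def L_def integrable_H0_mult integrable_L)
  qed
  then have c_le: "J c \<le> J \<phi> + \<delta>\<^sup>2" for \<delta> by (simp add: add_increasing2)
  have "b c v = L v" if v: "v \<in> H0 \<Omega>" for v
  proof (rule ccontr)
    assume ne: "b c v \<noteq> L v"
    \<comment> \<open>This \<delta> turns the approximate equation into 2 z \<le> z for z = |b c v -
      L v| > 0.\<close>
    define \<delta> where "\<delta> = \<bar>b c v - L v\<bar> / (1 + b v v)"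
    have pos: "1 + b v v > 0" using b_nonneg[of v] by linarith
    have "\<delta> > 0" using ne pos by (simp add: \<delta>_def)
    from approximate_euler_lagrange[OF min c c_le this v] have "2 * \<bar>b c v - L v\<bar> \<le> \<bar>b c v - L v\<bar>"
      using pos by (simp add: \<delta>_def)
    then show False using ne by simp
  qed
  then show ?thesis using c c01 by blast
qed

end

section \<open>Interior continuity of solutions\<close>

context symmetric_kernel begin

lemma energy_nn_eq_jump:
  assumes [measurable]: "u \<in> borel_measurable borel" "B \<in> sets borel"
  shows "energy_nn B k u = (\<integral>\<^sup>+p. indicator B (fst p) * (indicator B (snd p) * ennreal ((incr u p)\<^sup>2)) \<partial>jump)"
proof -
  have "(\<integral>\<^sup>+p. indicator B (fst p) * (indicator B (snd p) * ennreal ((incr u p)\<^sup>2)) \<partial>jump)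
     = (\<integral>\<^sup>+x. \<integral>\<^sup>+y. ennreal (k x y) * (indicator B x * (indicator B y * ennreal ((u y - u x)\<^sup>2))) \<partial>lborel \<partial>lborel)"
    by (subst nn_integral_jump) (simp_all add: incr_def)
  also have "\<dots> = (\<integral>\<^sup>+x. \<integral>\<^sup>+y. indicator B x * (indicator B y * ennreal ((u y - u x)\<^sup>2 * k x y)) \<partial>lborel \<partial>lborel)"
    by (simp add: ennreal_mult k_nonneg mult_ac)
  also have "\<dots> = energy_nn B k u"
    unfolding energy_nn_def nn_integral_completion
    by (intro nn_integral_cong nn_integral_cmult) measurable
  finally show ?thesis ..
qed

text \<open>The weak inequality L u \<ge> -K in a ball, L being the operator of the form. The bound
  c makes \<zeta> integrable, so that the integral on the right is a genuine one.\<close>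

definition supersolution :: "real \<Rightarrow> 'a \<Rightarrow> real \<Rightarrow> ('a \<Rightarrow> real) \<Rightarrow> bool" where
  "supersolution K x0 \<rho> u \<longleftrightarrow> (\<forall>\<zeta> c. finite_energy \<zeta> \<longrightarrow> (\<forall>x. 0 \<le> \<zeta> x \<and> \<zeta> x \<le> c) \<longrightarrow>
     (\<forall>x. x \<notin> ball x0 \<rho> \<longrightarrow> \<zeta> x = 0) \<longrightarrow> form u \<zeta> \<ge> - K * (\<integral>x. \<zeta> x \<partial>lborel))"

lemma supersolutionD:
  assumes "supersolution K x0 \<rho> u" "finite_energy \<zeta>" "\<And>x. 0 \<le> \<zeta> x" "\<And>x. \<zeta> x \<le> c" "\<And>x. x \<notin> ball x0 \<rho> \<Longrightarrow> \<zeta> x = 0"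
  shows "form u \<zeta> \<ge> - K * (\<integral>x. \<zeta> x \<partial>lborel)"
  using assms unfolding supersolution_def by blast

lemma supersolution_cong:
  assumes "supersolution K x0 \<rho> u" "\<rho>' \<le> \<rho>" "\<And>x y. u' x - u' y = u x - u y"
  shows "supersolution K x0 \<rho>' u'"
  using assms(1,2) form_cong_incr[of u' u, OF assms(3)] by (auto simp: supersolution_def)

lemma energy_nn_UNIV: "u \<in> borel_measurable borel \<Longrightarrow> energy_nn UNIV k u = energy u"
  by (subst energy_nn_eq_jump) (auto simp: energy_def)

end

lemma not_AE_notin_ball:
  fixes x0 :: "'a::euclidean_space"
  assumes "r > 0"
  shows "\<not> (AE x in lborel. x \<notin> ball x0 r)"
proof
  assume "AE x in lborel. x \<notin> ball x0 r"
  then have "emeasure lborel (ball x0 r) = 0"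
    by (subst (asm) AE_iff_measurable[of "ball x0 r"]) auto
  then have "measure lborel (ball x0 r) = 0" by (simp add: measure_def)
  then show False using content_ball_gt_0_iff[of x0 r] assms by simp
qed

lemma integrable_bounded_support:
  fixes f :: "'a::euclidean_space \<Rightarrow> real"
  assumes [measurable]: "f \<in> borel_measurable borel" and "\<And>x. \<bar>f x\<bar> \<le> c" "\<And>x. x \<notin> S \<Longrightarrow> f x = 0"
    "S \<in> sets borel" "emeasure lborel S < \<infinity>"
  shows "integrable lborel f"
proof (rule Bochner_Integration.integrable_bound)
  show "integrable lborel (\<lambda>x. c * indicator S x :: real)" using assms by simp
  show "AE x in lborel. norm (f x) \<le> norm (c * indicator S x :: real)"
    using assms(2,3) by (intro AE_I2) (auto simp: indicator_def intro: order_trans[OF _ abs_ge_self])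
qed simp

lemma integral_le_bounded_support:
  fixes f :: "'a::euclidean_space \<Rightarrow> real"
  assumes "\<And>x. f x \<le> c" "\<And>x. x \<notin> S \<Longrightarrow> f x = 0" "c \<ge> 0"
    "S \<in> sets borel" "emeasure lborel S < \<infinity>"
  shows "(\<integral>x. f x \<partial>lborel) \<le> c * measure lborel S"
proof -
  have "(\<integral>x. f x \<partial>lborel) \<le> (\<integral>x. c * indicator S x \<partial>lborel)"
  proof (rule integral_mono')
    show "integrable lborel (\<lambda>x. c * indicator S x :: real)" using assms by simp
  qed (use assms in \<open>auto simp: indicator_def\<close>)
  then show ?thesis using assms by simp
qed

context bounded_kernel begin

text \<open>Products of g and \<zeta> at the same point vanish almost everywhere, and a jump from
  the support of \<zeta> to that of g has length at least \<rho>/2, where \<open>trunc\<close> is 1.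
  What remains is (U1) integrated against \<zeta>. In this way values far from the ball enter as a
  bounded source.\<close>

lemma form_tail_lower:
  assumes g: "finite_energy g" "\<And>x. 0 \<le> g x" "\<And>x. g x \<le> M" "AE x in lborel. x \<in> ball x0 \<rho> \<longrightarrow> g x = 0"
    and \<zeta>: "finite_energy \<zeta>" "\<And>x. 0 \<le> \<zeta> x" "\<And>x. \<zeta> x \<le> c" "\<And>x. x \<notin> ball x0 (\<rho> / 2) \<Longrightarrow> \<zeta> x = 0" and "\<rho> > 0"
  shows "form g \<zeta> \<ge> - (2 * M * c_U * (\<rho> / 2) powr (- \<alpha>)) * (\<integral>x. \<zeta> x \<partial>lborel)"
proof -
  define h where "h = \<rho> / 2"
  have h: "h > 0" using \<open>\<rho> > 0\<close> by (simp add: h_def)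
  have M0: "M \<ge> 0" using g(2,3)[of x0] by linarith
  have [measurable]: "\<zeta> \<in> borel_measurable borel" "g \<in> borel_measurable borel" using \<zeta>(1) g(1) by measurable
  have \<zeta>_int: "integrable lborel \<zeta>"
    by (rule integrable_bounded_support[where c = c and S = "ball x0 (\<rho> / 2)"])
       (use \<zeta> emeasure_lborel_ball_finite[of x0 "\<rho>/2"] in \<open>auto simp: abs_of_nonneg\<close>)
  have nz: "(\<integral>\<^sup>+x. ennreal (\<zeta> x) \<partial>lborel) = ennreal (\<integral>x. \<zeta> x \<partial>lborel)"
    using \<zeta>_int \<zeta>(2) by (intro nn_integral_eq_integral) auto
  define T where "T p = (\<zeta> (fst p) + \<zeta> (snd p)) * trunc h p" for p
  have [measurable]: "T \<in> borel_measurable borel" unfolding T_def[abs_def] by measurable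
  have T0: "T p \<ge> 0" for p using \<zeta>(2) by (simp add: T_def trunc_nonneg)
  have z0: "(\<integral>x. \<zeta> x \<partial>lborel) \<ge> 0" using \<zeta>(2) by (intro Bochner_Integration.integral_nonneg) auto
  have "(\<integral>\<^sup>+p. ennreal (T p) \<partial>jump) = (\<integral>\<^sup>+p. ennreal (\<zeta> (fst p)) * ennreal (trunc h p) + ennreal (\<zeta> (snd p)) * ennreal (trunc h p) \<partial>jump)"
    using \<zeta>(2) by (intro nn_integral_cong) (simp add: T_def ennreal_mult trunc_nonneg distrib_right)
  also have "\<dots> = (\<integral>\<^sup>+p. ennreal (\<zeta> (fst p)) * ennreal (trunc h p) \<partial>jump) + (\<integral>\<^sup>+p. ennreal (\<zeta> (snd p)) * ennreal (trunc h p) \<partial>jump)"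
    by (rule nn_integral_add) measurable
  also have "\<dots> \<le> ennreal (c_U * h powr (- \<alpha>)) * ennreal (\<integral>x. \<zeta> x \<partial>lborel) + ennreal (c_U * h powr (- \<alpha>)) * ennreal (\<integral>x. \<zeta> x \<partial>lborel)"
    unfolding nz[symmetric] by (intro add_mono nn_integral_trunc_fst nn_integral_trunc_snd h) measurable
  also have "\<dots> = ennreal (2 * c_U * h powr (- \<alpha>) * (\<integral>x. \<zeta> x \<partial>lborel))"
    using z0 c_U_nonneg by (simp add: ennreal_mult[symmetric] ennreal_plus[symmetric] del: ennreal_plus)
  finally have Ti: "(\<integral>\<^sup>+p. ennreal (T p) \<partial>jump) \<le> ennreal (2 * c_U * h powr (- \<alpha>) * (\<integral>x. \<zeta> x \<partial>lborel))" .
  have T_int: "integrable jump T"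
    using Ti T0 by (intro integrableI_nonneg) (auto intro: le_less_trans)
  have T_le: "(\<integral>p. T p \<partial>jump) \<le> 2 * c_U * h powr (- \<alpha>) * (\<integral>x. \<zeta> x \<partial>lborel)"
    using Ti T0 z0 c_U_nonneg by (subst integral_eq_nn_integral) (auto intro!: enn2real_leI)
  have "(\<integral>p. - (M * T p) \<partial>jump) \<le> form g \<zeta>"
    unfolding form_def
  proof (rule integral_mono_AE)
    show "integrable jump (\<lambda>p. - (M * T p))" using T_int by simp
    show "integrable jump (\<lambda>p. incr g p * incr \<zeta> p)" by (rule integrable_incr_mult[OF g(1) \<zeta>(1)])
    show "AE p in jump. - (M * T p) \<le> incr g p * incr \<zeta> p"
      using AE_jump_fst[OF g(4)] AE_jump_snd[OF g(4)]
    proof eventually_elim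
      case (elim p)
      obtain x y where p: "p = (x, y)" by force
      have half: "\<zeta> z \<noteq> 0 \<Longrightarrow> z \<in> ball x0 (\<rho> / 2)" for z using \<zeta>(4) by auto
      have gz: "g x * \<zeta> x = 0" "g y * \<zeta> y = 0"
        using elim half[of x] half[of y] \<open>\<rho> > 0\<close> unfolding p by (auto; fastforce)+
      have far: "g b * \<zeta> a \<le> M * (\<zeta> a * trunc h p)"
        if "b \<in> ball x0 \<rho> \<longrightarrow> g b = 0" and ab: "dist a b = dist y x" for a b
      proof (cases "\<zeta> a = 0 \<or> g b = 0")
        case True then show ?thesis using M0 \<zeta>(2)[of a] trunc_nonneg[of h p] by auto
      next
        case False
        then have "dist x0 a < \<rho> / 2" "dist x0 b \<ge> \<rho>" using half[of a] that(1) by auto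
        then have "h \<le> dist a b" using dist_triangle[of x0 b a] by (simp add: h_def)
        then have "trunc h p = 1" using h power_mono[of h "dist a b" 2] ab
          by (simp add: trunc_def p min_def divide_simps)
        then show ?thesis using g(3)[of b] \<zeta>(2)[of a] by (simp add: mult_right_mono)
      qed
      have "g y * \<zeta> x \<le> M * (\<zeta> x * trunc h p)" "g x * \<zeta> y \<le> M * (\<zeta> y * trunc h p)"
        using elim unfolding p by (intro far[unfolded p]; simp add: dist_commute)+
      moreover have "incr g p * incr \<zeta> p = g y * \<zeta> y + g x * \<zeta> x - g y * \<zeta> x - g x * \<zeta> y"
        by (simp add: incr_def p algebra_simps)
      moreover have "M * T p = M * (\<zeta> x * trunc h p) + M * (\<zeta> y * trunc h p)"
        by (simp add: T_def p algebra_simps)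
      ultimately show "- (M * T p) \<le> incr g p * incr \<zeta> p"
        using gz by linarith
    qed
  qed
  moreover have "(\<integral>p. - (M * T p) \<partial>jump) = - (M * (\<integral>p. T p \<partial>jump))" using T_int by simp
  moreover have "M * (\<integral>p. T p \<partial>jump) \<le> M * (2 * c_U * h powr (- \<alpha>) * (\<integral>x. \<zeta> x \<partial>lborel))"
    by (rule mult_left_mono[OF T_le M0])
  ultimately show ?thesis by (simp add: h_def mult_ac)
qed

end

section \<open>Logarithmic estimate and vanishing oscillation\<close>

text \<open>With t half the logarithm of b / a, the right-hand side is 4 sinh(t)^2, and |t| \<le>
  |sinh t|. The right-hand side is Picone's remainder where the cutoff is 1.\<close>

lemma ln_diff_square_le:
  assumes "a > 0" "b > (0::real)"
  shows "(ln b - ln a)\<^sup>2 \<le> (a - b)\<^sup>2 / (a * b)"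
proof -
  define t where "t = (ln b - ln a) / 2"
  have e: "exp t * exp t = b / a"
    using assms by (simp add: t_def exp_add[symmetric] exp_diff)
  have "\<bar>t\<bar> \<le> \<bar>(exp t - inverse (exp t)) / 2\<bar>" by (rule real_le_abs_sinh)
  then have "\<bar>2 * t\<bar> \<le> \<bar>exp t - inverse (exp t)\<bar>" by simp
  then have "(2 * t)\<^sup>2 \<le> (exp t - inverse (exp t))\<^sup>2" by (simp add: abs_le_square_iff)
  also have "\<dots> = exp t * exp t - 2 + inverse (exp t * exp t)"
    by (simp add: power2_eq_square algebra_simps)
  also have "\<dots> = (a - b)\<^sup>2 / (a * b)"
    unfolding e using assms by (simp add: field_simps power2_eq_square)
  also have "2 * t = ln b - ln a" by (simp add: t_def)
  finally show ?thesis .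
qed

locale elliptic_kernel = degiorgi_kernel k \<alpha> c_U \<alpha>0 C_F
  for k :: "'a::euclidean_space \<Rightarrow> 'a \<Rightarrow> real" and \<alpha> c_U \<alpha>0 C_F +
  fixes c_l :: real
  assumes E_ge: "cond_E_ge \<alpha> c_l k" and c_l_pos: "c_l > 0"
begin

text \<open>Two points of the ball are at most 2 \<rho> apart, so the fractional kernel is bounded
  below by its value at that distance, and (E_\<ge>) on the same ball finishes. The constant
  contains the reciprocal of \<open>frac_const\<close> and blows up as \<alpha> tends to 2; it
  serves continuity alone.\<close>

lemma ball_poincare:
  "\<exists>C>0. \<forall>(u :: 'a \<Rightarrow> real) x0 M \<rho>. u \<in> borel_measurable borel \<longrightarrow> (\<forall>x. \<bar>u x\<bar> \<le> M) \<longrightarrow> \<rho> > 0 \<longrightarrow>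
     (\<integral>\<^sup>+x. \<integral>\<^sup>+y. indicator (ball x0 \<rho>) x * (indicator (ball x0 \<rho>) y * ennreal ((u y - u x)\<^sup>2)) \<partial>lborel \<partial>lborel)
       \<le> ennreal (C * \<rho> powr (real DIM('a) + \<alpha>)) * energy_nn (ball x0 \<rho>) k u"
proof -
  let ?d = "real DIM('a)"
  define c where "c = frac_const ?d \<alpha>"
  obtain c' where "c' > 0" "c' * (2 - \<alpha>) \<le> c"
    using frac_const_lower[of ?d \<alpha>] \<alpha> by (auto simp: c_def)
  then have c: "c > 0" using \<alpha> by (smt (verit) mult_pos_pos)
  define C where "C = 2 powr (?d + \<alpha>) / (c_l * c)"
  have C: "C > 0" using c c_l_pos by (simp add: C_def)
  show ?thesis
  proof (intro exI[of _ C] conjI C allI impI)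
    fix u :: "'a \<Rightarrow> real" and x0 :: 'a and M \<rho> :: real
    assume [measurable]: "u \<in> borel_measurable borel" and bd: "\<forall>x. \<bar>u x\<bar> \<le> M" and "\<rho> > 0"
    let ?B = "ball x0 \<rho>"
    define I where "I = (\<integral>\<^sup>+x. \<integral>\<^sup>+y. indicator ?B x * (indicator ?B y * ennreal ((u y - u x)\<^sup>2)) \<partial>lborel \<partial>lborel)"
    define e where "e = c * (2 * \<rho>) powr (- ?d - \<alpha>)"
    have e: "e > 0" using c \<open>\<rho> > 0\<close> by (simp add: e_def)
    have "L2_on ?B u"
      unfolding L2_on_def nn_integral_completion
    proof (intro conjI measurable_completion)
      have "(\<integral>\<^sup>+x. indicator ?B x * ennreal ((u x)\<^sup>2) \<partial>lborel) \<le> (\<integral>\<^sup>+x. ennreal (M\<^sup>2) * indicator ?B x \<partial>lborel)"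
        using bd by (intro nn_integral_mono) (auto simp: indicator_def abs_le_square_iff[symmetric] intro!: ennreal_leI order_trans[OF _ abs_ge_self])
      also have "\<dots> < \<infinity>" using emeasure_lborel_ball_finite[of x0 \<rho>] by (simp add: nn_integral_cmult ennreal_mult_less_top)
      finally show "(\<integral>\<^sup>+x. indicator ?B x * ennreal ((u x)\<^sup>2) \<partial>lborel) < \<infinity>" .
    qed simp
    then have E: "ennreal c_l * energy_nn ?B (frac_kernel \<alpha>) u \<le> energy_nn ?B k u"
      using E_ge \<open>\<rho> > 0\<close> by (auto simp: cond_E_ge_def)
    have "ennreal e * I = (\<integral>\<^sup>+x. \<integral>\<^sup>+y. ennreal e * (indicator ?B x * (indicator ?B y * ennreal ((u y - u x)\<^sup>2))) \<partial>lborel \<partial>lborel)"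
      unfolding I_def by (subst nn_integral_cmult[symmetric], measurable) (intro nn_integral_cong nn_integral_cmult[symmetric], measurable)
    also have "\<dots> \<le> (\<integral>\<^sup>+x. \<integral>\<^sup>+y. indicator ?B x * (indicator ?B y * ennreal ((u y - u x)\<^sup>2 * frac_kernel \<alpha> x y)) \<partial>lborel \<partial>lborel)"
    proof (intro nn_integral_mono)
      fix x y
      show "ennreal e * (indicator ?B x * (indicator ?B y * ennreal ((u y - u x)\<^sup>2)))
         \<le> indicator ?B x * (indicator ?B y * ennreal ((u y - u x)\<^sup>2 * frac_kernel \<alpha> x y))"
      proof (cases "x \<in> ?B \<and> y \<in> ?B \<and> x \<noteq> y")
        case True
        then have "dist y x \<le> 2 * \<rho>" using dist_triangle2[of y x x0] by (auto simp: dist_commute)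
        then have "(2 * \<rho>) powr (- ?d - \<alpha>) \<le> dist y x powr (- ?d - \<alpha>)"
          using True \<alpha> by (intro powr_mono2') auto
        moreover have "frac_kernel \<alpha> x y = c * dist y x powr (- ?d - \<alpha>)"
          by (simp add: frac_kernel_def c_def frac_const_def)
        ultimately have "e \<le> frac_kernel \<alpha> x y"
          using c by (simp add: e_def)
        then have "(u y - u x)\<^sup>2 * e \<le> (u y - u x)\<^sup>2 * frac_kernel \<alpha> x y" by (intro mult_left_mono) auto
        then show ?thesis using True e
          by (simp add: ennreal_mult[symmetric] mult.commute ennreal_leI)
      qed (auto simp: indicator_def)
    qed
    also have "\<dots> = energy_nn ?B (frac_kernel \<alpha>) u"
      unfolding energy_nn_def nn_integral_completion
      by (intro nn_integral_cong nn_integral_cmult) (simp add: frac_kernel_def)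
    finally have 1: "ennreal e * I \<le> energy_nn ?B (frac_kernel \<alpha>) u" .
    have ce: "C * \<rho> powr (?d + \<alpha>) * (c_l * e) = 1"
    proof -
      have "(2 * \<rho>) powr (- ?d - \<alpha>) = inverse (2 powr (?d + \<alpha>) * \<rho> powr (?d + \<alpha>))"
        using \<open>\<rho> > 0\<close> powr_minus[of "2 * \<rho>" "?d + \<alpha>"] by (simp add: powr_mult)
      then show ?thesis using c c_l_pos \<open>\<rho> > 0\<close> by (simp add: C_def e_def field_simps)
    qed
    have "I = ennreal (C * \<rho> powr (?d + \<alpha>) * (c_l * e)) * I" by (simp add: ce)
    also have "\<dots> = ennreal (C * \<rho> powr (?d + \<alpha>)) * (ennreal c_l * (ennreal e * I))"
      using C c_l_pos e by (simp add: ennreal_mult mult.assoc)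
    also have "\<dots> \<le> ennreal (C * \<rho> powr (?d + \<alpha>)) * (ennreal c_l * energy_nn ?B (frac_kernel \<alpha>) u)"
      by (intro mult_left_mono 1) auto
    also have "\<dots> \<le> ennreal (C * \<rho> powr (?d + \<alpha>)) * energy_nn ?B k u"
      by (intro mult_left_mono E) auto
    finally show "I \<le> ennreal (C * \<rho> powr (?d + \<alpha>)) * energy_nn ?B k u" .
  qed
qed

text \<open>Picone with \<eta>^2 / v bounds the energy of ln v on the ball by a multiple of
  \<rho>^(d-\<alpha>), hence by \<open>ball_poincare\<close> the double integral of its squared
  differences by a multiple of \<rho>^(2d). Each pair of points from the two level sets contributes
  at least the square of ln (a / b').\<close>

lemma log_small_set:
  "\<exists>C>0. \<forall>v x0 s M \<rho> K a b'. finite_energy v \<longrightarrow> 0 < s \<longrightarrow> (\<forall>x. s \<le> v x \<and> v x \<le> M) \<longrightarrow> \<rho> > 0 \<longrightarrow> 0 \<le> K \<longrightarrow>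
     K \<le> s * \<rho> powr (- \<alpha>) \<longrightarrow> 0 < b' \<longrightarrow> b' < a \<longrightarrow> supersolution K x0 (2 * \<rho>) v \<longrightarrow>
     measure lborel ({x. a \<le> v x} \<inter> ball x0 \<rho>) * measure lborel ({x. v x < b'} \<inter> ball x0 \<rho>) * (ln (a / b'))\<^sup>2
       \<le> C * (\<rho> ^ DIM('a))\<^sup>2"
proof -
  let ?d = "real DIM('a)"
  obtain C0 where C0: "C0 > 0" "\<And>(u :: 'a \<Rightarrow> real) x0 M \<rho>. u \<in> borel_measurable borel \<Longrightarrow> (\<And>x. \<bar>u x\<bar> \<le> M) \<Longrightarrow> \<rho> > 0 \<Longrightarrow>
     (\<integral>\<^sup>+x. \<integral>\<^sup>+y. indicator (ball x0 \<rho>) x * (indicator (ball x0 \<rho>) y * ennreal ((u y - u x)\<^sup>2)) \<partial>lborel \<partial>lborel)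
       \<le> ennreal (C0 * \<rho> powr (?d + \<alpha>)) * energy_nn (ball x0 \<rho>) k u"
    using ball_poincare by meson
  define \<omega> where "\<omega> = unit_ball_vol ?d"
  have \<omega>: "\<omega> > 0" by (simp add: \<omega>_def)
  define C where "C = C0 * ((2 * c_U + 1) * (\<omega> * 2 ^ DIM('a)))"
  have C: "C > 0" using C0 c_U_nonneg \<omega> by (simp add: C_def)
  show ?thesis
  proof (intro exI[of _ C] conjI C allI impI)
    fix v x0 and s M \<rho> K a b' :: real
    assume v: "finite_energy v" and s: "0 < s" "\<forall>x. s \<le> v x \<and> v x \<le> M" and \<rho>: "\<rho> > 0" and K: "0 \<le> K" "K \<le> s * \<rho> powr (- \<alpha>)"
      and ab: "0 < b'" "b' < a"
      and super: "supersolution K x0 (2 * \<rho>) v"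
    let ?B = "ball x0 \<rho>"
    have [measurable]: "v \<in> borel_measurable borel" using v by measurable
    have pos: "v x > 0" for x using s(1) s(2)[rule_format, of x] by linarith
    define V where "V = measure lborel (ball x0 (2 * \<rho>))"
    have V: "emeasure lborel (ball x0 (2 * \<rho>)) = ennreal V" "V = \<omega> * 2 ^ DIM('a) * \<rho> ^ DIM('a)" "V \<ge> 0"
      using \<rho> by (auto simp: V_def \<omega>_def content_ball emeasure_ball power_mult_distrib)
    define \<eta> where "\<eta> = cutoff x0 (2 * \<rho>) \<rho>"
    have \<eta>: "finite_energy \<eta>" "\<And>x. 0 \<le> \<eta> x" "\<And>x. \<eta> x \<le> 1" "\<And>x. x \<notin> ball x0 (2 * \<rho>) \<Longrightarrow> \<eta> x = 0" "\<And>x. x \<in> ?B \<Longrightarrow> \<eta> x = 1"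
      using finite_energy_cutoff[OF \<rho>] cutoff_bounds cutoff_eq_0[OF \<rho>] cutoff_eq_1[OF \<rho>, of _ x0 "2 * \<rho>"] by (auto simp: \<eta>_def)
    have \<eta>_abs: "\<bar>\<eta> x\<bar> \<le> 1" for x using \<eta>(2,3)[of x] by simp
    define \<zeta> where "\<zeta> = (\<lambda>x. (\<eta> x)\<^sup>2 / v x)"
    define Q where "Q = (\<lambda>p. (\<eta> (snd p) * v (fst p) - \<eta> (fst p) * v (snd p))\<^sup>2 / (v (fst p) * v (snd p)))"
    have sv: "s \<le> v x" for x using s by auto
    note P = picone[OF v s(1) sv \<eta>(1) \<eta>_abs, folded \<zeta>_def Q_def]
    have Q0: "Q p \<ge> 0" for p using pos by (simp add: Q_def less_imp_le)
    have \<zeta>01: "0 \<le> \<zeta> x" "\<zeta> x \<le> 1 / s" "x \<notin> ball x0 (2 * \<rho>) \<Longrightarrow> \<zeta> x = 0" for x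
    proof -
      show "0 \<le> \<zeta> x" using pos[of x] by (simp add: \<zeta>_def)
      have "(\<eta> x)\<^sup>2 \<le> 1" using \<eta>(2,3)[of x] by (simp add: power_le_one)
      then show "\<zeta> x \<le> 1 / s" unfolding \<zeta>_def using s(1) sv[of x] by (intro frac_le) auto
      show "x \<notin> ball x0 (2 * \<rho>) \<Longrightarrow> \<zeta> x = 0" using \<eta>(4)[of x] by (simp add: \<zeta>_def)
    qed
    have "form v \<zeta> \<ge> - K * (\<integral>x. \<zeta> x \<partial>lborel)" by (rule supersolutionD[OF super P(1) \<zeta>01])
    moreover have "K * (\<integral>x. \<zeta> x \<partial>lborel) \<le> \<rho> powr (- \<alpha>) * V"
    proof -
      have "(\<integral>x. \<zeta> x \<partial>lborel) \<le> 1 / s * V"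
        unfolding V_def using \<zeta>01 s(1) emeasure_lborel_ball_finite[of x0 "2 * \<rho>"]
        by (intro integral_le_bounded_support) auto
      then have "K * (\<integral>x. \<zeta> x \<partial>lborel) \<le> K * (1 / s * V)" using K by (intro mult_left_mono)
      also have "\<dots> \<le> (s * \<rho> powr (- \<alpha>)) * (1 / s * V)" using K V s(1) by (intro mult_right_mono) auto
      finally show ?thesis using s(1) by simp
    qed
    moreover have "form \<eta> \<eta> \<le> 2 * c_U * \<rho> powr (- \<alpha>) * V"
    proof -
      have "ennreal (form \<eta> \<eta>) \<le> ennreal (2 * c_U * \<rho> powr (- \<alpha>)) * ennreal V"
        using energy_cutoff[OF \<rho>, of x0 "2 * \<rho>"] energy_eq_form[OF \<eta>(1)] by (simp add: \<eta>_def V)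
      also have "\<dots> = ennreal (2 * c_U * \<rho> powr (- \<alpha>) * V)" using V c_U_nonneg by (simp add: ennreal_mult)
      finally show ?thesis using V c_U_nonneg by (subst (asm) ennreal_le_iff) auto
    qed
    ultimately have Q_le: "(\<integral>p. Q p \<partial>jump) \<le> (2 * c_U + 1) * \<rho> powr (- \<alpha>) * V"
      using P(3) by (simp add: algebra_simps)
    define w where "w x = ln (v x)" for x
    have [measurable]: "w \<in> borel_measurable borel" unfolding w_def[abs_def] by measurable
    have w_bd: "\<bar>w x\<bar> \<le> \<bar>ln s\<bar> + \<bar>ln M\<bar>" for x
    proof -
      have "s \<le> v x" "v x \<le> M" using s by auto
      then have "ln s \<le> w x" "w x \<le> ln M" unfolding w_def using s(1) pos[of x] by auto
      then show ?thesis by linarith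
    qed
    have "energy_nn ?B k w \<le> (\<integral>\<^sup>+p. ennreal (Q p) \<partial>jump)"
      unfolding energy_nn_eq_jump[OF \<open>w \<in> borel_measurable borel\<close> sets_borel_ball]
    proof (intro nn_integral_mono)
      fix p :: "'a \<times> 'a"
      have "fst p \<in> ?B \<Longrightarrow> snd p \<in> ?B \<Longrightarrow> (incr w p)\<^sup>2 \<le> Q p"
        using ln_diff_square_le[OF pos[of "fst p"] pos[of "snd p"]] \<eta>(5) by (simp add: incr_def w_def Q_def)
      then show "indicator ?B (fst p) * (indicator ?B (snd p) * ennreal ((incr w p)\<^sup>2)) \<le> ennreal (Q p)"
        by (auto simp: indicator_def intro!: ennreal_leI)
    qed
    also have "\<dots> = ennreal (\<integral>p. Q p \<partial>jump)" using P(2) Q0 by (intro nn_integral_eq_integral) auto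
    also have "\<dots> \<le> ennreal ((2 * c_U + 1) * \<rho> powr (- \<alpha>) * V)" by (intro ennreal_leI Q_le)
    finally have en: "energy_nn ?B k w \<le> ennreal ((2 * c_U + 1) * \<rho> powr (- \<alpha>) * V)" .
    define P1 where "P1 = {x. a \<le> v x} \<inter> ?B"
    define P2 where "P2 = {x. v x < b'} \<inter> ?B"
    define \<Lambda> where "\<Lambda> = ln (a / b')"
    have [measurable]: "P1 \<in> sets borel" "P2 \<in> sets borel" unfolding P1_def P2_def by measurable
    have \<Lambda>: "\<Lambda> > 0" using ab by (simp add: \<Lambda>_def)
    have fm: "emeasure lborel P1 = ennreal (measure lborel P1)" "emeasure lborel P2 = ennreal (measure lborel P2)"
      using emeasure_mono[of P1 ?B lborel] emeasure_mono[of P2 ?B lborel] emeasure_lborel_ball_finite[of x0 \<rho>]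
      by (auto simp: P1_def P2_def intro!: emeasure_eq_ennreal_measure)
    have "ennreal (measure lborel P1 * measure lborel P2 * \<Lambda>\<^sup>2) = ennreal (\<Lambda>\<^sup>2) * (emeasure lborel P1 * emeasure lborel P2)"
      by (simp add: fm ennreal_mult mult_ac)
    also have "\<dots> = (\<integral>\<^sup>+x. \<integral>\<^sup>+y. ennreal (\<Lambda>\<^sup>2) * (indicator P1 x * indicator P2 y) \<partial>lborel \<partial>lborel)"
      by (simp add: nn_integral_cmult nn_integral_multc)
    also have "\<dots> \<le> (\<integral>\<^sup>+x. \<integral>\<^sup>+y. indicator ?B x * (indicator ?B y * ennreal ((w y - w x)\<^sup>2)) \<partial>lborel \<partial>lborel)"
    proof (intro nn_integral_mono)
      fix x y
      have "\<Lambda>\<^sup>2 \<le> (w y - w x)\<^sup>2" if "x \<in> P1" "y \<in> P2"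
      proof -
        have "ln a \<le> w x" "w y \<le> ln b'" unfolding w_def using that ab pos[of y] by (auto simp: P1_def P2_def)
        then have "\<Lambda> \<le> \<bar>w y - w x\<bar>" using ab by (simp add: \<Lambda>_def ln_div)
        then show ?thesis using \<Lambda> power_mono[of \<Lambda> "\<bar>w y - w x\<bar>" 2] by simp
      qed
      then show "ennreal (\<Lambda>\<^sup>2) * (indicator P1 x * indicator P2 y) \<le> indicator ?B x * (indicator ?B y * ennreal ((w y - w x)\<^sup>2))"
        by (auto simp: indicator_def P1_def P2_def intro!: ennreal_leI)
    qed
    also have "\<dots> \<le> ennreal (C0 * \<rho> powr (?d + \<alpha>)) * energy_nn ?B k w"
      by (rule C0(2)) (use w_bd \<rho> in auto)
    also have "\<dots> \<le> ennreal (C0 * \<rho> powr (?d + \<alpha>)) * ennreal ((2 * c_U + 1) * \<rho> powr (- \<alpha>) * V)"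
      by (intro mult_left_mono en) auto
    also have "\<dots> = ennreal (C0 * \<rho> powr (?d + \<alpha>) * ((2 * c_U + 1) * \<rho> powr (- \<alpha>) * V))"
      using C0(1) c_U_nonneg V by (intro ennreal_mult[symmetric]) auto
    also have "C0 * \<rho> powr (?d + \<alpha>) * ((2 * c_U + 1) * \<rho> powr (- \<alpha>) * V)
       = C0 * ((2 * c_U + 1) * V) * (\<rho> powr (?d + \<alpha>) * \<rho> powr (- \<alpha>))"
      by (simp add: mult_ac)
    also have "\<rho> powr (?d + \<alpha>) * \<rho> powr (- \<alpha>) = \<rho> ^ DIM('a)"
      using \<rho> by (simp add: powr_add[symmetric] powr_realpow)
    also have "C0 * ((2 * c_U + 1) * V) * \<rho> ^ DIM('a) = C * (\<rho> ^ DIM('a))\<^sup>2"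
      by (simp add: C_def V power2_eq_square)
    finally show "measure lborel P1 * measure lborel P2 * \<Lambda>\<^sup>2 \<le> C * (\<rho> ^ DIM('a))\<^sup>2"
      using C by (subst (asm) ennreal_le_iff) auto
  qed
qed

text \<open>\<open>log_small_set\<close> makes the set where u is small compared with D a small
  fraction of the ball, and De Giorgi's lemma removes it. The order of quantifiers is the point:
  \<theta> is fixed before u, D and M, and the tail only shrinks the admissible radius, so the same
  relative gain from -\<theta> D to 2 \<theta> D is available for all data at small scales.\<close>

lemma growth:
  obtains \<theta> :: real where "\<theta> > 0" and "\<forall>u x0 \<rho>0 D M. finite_energy u \<longrightarrow> (\<forall>x. \<bar>u x\<bar> \<le> M) \<longrightarrow> \<rho>0 > 0 \<longrightarrow> D > 0 \<longrightarrow> supersolution 1 x0 \<rho>0 u \<longrightarrow>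
     (AE x in lborel. x \<in> ball x0 \<rho>0 \<longrightarrow> - \<theta> * D \<le> u x) \<longrightarrow>
     (\<exists>\<rho>1>0. \<forall>\<rho>. 0 < \<rho> \<longrightarrow> \<rho> \<le> \<rho>1 \<longrightarrow> measure lborel (ball x0 \<rho>) / 2 \<le> measure lborel ({x. D / 2 \<le> u x} \<inter> ball x0 \<rho>) \<longrightarrow>
        (AE x in lborel. x \<in> ball x0 (\<rho> / 2) \<longrightarrow> 2 * \<theta> * D \<le> u x))"
proof -
  let ?d = "real DIM('a)"
  obtain C where C: "C > 0" and log: "\<forall>v x0 s M \<rho> K a b'. finite_energy v \<longrightarrow> 0 < s \<longrightarrow> (\<forall>x. s \<le> v x \<and> v x \<le> M) \<longrightarrow> \<rho> > 0 \<longrightarrow> 0 \<le> K \<longrightarrow>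
     K \<le> s * \<rho> powr (- \<alpha>) \<longrightarrow> 0 < b' \<longrightarrow> b' < a \<longrightarrow> supersolution K x0 (2 * \<rho>) v \<longrightarrow>
     measure lborel ({x. a \<le> v x} \<inter> ball x0 \<rho>) * measure lborel ({x. v x < b'} \<inter> ball x0 \<rho>) * (ln (a / b'))\<^sup>2
       \<le> C * (\<rho> ^ DIM('a))\<^sup>2"
    using log_small_set by (elim exE conjE)
  define \<omega> where "\<omega> = unit_ball_vol ?d"
  have \<omega>: "\<omega> > 0" by (simp add: \<omega>_def)
  have eps0: "eps0 > 0" using C_F_pos c_U_nonneg by (simp add: eps0_def degiorgi_eps_pos)
  \<comment> \<open>With one level set filling half the ball, a logarithmic gap \<Lambda> forces the
    other below \<open>eps0\<close> times \<rho>^d.\<close>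
  define \<Lambda> where "\<Lambda> = sqrt (2 * C / (\<omega> * eps0)) + 1"
  have sq0: "sqrt (2 * C / (\<omega> * eps0)) \<ge> 0" using C \<omega> eps0 by simp
  then have \<Lambda>: "\<Lambda> > 0" unfolding \<Lambda>_def by linarith
  have \<Lambda>2: "2 * C / (\<omega> * eps0) \<le> \<Lambda>\<^sup>2"
  proof -
    have "(sqrt (2 * C / (\<omega> * eps0)))\<^sup>2 \<le> \<Lambda>\<^sup>2" using sq0 by (intro power_mono) (auto simp: \<Lambda>_def)
    then show ?thesis using C \<omega> eps0 by simp
  qed
  \<comment> \<open>Chosen so that the levels D/2 and 8 \<theta> D have the ratio exp
    \<Lambda>.\<close>
  define \<theta> where "\<theta> = exp (- \<Lambda>) / 16"
  have \<theta>: "\<theta> > 0" by (simp add: \<theta>_def)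
  have \<theta>16: "16 * \<theta> < 1" using \<Lambda> by (simp add: \<theta>_def)
  show thesis
  proof (rule that[OF \<theta>], intro allI impI)
    fix u x0 and \<rho>0 D M :: real
    assume u: "finite_energy u" "\<forall>x. \<bar>u x\<bar> \<le> M" and \<rho>0: "\<rho>0 > 0" and D: "D > 0"
      and super: "supersolution 1 x0 \<rho>0 u"
      and low: "AE x in lborel. x \<in> ball x0 \<rho>0 \<longrightarrow> - \<theta> * D \<le> u x"
    have M: "M \<ge> 0" using u(2)[rule_format, of x0] by linarith
    have \<theta>D: "\<theta> * D > 0" using \<theta> D by simp
    \<comment> \<open>The shift makes v positive, and the truncation at \<theta> D is inactive
      almost everywhere in the ball because u \<ge> -\<theta> D there; the correction g lives
      outside and enters through \<open>form_tail_lower\<close>. De Giorgi halves the level 8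
      \<theta> D to 4 \<theta> D, and undoing the shift leaves 2 \<theta> D.\<close>
    define v where "v x = max (u x + 2 * \<theta> * D) (\<theta> * D)" for x
    define g where "g x = max 0 (- u x - \<theta> * D)" for x
    have vg: "v x = u x + 2 * \<theta> * D + g x" for x by (auto simp: v_def g_def)
    have [measurable]: "u \<in> borel_measurable borel" using u(1) by measurable
    have v: "finite_energy v"
      by (rule finite_energy_lipschitz[OF _ u(1), of _ 1]) (auto simp: v_def[abs_def])
    have g: "finite_energy g"
      by (rule finite_energy_lipschitz[OF _ u(1), of _ 1]) (auto simp: g_def[abs_def])
    have g01: "0 \<le> g x" "g x \<le> M" for x using u(2)[rule_format, of x] \<theta>D M by (auto simp: g_def)
    have gAE: "AE x in lborel. x \<in> ball x0 \<rho>0 \<longrightarrow> g x = 0"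
      using low by eventually_elim (auto simp: g_def)
    define K where "K = 1 + 2 * M * c_U * (\<rho>0 / 2) powr (- \<alpha>)"
    have K: "K > 0" using M c_U_nonneg by (auto simp: K_def intro!: add_pos_nonneg)
    have superv: "form v \<zeta> \<ge> - K * (\<integral>x. \<zeta> x \<partial>lborel)"
      if \<zeta>: "finite_energy \<zeta>" "\<And>x. 0 \<le> \<zeta> x" "\<And>x. \<zeta> x \<le> c" "\<And>x. x \<notin> ball x0 (\<rho>0 / 2) \<Longrightarrow> \<zeta> x = 0" for \<zeta> c
    proof -
      have "form v \<zeta> = form (\<lambda>x. u x + g x) \<zeta>" by (rule form_cong_incr) (auto simp: vg)
      also have "\<dots> = form u \<zeta> + form g \<zeta>" by (rule form_add_left[OF u(1) g \<zeta>(1)])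
      finally have "form v \<zeta> = form u \<zeta> + form g \<zeta>" .
      moreover have "form u \<zeta> \<ge> - 1 * (\<integral>x. \<zeta> x \<partial>lborel)"
        using \<zeta> \<rho>0 by (intro supersolutionD[OF super, of \<zeta> c]) auto
      moreover have "form g \<zeta> \<ge> - (2 * M * c_U * (\<rho>0 / 2) powr (- \<alpha>)) * (\<integral>x. \<zeta> x \<partial>lborel)"
        by (rule form_tail_lower[OF g g01 gAE \<zeta> \<rho>0])
      ultimately show ?thesis by (simp add: K_def algebra_simps)
    qed
    \<comment> \<open>The bound \<rho>0 / 4 keeps the ball of radius 2 \<rho> within radius \<rho>0
      / 2, where v satisfies its inequality; the second bound is K \<le> \<theta> D
      \<rho>^(-\<alpha>) solved for \<rho>.\<close>
    define \<rho>1 where "\<rho>1 = min (\<rho>0 / 4) ((\<theta> * D / K) powr (1 / \<alpha>))"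
    have \<rho>1: "\<rho>1 > 0" using \<rho>0 \<theta> D K by (simp add: \<rho>1_def)
    show "\<exists>\<rho>1>0. \<forall>\<rho>. 0 < \<rho> \<longrightarrow> \<rho> \<le> \<rho>1 \<longrightarrow> measure lborel (ball x0 \<rho>) / 2 \<le> measure lborel ({x. D / 2 \<le> u x} \<inter> ball x0 \<rho>) \<longrightarrow>
        (AE x in lborel. x \<in> ball x0 (\<rho> / 2) \<longrightarrow> 2 * \<theta> * D \<le> u x)"
    proof (intro exI[of _ \<rho>1] conjI \<rho>1 allI impI)
      fix \<rho> assume \<rho>: "0 < \<rho>" "\<rho> \<le> \<rho>1"
        and half: "measure lborel (ball x0 \<rho>) / 2 \<le> measure lborel ({x. D / 2 \<le> u x} \<inter> ball x0 \<rho>)"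
      have \<alpha>0: "\<alpha> > 0" using \<alpha> by linarith
      have K\<rho>: "K \<le> \<theta> * D * \<rho> powr (- \<alpha>)"
      proof -
        have "\<rho> powr \<alpha> \<le> ((\<theta> * D / K) powr (1 / \<alpha>)) powr \<alpha>"
          using \<rho> \<alpha>0 by (intro powr_mono2) (auto simp: \<rho>1_def)
        also have "\<dots> = \<theta> * D / K" using \<alpha>0 \<theta>D K by (simp add: powr_powr)
        finally show ?thesis using K \<rho>(1) by (simp add: powr_minus field_simps)
      qed
      have \<rho>4: "4 * \<rho> \<le> \<rho>0" using \<rho> by (simp add: \<rho>1_def)
      have v_bd: "\<forall>x. \<theta> * D \<le> v x \<and> v x \<le> M + 3 * \<theta> * D"
      proof
        fix x
        have "u x \<le> M" using u(2)[rule_format, of x] by simp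
        then show "\<theta> * D \<le> v x \<and> v x \<le> M + 3 * \<theta> * D"
          unfolding v_def mult.assoc using \<theta>D M by linarith
      qed
      let ?P = "{x. D / 2 \<le> v x} \<inter> ball x0 \<rho>" and ?Z = "{x. v x < 8 * \<theta> * D} \<inter> ball x0 \<rho>"
      have lg: "measure lborel ?P * measure lborel ?Z * (ln ((D / 2) / (8 * \<theta> * D)))\<^sup>2 \<le> C * (\<rho> ^ DIM('a))\<^sup>2"
      proof (rule log[rule_format, OF v \<theta>D v_bd[rule_format] \<rho>(1) less_imp_le[OF K] K\<rho>])
        show "0 < 8 * \<theta> * D" "8 * \<theta> * D < D / 2" using \<theta> D \<theta>16 by (auto simp: field_simps)
        show "supersolution K x0 (2 * \<rho>) v"
          unfolding supersolution_def using \<rho>4 by (intro allI impI superv) auto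
      qed
      have "(D / 2) / (8 * \<theta> * D) = exp \<Lambda>" using D by (simp add: \<theta>_def exp_minus field_simps)
      then have ln\<Lambda>: "ln ((D / 2) / (8 * \<theta> * D)) = \<Lambda>" by simp
      have [measurable]: "v \<in> borel_measurable borel" using v by measurable
      have "\<omega> * \<rho> ^ DIM('a) / 2 \<le> measure lborel ({x. D / 2 \<le> u x} \<inter> ball x0 \<rho>)"
        using half \<rho>(1) by (simp add: content_ball \<omega>_def)
      also have "\<dots> \<le> measure lborel ?P"
      proof (rule measure_mono_fmeasurable)
        have "D / 2 \<le> v x" if "D / 2 \<le> u x" for x
          unfolding v_def mult.assoc using that \<theta>D by linarith
        then show "{x. D / 2 \<le> u x} \<inter> ball x0 \<rho> \<subseteq> ?P" by blast
        show "{x. D / 2 \<le> u x} \<inter> ball x0 \<rho> \<in> sets lborel" by simp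
        have "?P \<in> sets lborel" by simp
        then show "?P \<in> fmeasurable lborel"
          using emeasure_mono[of ?P "ball x0 \<rho>" lborel] emeasure_lborel_ball_finite[of x0 \<rho>]
          by (auto simp: fmeasurable_def intro: le_less_trans)
      qed
      finally have P: "\<omega> * \<rho> ^ DIM('a) / 2 \<le> measure lborel ?P" .
      have "measure lborel ?Z \<le> eps0 * \<rho> ^ DIM('a)"
      proof -
        define r where "r = \<rho> ^ DIM('a)"
        have r: "r > 0" using \<rho> by (simp add: r_def)
        define z where "z = measure lborel ?Z"
        have z: "z \<ge> 0" by (simp add: z_def)
        have "(\<omega> * r / 2) * z * \<Lambda>\<^sup>2 \<le> measure lborel ?P * z * \<Lambda>\<^sup>2"
          using P z by (intro mult_right_mono) (auto simp: r_def)
        also have "\<dots> \<le> C * r\<^sup>2" using lg ln\<Lambda> by (simp add: z_def r_def)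
        finally have 1: "(\<omega> * r / 2) * z * \<Lambda>\<^sup>2 \<le> C * r\<^sup>2" .
        have "(\<omega> * r / 2) * z * (2 * C / (\<omega> * eps0)) \<le> (\<omega> * r / 2) * z * \<Lambda>\<^sup>2"
          using \<Lambda>2 \<omega> r z by (intro mult_left_mono) auto
        also note 1
        finally have "z * (C * r / eps0) \<le> (eps0 * r) * (C * r / eps0)"
          using \<omega> eps0 by (simp add: power2_eq_square field_simps)
        moreover have "C * r / eps0 > 0" using C r eps0 by simp
        ultimately have "z \<le> eps0 * r" by (rule mult_right_le_imp_le)
        then show ?thesis by (simp add: z_def r_def)
      qed
      then have "AE x in lborel. x \<in> ball x0 (\<rho> / 2) \<longrightarrow> 8 * \<theta> * D / 2 \<le> v x"
      proof (intro degiorgi_lower_bound[OF v _ _ \<rho>(1), of _ K])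
        show "0 \<le> v x" for x using v_bd \<theta>D by (meson less_imp_le order_trans)
        show "0 < 8 * \<theta> * D" using \<theta> D by simp
        show "0 \<le> K" using K by simp
        have "\<theta> * D * \<rho> powr (- \<alpha>) \<le> 8 * \<theta> * D * \<rho> powr (- \<alpha>)" using \<theta> D by (intro mult_right_mono) auto
        then show "K \<le> 8 * \<theta> * D * \<rho> powr (- \<alpha>)" using K\<rho> by linarith
        fix \<zeta> assume \<zeta>: "finite_energy \<zeta>" "\<And>x. 0 \<le> \<zeta> x" "\<And>x. \<zeta> x \<le> 8 * \<theta> * D" "\<And>x. x \<notin> ball x0 \<rho> \<or> 8 * \<theta> * D \<le> v x \<Longrightarrow> \<zeta> x = 0"
        show "form v \<zeta> \<ge> - K * (\<integral>x. \<zeta> x \<partial>lborel)"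
          using \<rho>4 \<rho>(1) by (intro superv[OF \<zeta>(1-3)] \<zeta>(4)) auto
      qed
      moreover have "2 * \<theta> * D \<le> u x" if "8 * \<theta> * D / 2 \<le> v x" for x
        using that \<theta>D unfolding v_def mult.assoc by linarith
      ultimately show "AE x in lborel. x \<in> ball x0 (\<rho> / 2) \<longrightarrow> 2 * \<theta> * D \<le> u x"
        by (auto elim!: eventually_mono)
    qed
  qed
qed

text \<open>m and N are limits over shrinking balls rather than bounds on one ball: D = N - m then
  stays fixed while the radius shrinks, which is the situation of \<open>growth\<close>, and the
  contradiction comes after a single step, without a rate of decay.\<close>

lemma vanishing_oscillation:
  assumes \<phi>: "finite_energy \<phi>" "\<And>x. \<bar>\<phi> x\<bar> \<le> M" and "\<rho>0 > 0"
    and super: "supersolution 1 x0 \<rho>0 \<phi>" and sub: "supersolution 1 x0 \<rho>0 (\<lambda>x. - \<phi> x)"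
    and "e > 0"
  shows "\<exists>\<rho>>0. \<exists>a. AE x in lborel. x \<in> ball x0 \<rho> \<longrightarrow> a \<le> \<phi> x \<and> \<phi> x \<le> a + e"
proof -
  have [measurable]: "\<phi> \<in> borel_measurable borel" using \<phi>(1) by measurable
  define Lo where "Lo = {a. \<exists>\<rho>>0. AE x in lborel. x \<in> ball x0 \<rho> \<longrightarrow> a \<le> \<phi> x}"
  define Up where "Up = {a. \<exists>\<rho>>0. AE x in lborel. x \<in> ball x0 \<rho> \<longrightarrow> \<phi> x \<le> a}"
  have bd: "- M \<le> \<phi> x" "\<phi> x \<le> M" for x using \<phi>(2)[of x] by auto
  have LoM: "- M \<in> Lo" and UpM: "M \<in> Up"
    using bd \<open>\<rho>0 > 0\<close> by (auto simp: Lo_def Up_def)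
  have LU: "a \<le> b" if asm: "a \<in> Lo" "b \<in> Up" for a b
  proof -
    obtain \<rho> \<rho>' where "\<rho> > 0" "\<rho>' > 0" and ae: "AE x in lborel. x \<in> ball x0 \<rho> \<longrightarrow> a \<le> \<phi> x" "AE x in lborel. x \<in> ball x0 \<rho>' \<longrightarrow> \<phi> x \<le> b"
      using asm unfolding Lo_def Up_def by blast
    have "AE x in lborel. x \<in> ball x0 (min \<rho> \<rho>') \<longrightarrow> a \<le> b" using ae by eventually_elim auto
    show ?thesis
    proof (rule ccontr)
      assume "\<not> a \<le> b"
      then have "AE x in lborel. x \<notin> ball x0 (min \<rho> \<rho>')" using \<open>AE x in lborel. x \<in> ball x0 (min \<rho> \<rho>') \<longrightarrow> a \<le> b\<close> by auto
      then show False using not_AE_notin_ball[of "min \<rho> \<rho>'" x0] \<open>\<rho> > 0\<close> \<open>\<rho>' > 0\<close> by simp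
    qed
  qed
  define m where "m = Sup Lo"
  define N where "N = Inf Up"
  have bddL: "bdd_above Lo" and bddU: "bdd_below Up" using LU LoM UpM by (auto intro!: bdd_aboveI[of _ M] bdd_belowI[of _ "-M"])
  have "N \<le> m"
  proof (rule ccontr)
    assume "\<not> N \<le> m"
    define D where "D = N - m"
    have D: "D > 0" using \<open>\<not> N \<le> m\<close> by (simp add: D_def)
    obtain \<theta> :: real where \<theta>: "\<theta> > 0" and gr: "\<forall>u x0 \<rho>0 D M. finite_energy u \<longrightarrow> (\<forall>x. \<bar>u x\<bar> \<le> M) \<longrightarrow> \<rho>0 > 0 \<longrightarrow> D > 0 \<longrightarrow> supersolution 1 x0 \<rho>0 u \<longrightarrow>
     (AE x in lborel. x \<in> ball x0 \<rho>0 \<longrightarrow> - \<theta> * D \<le> u x) \<longrightarrow>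
     (\<exists>\<rho>1>0. \<forall>\<rho>. 0 < \<rho> \<longrightarrow> \<rho> \<le> \<rho>1 \<longrightarrow> measure lborel (ball x0 \<rho>) / 2 \<le> measure lborel ({x. D / 2 \<le> u x} \<inter> ball x0 \<rho>) \<longrightarrow>
        (AE x in lborel. x \<in> ball x0 (\<rho> / 2) \<longrightarrow> 2 * \<theta> * D \<le> u x))"
      by (rule growth)
    have \<theta>D: "\<theta> * D > 0" using \<theta> D by simp
    have "\<exists>a\<in>Lo. m - \<theta> * D < a"
      using less_cSupD[of Lo "m - \<theta> * D"] LoM \<theta>D by (auto simp: m_def)
    then obtain a \<rho>a where a: "m - \<theta> * D < a" "\<rho>a > 0" "AE x in lborel. x \<in> ball x0 \<rho>a \<longrightarrow> a \<le> \<phi> x" unfolding Lo_def by blast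
    have "\<exists>b\<in>Up. b < N + \<theta> * D"
      using cInf_lessD[of Up "N + \<theta> * D"] UpM \<theta>D by (auto simp: N_def)
    then obtain b \<rho>b where b: "b < N + \<theta> * D" "\<rho>b > 0" "AE x in lborel. x \<in> ball x0 \<rho>b \<longrightarrow> \<phi> x \<le> b" unfolding Up_def by blast
    have "\<exists>\<rho>1>0. \<forall>\<rho>. 0 < \<rho> \<longrightarrow> \<rho> \<le> \<rho>1 \<longrightarrow> measure lborel (ball x0 \<rho>) / 2 \<le> measure lborel ({x. D / 2 \<le> \<phi> x - m} \<inter> ball x0 \<rho>) \<longrightarrow>
        (AE x in lborel. x \<in> ball x0 (\<rho> / 2) \<longrightarrow> 2 * \<theta> * D \<le> \<phi> x - m)"
    proof (rule gr[rule_format])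
      show "finite_energy (\<lambda>x. \<phi> x - m)" by (rule finite_energy_lipschitz[OF _ \<phi>(1), of _ 1]) auto
      show "\<bar>\<phi> x - m\<bar> \<le> M + \<bar>m\<bar>" for x using \<phi>(2)[of x] by linarith
      show "0 < min \<rho>0 \<rho>a" "0 < D" using a \<open>\<rho>0 > 0\<close> D by simp_all
      show "AE x in lborel. x \<in> ball x0 (min \<rho>0 \<rho>a) \<longrightarrow> - \<theta> * D \<le> \<phi> x - m"
        using a(3) by eventually_elim (use a(1) in auto)
      show "supersolution 1 x0 (min \<rho>0 \<rho>a) (\<lambda>x. \<phi> x - m)" by (rule supersolution_cong[OF super]) auto
    qed
    then obtain \<rho>1 where \<rho>1: "\<rho>1 > 0" "\<And>\<rho>. 0 < \<rho> \<Longrightarrow> \<rho> \<le> \<rho>1 \<Longrightarrow> measure lborel (ball x0 \<rho>) / 2 \<le> measure lborel ({x. D / 2 \<le> \<phi> x - m} \<inter> ball x0 \<rho>) \<Longrightarrow>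
        (AE x in lborel. x \<in> ball x0 (\<rho> / 2) \<longrightarrow> 2 * \<theta> * D \<le> \<phi> x - m)" by blast
    have "\<exists>\<rho>1>0. \<forall>\<rho>. 0 < \<rho> \<longrightarrow> \<rho> \<le> \<rho>1 \<longrightarrow> measure lborel (ball x0 \<rho>) / 2 \<le> measure lborel ({x. D / 2 \<le> N - \<phi> x} \<inter> ball x0 \<rho>) \<longrightarrow>
        (AE x in lborel. x \<in> ball x0 (\<rho> / 2) \<longrightarrow> 2 * \<theta> * D \<le> N - \<phi> x)"
    proof (rule gr[rule_format])
      show "finite_energy (\<lambda>x. N - \<phi> x)" by (rule finite_energy_lipschitz[OF _ \<phi>(1), of _ 1]) auto
      show "\<bar>N - \<phi> x\<bar> \<le> \<bar>N\<bar> + M" for x using \<phi>(2)[of x] by linarith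
      show "0 < min \<rho>0 \<rho>b" "0 < D" using b \<open>\<rho>0 > 0\<close> D by simp_all
      show "AE x in lborel. x \<in> ball x0 (min \<rho>0 \<rho>b) \<longrightarrow> - \<theta> * D \<le> N - \<phi> x"
        using b(3) by eventually_elim (use b(1) in auto)
      show "supersolution 1 x0 (min \<rho>0 \<rho>b) (\<lambda>x. N - \<phi> x)" by (rule supersolution_cong[OF sub]) auto
    qed
    then obtain \<rho>2 where \<rho>2: "\<rho>2 > 0" "\<And>\<rho>. 0 < \<rho> \<Longrightarrow> \<rho> \<le> \<rho>2 \<Longrightarrow> measure lborel (ball x0 \<rho>) / 2 \<le> measure lborel ({x. D / 2 \<le> N - \<phi> x} \<inter> ball x0 \<rho>) \<Longrightarrow>
        (AE x in lborel. x \<in> ball x0 (\<rho> / 2) \<longrightarrow> 2 * \<theta> * D \<le> N - \<phi> x)" by blast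
    define \<rho> where "\<rho> = min \<rho>1 \<rho>2"
    have \<rho>: "0 < \<rho>" "\<rho> \<le> \<rho>1" "\<rho> \<le> \<rho>2" using \<rho>1(1) \<rho>2(1) by (auto simp: \<rho>_def)
    let ?P = "{x. D / 2 \<le> \<phi> x - m} \<inter> ball x0 \<rho>" and ?Q = "{x. D / 2 \<le> N - \<phi> x} \<inter> ball x0 \<rho>"
    have sets: "?P \<in> sets lborel" "?Q \<in> sets lborel" by simp_all
    \<comment> \<open>\<phi> - m and N - \<phi> add up to D, so at each point one of them is at
      least D/2.\<close>
    have "measure lborel (ball x0 \<rho>) \<le> measure lborel (?P \<union> ?Q)"
    proof (rule measure_mono_fmeasurable)
      show "ball x0 \<rho> \<subseteq> ?P \<union> ?Q" by (auto simp: D_def field_simps)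
      show "?P \<union> ?Q \<in> fmeasurable lborel"
        using sets emeasure_mono[of "?P \<union> ?Q" "ball x0 \<rho>" lborel] emeasure_lborel_ball_finite[of x0 \<rho>]
        by (auto simp: fmeasurable_def intro: le_less_trans)
    qed simp
    also have "\<dots> \<le> measure lborel ?P + measure lborel ?Q" by (rule measure_Un_le[OF sets])
    finally consider "measure lborel (ball x0 \<rho>) / 2 \<le> measure lborel ?P" | "measure lborel (ball x0 \<rho>) / 2 \<le> measure lborel ?Q" by linarith
    then show False
    proof cases
      case 1
      from \<rho>1(2)[OF \<rho>(1,2) this] have "AE x in lborel. x \<in> ball x0 (\<rho> / 2) \<longrightarrow> m + 2 * \<theta> * D \<le> \<phi> x"
        by eventually_elim auto
      then have "m + 2 * \<theta> * D \<in> Lo" using \<rho>(1) by (auto simp: Lo_def intro!: exI[of _ "\<rho> / 2"])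
      then have "m + 2 * \<theta> * D \<le> m" unfolding m_def using bddL by (intro cSup_upper) auto
      then show False using \<theta>D by (simp add: mult.commute)
    next
      case 2
      from \<rho>2(2)[OF \<rho>(1,3) this] have "AE x in lborel. x \<in> ball x0 (\<rho> / 2) \<longrightarrow> \<phi> x \<le> N - 2 * \<theta> * D"
        by eventually_elim auto
      then have "N - 2 * \<theta> * D \<in> Up" using \<rho>(1) by (auto simp: Up_def intro!: exI[of _ "\<rho> / 2"])
      then have "N \<le> N - 2 * \<theta> * D" unfolding N_def using bddU by (intro cInf_lower) auto
      then show False using \<theta>D by (simp add: mult.commute)
    qed
  qed
  have "\<exists>a\<in>Lo. m - e / 2 < a"
    using less_cSupD[of Lo "m - e / 2"] LoM \<open>e > 0\<close> by (auto simp: m_def)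
  then obtain a \<rho>a where a: "m - e / 2 < a" "\<rho>a > 0" "AE x in lborel. x \<in> ball x0 \<rho>a \<longrightarrow> a \<le> \<phi> x" unfolding Lo_def by blast
  have "\<exists>b\<in>Up. b < N + e / 2"
    using cInf_lessD[of Up "N + e / 2"] UpM \<open>e > 0\<close> by (auto simp: N_def)
  then obtain b \<rho>b where b: "b < N + e / 2" "\<rho>b > 0" "AE x in lborel. x \<in> ball x0 \<rho>b \<longrightarrow> \<phi> x \<le> b" unfolding Up_def by blast
  have "AE x in lborel. x \<in> ball x0 (min \<rho>a \<rho>b) \<longrightarrow> a \<le> \<phi> x \<and> \<phi> x \<le> a + e"
    using a(3) b(3) by eventually_elim (use a(1) b(1) \<open>N \<le> m\<close> in auto)
  then show ?thesis using a(2) b(2) by (intro exI[of _ "min \<rho>a \<rho>b"]) auto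
qed

end

text \<open>The representative is the essential lower limit, defined at every point; it therefore
  inherits essential lower bounds near a point, which is how the De Giorgi bound becomes a bound at
  y itself.\<close>

lemma continuous_representative:
  fixes \<phi> :: "'a::euclidean_space \<Rightarrow> real"
  assumes "open \<Omega>"
    and osc: "\<And>x0 e. x0 \<in> \<Omega> \<Longrightarrow> e > 0 \<Longrightarrow> \<exists>\<rho>>0. \<exists>a. AE x in lborel. x \<in> ball x0 \<rho> \<longrightarrow> a \<le> \<phi> x \<and> \<phi> x \<le> a + e"
  shows "\<exists>g. continuous_on \<Omega> g \<and> (AE x in lborel. x \<in> \<Omega> \<longrightarrow> g x = \<phi> x) \<and>
     (\<forall>y\<in>\<Omega>. \<forall>c r. r > 0 \<longrightarrow> (AE x in lborel. x \<in> ball y r \<longrightarrow> c \<le> \<phi> x) \<longrightarrow> c \<le> g y)"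
proof -
  define Lo where "Lo x = {a. \<exists>\<rho>>0. AE z in lborel. z \<in> ball x \<rho> \<longrightarrow> a \<le> \<phi> z}" for x
  define g where "g x = Sup (Lo x)" for x
  have up: "a' \<le> b" if asm: "a' \<in> Lo x" "\<rho> > 0" "AE z in lborel. z \<in> ball x \<rho> \<longrightarrow> \<phi> z \<le> b" for a' b x \<rho>
  proof -
    obtain \<rho>' where "\<rho>' > 0" and ae: "AE z in lborel. z \<in> ball x \<rho>' \<longrightarrow> a' \<le> \<phi> z" using asm(1) unfolding Lo_def by blast
    have *: "AE z in lborel. z \<in> ball x (min \<rho> \<rho>') \<longrightarrow> a' \<le> b" using ae asm(3) by eventually_elim auto
    show ?thesis
    proof (rule ccontr)
      assume "\<not> a' \<le> b"
      then have "AE z in lborel. z \<notin> ball x (min \<rho> \<rho>')" using * by auto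
      then show False using not_AE_notin_ball[of "min \<rho> \<rho>'" x] \<open>\<rho> > 0\<close> \<open>\<rho>' > 0\<close> by simp
    qed
  qed
  have g_bounds: "a \<le> g x \<and> g x \<le> a + e" and bdd: "bdd_above (Lo x)"
    if "x \<in> ball x0 \<rho>" "AE z in lborel. z \<in> ball x0 \<rho> \<longrightarrow> a \<le> \<phi> z \<and> \<phi> z \<le> a + e" for x x0 \<rho> a e
  proof -
    define \<rho>' where "\<rho>' = \<rho> - dist x0 x"
    have \<rho>': "\<rho>' > 0" using that(1) by (simp add: \<rho>'_def)
    have sub: "ball x \<rho>' \<subseteq> ball x0 \<rho>"
    proof
      fix z assume "z \<in> ball x \<rho>'"
      then show "z \<in> ball x0 \<rho>" using dist_triangle[of x0 z x] by (auto simp: \<rho>'_def)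
    qed
    have ae1: "AE z in lborel. z \<in> ball x \<rho>' \<longrightarrow> a \<le> \<phi> z" and ae2: "AE z in lborel. z \<in> ball x \<rho>' \<longrightarrow> \<phi> z \<le> a + e"
      using that(2) sub by (auto elim!: eventually_mono)
    have aL: "a \<in> Lo x" using ae1 \<rho>' by (auto simp: Lo_def)
    have le: "a' \<le> a + e" if "a' \<in> Lo x" for a' using up[OF that \<rho>' ae2] .
    show bdd: "bdd_above (Lo x)" by (rule bdd_aboveI[OF le])
    show "a \<le> g x \<and> g x \<le> a + e"
      unfolding g_def using aL le bdd by (auto intro!: cSup_upper cSup_least)
  qed
  have "continuous_on \<Omega> g"
  proof (rule continuous_at_imp_continuous_on, rule ballI)
    fix x0 assume x0: "x0 \<in> \<Omega>"
    show "isCont g x0"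
      unfolding continuous_at_eps_delta
    proof (intro allI impI)
      fix e :: real assume "e > 0"
      then obtain \<rho> a where \<rho>: "\<rho> > 0" "AE z in lborel. z \<in> ball x0 \<rho> \<longrightarrow> a \<le> \<phi> z \<and> \<phi> z \<le> a + e / 2"
        using osc[OF x0, of "e / 2"] by auto
      show "\<exists>d>0. \<forall>x'. dist x' x0 < d \<longrightarrow> dist (g x') (g x0) < e"
      proof (intro exI[of _ \<rho>] conjI \<rho>(1) allI impI)
        fix x' assume "dist x' x0 < \<rho>"
        then have "x' \<in> ball x0 \<rho>" "x0 \<in> ball x0 \<rho>" using \<rho>(1) by (auto simp: dist_commute)
        from g_bounds[OF this(1) \<rho>(2)] g_bounds[OF this(2) \<rho>(2)] show "dist (g x') (g x0) < e"
          using \<open>e > 0\<close> by (auto simp: dist_real_def)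
      qed
    qed
  qed
  moreover have "AE x in lborel. x \<in> \<Omega> \<longrightarrow> g x = \<phi> x"
  proof -
    have "AE x in lborel. x \<in> \<Omega> \<longrightarrow> \<bar>g x - \<phi> x\<bar> \<le> inverse (real (Suc n))" for n
    proof -
      define F where "F = {ball x0 \<rho> |x0 \<rho>. \<rho> > 0 \<and> (\<exists>a. AE z in lborel. z \<in> ball x0 \<rho> \<longrightarrow> a \<le> \<phi> z \<and> \<phi> z \<le> a + inverse (real (Suc n)))}"
      have "\<And>S. S \<in> F \<Longrightarrow> open S" by (auto simp: F_def)
      \<comment> \<open>Lindelof leaves countably many balls, so their exceptional null sets can be
        united.\<close>
      then obtain F' where F': "F' \<subseteq> F" "countable F'" "\<Union>F' = \<Union>F" using Lindelof by metis
      have cov: "\<Omega> \<subseteq> \<Union>F"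
      proof
        fix x assume "x \<in> \<Omega>"
        then obtain \<rho> a where "\<rho> > 0" "AE z in lborel. z \<in> ball x \<rho> \<longrightarrow> a \<le> \<phi> z \<and> \<phi> z \<le> a + inverse (real (Suc n))"
          using osc[of x "inverse (real (Suc n))"] by auto
        then show "x \<in> \<Union>F" unfolding F_def by (intro UnionI[of "ball x \<rho>"]) auto
      qed
      have "AE x in lborel. \<forall>S\<in>F'. x \<in> S \<longrightarrow> \<bar>g x - \<phi> x\<bar> \<le> inverse (real (Suc n))"
      proof (subst AE_ball_countable[OF F'(2)], rule ballI)
        fix S assume "S \<in> F'"
        then obtain x0 \<rho> a where S: "S = ball x0 \<rho>" and ae: "AE z in lborel. z \<in> ball x0 \<rho> \<longrightarrow> a \<le> \<phi> z \<and> \<phi> z \<le> a + inverse (real (Suc n))"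
          using F'(1) by (auto simp: F_def)
        show "AE x in lborel. x \<in> S \<longrightarrow> \<bar>g x - \<phi> x\<bar> \<le> inverse (real (Suc n))"
          using ae
        proof eventually_elim
          case (elim x)
          then show ?case using g_bounds[of x x0 \<rho>, OF _ ae] unfolding S by (auto simp: abs_le_iff)
        qed
      qed
      then show ?thesis by eventually_elim (use cov F'(3) in blast)
    qed
    then have "AE x in lborel. \<forall>n. x \<in> \<Omega> \<longrightarrow> \<bar>g x - \<phi> x\<bar> \<le> inverse (real (Suc n))"
      unfolding AE_all_countable by (rule allI)
    then show ?thesis
    proof eventually_elim
      case (elim x)
      show ?case
      proof (intro impI, rule ccontr)
        assume "x \<in> \<Omega>" "g x \<noteq> \<phi> x"
        then obtain n where "inverse (real (Suc n)) < \<bar>g x - \<phi> x\<bar>" using reals_Archimedean[of "\<bar>g x - \<phi> x\<bar>"] by auto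
        then show False using elim \<open>x \<in> \<Omega>\<close> by (auto simp: not_le[symmetric])
      qed
    qed
  qed
  moreover have "c \<le> g y" if y: "y \<in> \<Omega>" and "r > 0" and "AE x in lborel. x \<in> ball y r \<longrightarrow> c \<le> \<phi> x" for y c r
  proof -
    have "c \<in> Lo y" using that by (auto simp: Lo_def)
    moreover obtain \<rho> a where \<rho>: "\<rho> > 0" "AE z in lborel. z \<in> ball y \<rho> \<longrightarrow> a \<le> \<phi> z \<and> \<phi> z \<le> a + 1"
      using osc[OF y, of 1] by auto
    moreover have "bdd_above (Lo y)" by (rule bdd[OF _ \<rho>(2)]) (use \<rho>(1) in simp)
    ultimately show ?thesis unfolding g_def by (intro cSup_upper)
  qed
  ultimately show ?thesis by (intro exI[of _ g]) auto
qed

section \<open>A continuous test function with a pointwise lower bound\<close>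

context elliptic_kernel begin

lemma bounded_support_in_H0:
  assumes "finite_energy \<zeta>" "\<And>x. 0 \<le> \<zeta> x" "\<And>x. \<zeta> x \<le> c" "\<And>x. x \<notin> ball x0 \<rho> \<Longrightarrow> \<zeta> x = 0" "ball x0 \<rho> \<subseteq> \<Omega>"
  shows "\<zeta> \<in> H0 \<Omega>"
proof -
  have [measurable]: "\<zeta> \<in> borel_measurable borel" using assms(1) by measurable
  have "integrable lborel (\<lambda>x. (\<zeta> x)\<^sup>2)"
  proof (rule integrable_bounded_support[where c = "c\<^sup>2" and S = "ball x0 \<rho>"])
    show "\<bar>(\<zeta> x)\<^sup>2\<bar> \<le> c\<^sup>2" for x using assms(2,3)[of x] by (simp add: power_mono)
  qed (use assms(4) emeasure_lborel_ball_finite[of x0 \<rho>] in auto)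
  moreover have "\<zeta> x = 0" if "x \<notin> \<Omega>" for x
    using assms(4)[of x] assms(5) that by blast
  ultimately show ?thesis using assms(1) by (simp add: H0_def)
qed

text \<open>The test function solves the equation for the operator plus a zero-order term \<^term>\<open>q\<close>: the
  latter makes it trivially bounded by \<^term>\<open>1 / q\<close>, and it only lowers the right-hand side.\<close>
lemma continuous_test_function:
  fixes \<Omega> :: "'a set" and y :: 'a and r :: real
  defines "e0 \<equiv> degiorgi_eps (256 * C_F * (2 * c_U + 1)) (\<alpha>0 / real DIM('a))"
    and "\<omega> \<equiv> unit_ball_vol (real DIM('a))"
  defines "\<kappa> \<equiv> e0 * (1/2) ^ DIM('a) / (4 * (8 * c_U + 1) * \<omega>)"
    and "\<epsilon> \<equiv> min (1/2) (e0 * (1/2) ^ DIM('a) / (2 * \<omega>))" and "q \<equiv> r powr (- \<alpha>)"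
  defines "A \<equiv> ball y r - ball y (\<epsilon> * r)"
  assumes "open \<Omega>" "y \<in> \<Omega>" "r > 0" "ball y r \<subseteq> \<Omega>"
  shows "\<exists>\<phi> g. \<phi> \<in> H0 \<Omega> \<and> (\<forall>x. 0 \<le> \<phi> x \<and> q * \<phi> x \<le> 1) \<and>
     (\<forall>v\<in>H0 \<Omega>. form \<phi> v = (\<integral>x. (indicator A x - q * \<phi> x) * v x \<partial>lborel)) \<and>
     continuous_on \<Omega> g \<and> (AE x in lborel. x \<in> \<Omega> \<longrightarrow> g x = \<phi> x) \<and> \<kappa> * r powr \<alpha> / 2 \<le> g y"
proof -
  let ?d = "real DIM('a)"
  have e0: "e0 > 0" using C_F_pos c_U_nonneg by (simp add: e0_def degiorgi_eps_pos)
  have e0_eq: "eps0 = e0" by (simp add: eps0_def e0_def)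
  have \<omega>: "\<omega> > 0" by (simp add: \<omega>_def)
  \<comment> \<open>The set where \<phi> is small in the ball of radius r/2 is split by the ball of
    radius \<epsilon> r; \<kappa> and \<epsilon> are such that each piece gets half of the measure
    \<open>e0 * (r/2) ^ DIM('a)\<close> allowed by De Giorgi's lemma.\<close>
  have \<kappa>: "\<kappa> > 0" using e0 \<omega> c_U_nonneg by (simp add: \<kappa>_def add_nonneg_pos)
  have \<epsilon>: "\<epsilon> > 0" "\<epsilon> \<le> 1/2" "\<epsilon> \<le> e0 * (1/2) ^ DIM('a) / (2 * \<omega>)" using e0 \<omega> by (auto simp: \<epsilon>_def)
  have q: "q > 0" using \<open>r > 0\<close> by (simp add: q_def)
  have [measurable]: "\<Omega> \<in> sets borel" "A \<in> sets borel" using \<open>open \<Omega>\<close> by (auto simp: A_def)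
  have A_fin: "emeasure lborel A < \<infinity>"
    using emeasure_mono[of A "ball y r" lborel] emeasure_lborel_ball_finite[of y r]
    by (auto simp: A_def intro: le_less_trans)
  interpret resolvent k \<Omega> A q
    by unfold_locales (use A_fin q in auto)
  obtain \<phi> where \<phi>: "\<phi> \<in> H0 \<Omega>" "\<And>x. 0 \<le> \<phi> x" "\<And>x. \<phi> x \<le> 1 / q" and sol: "\<And>v. v \<in> H0 \<Omega> \<Longrightarrow> b \<phi> v = L v"
    using solution_exists by blast
  have finite_energy\<phi>: "finite_energy \<phi>" by (rule H0D(1)[OF \<phi>(1)])
  have [measurable]: "\<phi> \<in> borel_measurable borel" using finite_energy\<phi> by measurable
  have q\<phi>: "0 \<le> q * \<phi> x" "q * \<phi> x \<le> 1" for x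
    using \<phi>(2)[of x] mult_left_mono[OF \<phi>(3)[of x], of q] q by auto
  have eq: "form \<phi> v = (\<integral>x. (indicator A x - q * \<phi> x) * v x \<partial>lborel)" if v: "v \<in> H0 \<Omega>" for v
  proof -
    have "(\<integral>x. (indicator A x - q * \<phi> x) * v x \<partial>lborel) = (\<integral>x. indicator A x * v x - q * (\<phi> x * v x) \<partial>lborel)"
      by (simp add: left_diff_distrib mult.assoc)
    also have "\<dots> = L v - q * (\<integral>x. \<phi> x * v x \<partial>lborel)"
      using integrable_L[OF v] integrable_H0_mult[OF \<phi>(1) v] by (simp add: L_def)
    finally show ?thesis using sol[OF v] by (simp add: b_def)
  qed
  have int_\<zeta>: "integrable lborel \<zeta>"
    if "finite_energy \<zeta>" "\<And>x. 0 \<le> \<zeta> x" "\<And>x. \<zeta> x \<le> c" "\<And>x. x \<notin> ball x0 \<rho> \<Longrightarrow> \<zeta> x = 0" for \<zeta> c x0 \<rho>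
  proof (rule integrable_bounded_support[where c = c and S = "ball x0 \<rho>"])
    show "\<zeta> \<in> borel_measurable borel" using that(1) by measurable
    show "\<bar>\<zeta> x\<bar> \<le> c" for x using that(2,3)[of x] by simp
  qed (use that(4) emeasure_lborel_ball_finite[of x0 \<rho>] in auto)
  have int_mult: "integrable lborel (\<lambda>x. f x * \<zeta> x)"
    if "integrable lborel \<zeta>" "f \<in> borel_measurable borel" "\<And>x. \<bar>f x\<bar> \<le> 1" for f \<zeta> :: "'a \<Rightarrow> real"
  proof (rule Bochner_Integration.integrable_bound[OF that(1)])
    show "(\<lambda>x. f x * \<zeta> x) \<in> borel_measurable lborel" using that by measurable
    show "AE x in lborel. norm (f x * \<zeta> x) \<le> norm (\<zeta> x)"
      using that(3) by (intro AE_I2) (simp add: abs_mult mult_left_le_one_le)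
  qed
  \<comment> \<open>The right-hand side takes values in [-1, 1], so \<phi> and -\<phi> are both
    supersolutions with K = 1.\<close>
  have osc: "\<exists>\<rho>>0. \<exists>a. AE x in lborel. x \<in> ball x0 \<rho> \<longrightarrow> a \<le> \<phi> x \<and> \<phi> x \<le> a + e" if "x0 \<in> \<Omega>" "e > 0" for x0 e
  proof -
    obtain \<rho>0 where \<rho>0: "\<rho>0 > 0" "ball x0 \<rho>0 \<subseteq> \<Omega>" using \<open>open \<Omega>\<close> \<open>x0 \<in> \<Omega>\<close> openE by blast
    have bd: "\<bar>form \<phi> \<zeta>\<bar> \<le> (\<integral>x. \<zeta> x \<partial>lborel)"
      if \<zeta>: "finite_energy \<zeta>" "\<And>x. 0 \<le> \<zeta> x" "\<And>x. \<zeta> x \<le> c" "\<And>x. x \<notin> ball x0 \<rho>0 \<Longrightarrow> \<zeta> x = 0" for \<zeta> c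
    proof -
      have i: "integrable lborel \<zeta>" by (rule int_\<zeta>[OF \<zeta>])
      have "form \<phi> \<zeta> = (\<integral>x. (indicator A x - q * \<phi> x) * \<zeta> x \<partial>lborel)"
        by (rule eq[OF bounded_support_in_H0[OF \<zeta> \<rho>0(2)]])
      then have "\<bar>form \<phi> \<zeta>\<bar> = \<bar>\<integral>x. (indicator A x - q * \<phi> x) * \<zeta> x \<partial>lborel\<bar>" by (rule arg_cong)
      also have "\<dots> \<le> (\<integral>x. \<bar>(indicator A x - q * \<phi> x) * \<zeta> x\<bar> \<partial>lborel)" by (rule integral_abs_bound)
      also have "\<dots> \<le> (\<integral>x. \<zeta> x \<partial>lborel)"
      proof (rule integral_mono'[OF i])
        fix x
        have "\<bar>indicator A x - q * \<phi> x\<bar> \<le> 1" using q\<phi>[of x] by (auto simp: indicator_def)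
        then show "\<bar>(indicator A x - q * \<phi> x) * \<zeta> x\<bar> \<le> \<zeta> x"
          using \<zeta>(2)[of x] by (simp add: abs_mult mult_left_le_one_le)
      qed (rule \<zeta>(2))
      finally show ?thesis .
    qed
    show ?thesis
    proof (rule vanishing_oscillation[OF finite_energy\<phi> _ \<rho>0(1) _ _ \<open>e > 0\<close>])
      show "\<bar>\<phi> x\<bar> \<le> 1 / q" for x using \<phi>(2,3)[of x] by simp
      have "- 1 * (\<integral>x. \<zeta> x \<partial>lborel) \<le> form \<phi> \<zeta> \<and> - 1 * (\<integral>x. \<zeta> x \<partial>lborel) \<le> form (\<lambda>x. - \<phi> x) \<zeta>"
        if "finite_energy \<zeta>" "\<forall>x. 0 \<le> \<zeta> x \<and> \<zeta> x \<le> c" "\<forall>x. x \<notin> ball x0 \<rho>0 \<longrightarrow> \<zeta> x = 0" for \<zeta> c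
        using bd[of \<zeta> c] that form_cmult_left[of "-1" \<phi> \<zeta>] by (simp add: abs_le_iff)
      then show "supersolution 1 x0 \<rho>0 \<phi>" "supersolution 1 x0 \<rho>0 (\<lambda>x. - \<phi> x)"
        unfolding supersolution_def by blast+
    qed
  qed
  obtain g where g: "continuous_on \<Omega> g" "AE x in lborel. x \<in> \<Omega> \<longrightarrow> g x = \<phi> x"
     "\<forall>y\<in>\<Omega>. \<forall>c r. r > 0 \<longrightarrow> (AE x in lborel. x \<in> ball y r \<longrightarrow> c \<le> \<phi> x) \<longrightarrow> c \<le> g y"
    using continuous_representative[OF \<open>open \<Omega>\<close> osc] by blast
  define l where "l = \<kappa> * r powr \<alpha>"
  have l: "l > 0" using \<kappa> \<open>r > 0\<close> by (simp add: l_def)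
  have ql: "q * l = \<kappa>" using \<open>r > 0\<close> by (simp add: q_def l_def powr_minus)
  let ?Z = "{x. \<phi> x < l} \<inter> ball y (r/2)"
  have Z_small: "measure lborel ?Z \<le> e0 * (r/2) ^ DIM('a)"
  proof -
    define V where "V = \<omega> * r ^ DIM('a)"
    have V: "emeasure lborel (ball y r) = ennreal V" "measure lborel (ball y r) = V" "V \<ge> 0"
      using \<open>r > 0\<close> \<omega> by (auto simp: V_def \<omega>_def emeasure_ball content_ball)
    define \<eta> where "\<eta> = cutoff y r (r/2)"
    have h: "r/2 > 0" using \<open>r > 0\<close> by simp
    have \<eta>: "finite_energy \<eta>" "\<And>x. 0 \<le> \<eta> x" "\<And>x. \<eta> x \<le> 1" "\<And>x. x \<notin> ball y r \<Longrightarrow> \<eta> x = 0" "\<And>x. x \<in> ball y (r/2) \<Longrightarrow> \<eta> x = 1"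
      using finite_energy_cutoff[OF h] cutoff_bounds cutoff_eq_0[OF h] cutoff_eq_1[OF h, of _ y r] by (auto simp: \<eta>_def)
    have \<eta>_abs: "\<bar>\<eta> x\<bar> \<le> 1" for x using \<eta>(2,3)[of x] by simp
    \<comment> \<open>Adding the level l makes Picone applicable and gives v < 2 l wherever \<phi> <
      l.\<close>
    define v where "v x = \<phi> x + l" for x
    have v: "finite_energy v" by (rule finite_energy_lipschitz[OF _ finite_energy\<phi>, of _ 1]) (auto simp: v_def[abs_def])
    have sv: "l \<le> v x" for x using \<phi>(2)[of x] by (simp add: v_def)
    have vpos: "v x > 0" for x using sv[of x] l by linarith
    define \<zeta> where "\<zeta> = (\<lambda>x. (\<eta> x)\<^sup>2 / v x)"
    define Q where "Q = (\<lambda>p. (\<eta> (snd p) * v (fst p) - \<eta> (fst p) * v (snd p))\<^sup>2 / (v (fst p) * v (snd p)))"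
    note P = picone[OF v l sv \<eta>(1) \<eta>_abs, folded \<zeta>_def Q_def]
    have \<zeta>: "0 \<le> \<zeta> x" "\<zeta> x \<le> 1 / v x" "\<zeta> x \<le> 1 / l" "x \<notin> ball y r \<Longrightarrow> \<zeta> x = 0" for x
    proof -
      show "0 \<le> \<zeta> x" using vpos[of x] by (simp add: \<zeta>_def)
      have "(\<eta> x)\<^sup>2 \<le> 1" using \<eta>(2,3)[of x] by (simp add: power_le_one)
      then show *: "\<zeta> x \<le> 1 / v x" unfolding \<zeta>_def using vpos[of x] by (intro divide_right_mono) auto
      also have "1 / v x \<le> 1 / l" using l sv[of x] by (intro frac_le) auto
      finally show "\<zeta> x \<le> 1 / l" .
      show "x \<notin> ball y r \<Longrightarrow> \<zeta> x = 0" using \<eta>(4)[of x] by (simp add: \<zeta>_def)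
    qed
    have i\<zeta>: "integrable lborel \<zeta>" by (rule int_\<zeta>[OF P(1) \<zeta>(1,3,4)])
    have [measurable]: "\<zeta> \<in> borel_measurable borel" using P(1) by measurable
    have iA: "integrable lborel (\<lambda>x. indicator A x * \<zeta> x)" by (rule int_mult[OF i\<zeta>]) (auto simp: indicator_def)
    have iq: "integrable lborel (\<lambda>x. (q * \<phi> x) * \<zeta> x)" by (rule int_mult[OF i\<zeta>]) (use q\<phi> in auto)
    have "form v \<zeta> = form \<phi> \<zeta>" by (rule form_cong_incr) (auto simp: v_def)
    also have "\<dots> = (\<integral>x. (indicator A x - q * \<phi> x) * \<zeta> x \<partial>lborel)"
      by (rule eq[OF bounded_support_in_H0[OF P(1) \<zeta>(1,3,4) \<open>ball y r \<subseteq> \<Omega>\<close>]])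
    also have "\<dots> = (\<integral>x. indicator A x * \<zeta> x \<partial>lborel) - (\<integral>x. (q * \<phi> x) * \<zeta> x \<partial>lborel)"
      unfolding left_diff_distrib by (rule Bochner_Integration.integral_diff[OF iA iq])
    finally have form_v: "form v \<zeta> = (\<integral>x. indicator A x * \<zeta> x \<partial>lborel) - (\<integral>x. (q * \<phi> x) * \<zeta> x \<partial>lborel)" .
    \<comment> \<open>Since \<phi> \<zeta> \<le> \<phi> / v \<le> 1, the zero-order term costs at
      most q times the volume of the ball, which is the scale of the cutoff energy.\<close>
    have "(\<integral>x. (q * \<phi> x) * \<zeta> x \<partial>lborel) \<le> q * measure lborel (ball y r)"
    proof (rule integral_le_bounded_support)
      fix x
      have "\<phi> x * \<zeta> x \<le> \<phi> x * (1 / v x)" by (rule mult_left_mono[OF \<zeta>(2) \<phi>(2)])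
      also have "\<dots> \<le> 1" using vpos[of x] l by (simp add: v_def)
      finally show "(q * \<phi> x) * \<zeta> x \<le> q" using q by (simp add: mult.assoc mult_left_le)
    qed (use \<zeta>(4) q emeasure_lborel_ball_finite[of y r] in auto)
    moreover have "form \<eta> \<eta> \<le> 8 * c_U * q * V"
    proof -
      have "ennreal (form \<eta> \<eta>) \<le> ennreal (2 * c_U * (r/2) powr (- \<alpha>)) * ennreal V"
        using energy_cutoff[OF h, of y r] energy_eq_form[OF \<eta>(1)] by (simp add: \<eta>_def V)
      also have "\<dots> = ennreal (2 * c_U * (r/2) powr (- \<alpha>) * V)" using V c_U_nonneg by (simp add: ennreal_mult)
      finally have "form \<eta> \<eta> \<le> 2 * c_U * (r/2) powr (- \<alpha>) * V" using V c_U_nonneg by (subst (asm) ennreal_le_iff) auto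
      also have "\<dots> \<le> 2 * c_U * (q * 4) * V"
      proof -
        have "(r/2) powr (- \<alpha>) = q * 2 powr \<alpha>" using \<open>r > 0\<close> by (simp add: q_def powr_divide powr_minus field_simps)
        also have "2 powr \<alpha> \<le> (2::real) powr 2" using \<alpha> by (intro powr_mono) auto
        finally have "(r/2) powr (- \<alpha>) \<le> q * 4" using q by simp
        then show ?thesis using c_U_nonneg V by (intro mult_right_mono mult_left_mono) auto
      qed
      finally show ?thesis by (simp add: mult_ac)
    qed
    moreover have "(\<integral>p. Q p \<partial>jump) \<ge> 0"
      using vpos by (intro Bochner_Integration.integral_nonneg) (simp add: Q_def less_imp_le)
    ultimately have IA: "(\<integral>x. indicator A x * \<zeta> x \<partial>lborel) \<le> (8 * c_U + 1) * q * V"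
      using P(3) form_v V by (simp add: algebra_simps)
    let ?Z' = "?Z - ball y (\<epsilon> * r)"
    have Zs: "?Z \<in> sets lborel" by simp
    have Zfin: "emeasure lborel ?Z < \<infinity>"
      using emeasure_mono[of ?Z "ball y (r/2)" lborel] emeasure_lborel_ball_finite[of y "r/2"]
      by (auto intro: le_less_trans)
    have Z'finite_energy: "emeasure lborel ?Z' < \<infinity>"
      using emeasure_mono[of ?Z' ?Z lborel] Zs Zfin by (auto intro: le_less_trans)
    have "measure lborel ?Z' / (2 * l) = (\<integral>x. 1 / (2 * l) * indicator ?Z' x \<partial>lborel)"
      using Z'finite_energy Zs by simp
    \<comment> \<open>On this set \<eta> = 1 and v < 2 l, so \<zeta> \<ge> 1 / (2 l).\<close>
    also have "\<dots> \<le> (\<integral>x. indicator A x * \<zeta> x \<partial>lborel)"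
    proof (rule integral_mono[OF _ iA])
      show "integrable lborel (\<lambda>x. 1 / (2 * l) * indicator ?Z' x :: real)" using Z'finite_energy Zs by simp
      fix x
      show "1 / (2 * l) * indicator ?Z' x \<le> indicator A x * \<zeta> x"
      proof (cases "x \<in> ?Z'")
        case True
        then have "x \<in> A" "\<eta> x = 1" using \<eta>(5)[of x] \<open>r > 0\<close> by (auto simp: A_def)
        moreover have "1 / (2 * l) \<le> 1 / v x" using True vpos[of x] by (intro frac_le) (auto simp: v_def)
        ultimately show ?thesis using True by (simp add: \<zeta>_def)
      qed (use \<zeta>(1)[of x] in auto)
    qed
    also note IA
    finally have "measure lborel ?Z' / (2 * l) * (2 * l) \<le> (8 * c_U + 1) * q * V * (2 * l)"
      using l by (intro mult_right_mono) auto
    then have "measure lborel ?Z' \<le> 2 * (8 * c_U + 1) * V * (q * l)" using l by (simp add: mult_ac)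
    also have "\<dots> = e0 * (r/2) ^ DIM('a) / 2"
    proof -
      define s where "s = 8 * c_U + 1"
      have "s > 0" using c_U_nonneg by (simp add: s_def)
      then show ?thesis unfolding ql \<kappa>_def V_def s_def[symmetric] using \<omega> by (simp add: power_divide)
    qed
    finally have Z': "measure lborel ?Z' \<le> e0 * (r/2) ^ DIM('a) / 2" .
    have "measure lborel (ball y (\<epsilon> * r)) = \<omega> * \<epsilon> ^ DIM('a) * r ^ DIM('a)"
      using \<epsilon> \<open>r > 0\<close> by (simp add: content_ball \<omega>_def power_mult_distrib)
    also have "\<dots> \<le> \<omega> * \<epsilon> * r ^ DIM('a)"
      using \<epsilon> \<omega> \<open>r > 0\<close> power_decreasing[of 1 "DIM('a)" \<epsilon>] by (intro mult_left_mono mult_right_mono) (auto simp: Suc_le_eq)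
    also have "\<dots> \<le> \<omega> * (e0 * (1/2) ^ DIM('a) / (2 * \<omega>)) * r ^ DIM('a)"
      using \<epsilon> \<omega> \<open>r > 0\<close> by (intro mult_left_mono mult_right_mono) auto
    also have "\<dots> = e0 * (r/2) ^ DIM('a) / 2" using \<omega> by (simp add: power_divide)
    finally have B: "measure lborel (ball y (\<epsilon> * r)) \<le> e0 * (r/2) ^ DIM('a) / 2" .
    have "measure lborel ?Z \<le> measure lborel (?Z' \<union> ball y (\<epsilon> * r))"
    proof (rule measure_mono_fmeasurable)
      show "?Z' \<union> ball y (\<epsilon> * r) \<in> fmeasurable lborel"
        using Z'finite_energy Zs emeasure_lborel_ball_finite[of y "\<epsilon> * r"] by (intro fmeasurable.Un) (auto simp: fmeasurable_def)
    qed auto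
    also have "\<dots> \<le> measure lborel ?Z' + measure lborel (ball y (\<epsilon> * r))" by (rule measure_Un_le) (use Zs in auto)
    finally show ?thesis using Z' B by linarith
  qed
  have "AE x in lborel. x \<in> ball y (r / 2 / 2) \<longrightarrow> l / 2 \<le> \<phi> x"
  proof (rule degiorgi_lower_bound[OF finite_energy\<phi> \<phi>(2) l, of "r/2" \<kappa>])
    show "0 < r/2" using \<open>r > 0\<close> by simp
    show "0 \<le> \<kappa>" using \<kappa> by simp
    have "l * (r/2) powr (- \<alpha>) = \<kappa> * 2 powr \<alpha>"
      using \<open>r > 0\<close> by (simp add: l_def powr_divide powr_minus field_simps)
    moreover have "2 powr \<alpha> \<ge> (1::real)" using \<alpha> by (intro ge_one_powr_ge_zero) auto
    ultimately show "\<kappa> \<le> l * (r/2) powr (- \<alpha>)" using \<kappa> by simp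
    show "measure lborel ?Z \<le> eps0 * (r/2) ^ DIM('a)" using Z_small by (simp add: e0_eq)
    fix \<zeta> assume \<zeta>: "finite_energy \<zeta>" "\<And>x. 0 \<le> \<zeta> x" "\<And>x. \<zeta> x \<le> l" "\<And>x. x \<notin> ball y (r/2) \<or> l \<le> \<phi> x \<Longrightarrow> \<zeta> x = 0"
    have sub: "ball y (r/2) \<subseteq> \<Omega>" using \<open>ball y r \<subseteq> \<Omega>\<close> \<open>r > 0\<close> by (auto intro!: subset_trans[OF subset_ball[of "r/2" r y]])
    have \<zeta>4: "x \<notin> ball y (r/2) \<Longrightarrow> \<zeta> x = 0" for x using \<zeta>(4) by blast
    have i\<zeta>: "integrable lborel \<zeta>" by (rule int_\<zeta>[OF \<zeta>(1-3) \<zeta>4])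
    have "- \<kappa> * (\<integral>x. \<zeta> x \<partial>lborel) = (\<integral>x. - \<kappa> * \<zeta> x \<partial>lborel)" by simp
    also have "\<dots> \<le> (\<integral>x. (indicator A x - q * \<phi> x) * \<zeta> x \<partial>lborel)"
    proof (rule integral_mono)
      show "integrable lborel (\<lambda>x. - \<kappa> * \<zeta> x)" using i\<zeta> by simp
      show "integrable lborel (\<lambda>x. (indicator A x - q * \<phi> x) * \<zeta> x)"
        by (rule int_mult[OF i\<zeta>]) (use q\<phi> in \<open>auto simp: indicator_def\<close>)
      fix x
      show "- \<kappa> * \<zeta> x \<le> (indicator A x - q * \<phi> x) * \<zeta> x"
      \<comment> \<open>Only points with \<phi> < l are tested; there the right-hand side is at
        least -q l = -\<kappa>, even inside the removed ball.\<close>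
      proof (cases "\<phi> x < l")
        case True
        then have "q * \<phi> x \<le> \<kappa>" using q ql mult_left_mono[of "\<phi> x" l q] by simp
        then have "- \<kappa> \<le> indicator A x - q * \<phi> x" by (auto simp: indicator_def)
        then show ?thesis using \<zeta>(2)[of x] by (intro mult_right_mono)
      next
        case False then show ?thesis using \<zeta>(4)[of x] by simp
      qed
    qed
    also have "\<dots> = form \<phi> \<zeta>" by (rule eq[OF bounded_support_in_H0[OF \<zeta>(1-3) \<zeta>4 sub], symmetric])
    finally show "form \<phi> \<zeta> \<ge> - \<kappa> * (\<integral>x. \<zeta> x \<partial>lborel)" .
  qed
  then have "l / 2 \<le> g y" using g(3) \<open>y \<in> \<Omega>\<close> \<open>r > 0\<close> by (intro g(3)[rule_format, of y "r/2/2"]) auto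
  then show ?thesis using \<phi>(1,2) q\<phi> eq g(1,2) by (intro exI[of _ \<phi>] exI[of _ g]) (auto simp: l_def)
qed

end

section \<open>Harnack chains and the Green function\<close>

lemma energy_nn_cong_AE:
  assumes k: "AE x in lborel. AE y in lborel. k x y = k' x y" and u: "AE x in lborel. u x = u' x"
  shows "energy_nn U k u = energy_nn U k' u'"
  unfolding energy_nn_def nn_integral_completion
proof (rule nn_integral_cong_AE)
  show "AE x in lborel. indicator U x * (\<integral>\<^sup>+y. indicator U y * ennreal ((u y - u x)\<^sup>2 * k x y) \<partial>lborel)
     = indicator U x * (\<integral>\<^sup>+y. indicator U y * ennreal ((u' y - u' x)\<^sup>2 * k' x y) \<partial>lborel)"
    using k u
  proof eventually_elim
    case (elim x)
    have "(\<integral>\<^sup>+y. indicator U y * ennreal ((u y - u x)\<^sup>2 * k x y) \<partial>lborel)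
      = (\<integral>\<^sup>+y. indicator U y * ennreal ((u' y - u' x)\<^sup>2 * k' x y) \<partial>lborel)"
    proof (rule nn_integral_cong_AE)
      show "AE y in lborel. indicator U y * ennreal ((u y - u x)\<^sup>2 * k x y) = indicator U y * ennreal ((u' y - u' x)\<^sup>2 * k' x y)"
        using elim(1) u by eventually_elim (simp add: elim(2))
    qed
    then show ?case by simp
  qed
qed

text \<open>\<open>k\<close> is Lebesgue measurable and symmetric off the diagonal. A Borel version
  is symmetrised by averaging and clamped at 0; rows and columns over the null set of bad sections
  are then set to 0. The bound (U1), which is required at every x, survives: a bad row is 0, and
  every other row agrees almost everywhere with that of \<open>k\<close>.\<close>

lemma kernel_regularization:
  fixes k :: "'a::euclidean_space \<Rightarrow> 'a \<Rightarrow> real"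
  assumes k: "kernel_ok k"
  obtains k' where "symmetric_kernel k'" "AE x in lborel. AE y in lborel. k x y = k' x y"
    "\<And>\<alpha> c_U. cond_U1 \<alpha> c_U k \<Longrightarrow> cond_U1 \<alpha> c_U k'"
proof -
  let ?M = "lborel \<Otimes>\<^sub>M lborel :: ('a \<times> 'a) measure"
  have km: "(\<lambda>p. k (fst p) (snd p)) \<in> borel_measurable (completion ?M)"
    and k1: "\<And>x y. x \<noteq> y \<Longrightarrow> k x y \<ge> 0 \<and> k x y = k y x"
    using k by (auto simp: kernel_ok_def leb2_def)
  obtain g where g [measurable]: "g \<in> borel_measurable ?M" and ae: "AE p in ?M. k (fst p) (snd p) = g p"
    using completion_ex_borel_measurable_real[OF km] by auto
  have g_borel [measurable]: "g \<in> borel_measurable borel" using g by (simp add: lborel_prod)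
  have "AE p in distr ?M ?M (\<lambda>(x, y). (y, x)). k (fst p) (snd p) = g p"
    using ae lborel_pair.distr_pair_swap by metis
  then have ae': "AE p in ?M. k (snd p) (fst p) = g (snd p, fst p)"
    by (drule_tac AE_distrD[rotated]) (auto simp: case_prod_beta)
  have "AE p in ?M. k (fst p) (snd p) = g p \<and> k (snd p) (fst p) = g (snd p, fst p)"
    using ae ae' by eventually_elim auto
  then have ae2: "AE x in lborel. AE y in lborel. k x y = g (x, y) \<and> k y x = g (y, x)"
    by (drule_tac lborel_pair.AE_pair) simp
  define k0 where "k0 x y = max 0 ((g (x, y) + g (y, x)) / 2)" for x y
  have "AE x in lborel. AE y in lborel. k x y = k0 x y"
    using ae2
  proof eventually_elim
    case (elim x)
    have "AE y in lborel. y \<noteq> x" by (rule AE_lborel_singleton)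
    with elim show ?case
    proof eventually_elim
      case (elim y)
      then show ?case using k1[of x y] by (simp add: k0_def)
    qed
  qed
  then obtain N where N: "{x. \<not> (AE y in lborel. k x y = k0 x y)} \<subseteq> N" "N \<in> null_sets lborel"
    unfolding eventually_ae_filter[of _ lborel] by auto
  have [measurable]: "N \<in> sets borel" using N(2) by (auto simp: null_sets_def)
  define k' where "k' x y = (if x \<in> N \<or> y \<in> N then 0 else k0 x y)" for x y
  have k'_eq: "AE y in lborel. k x y = k' x y" if "x \<notin> N" for x
  proof -
    have "AE y in lborel. k x y = k0 x y" using N(1) that by auto
    then show ?thesis using AE_not_in[OF N(2)] by eventually_elim (use that in \<open>auto simp: k'_def\<close>)
  qed
  show thesis
  proof (rule that[of k'])
    show "symmetric_kernel k'"
    proof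
      have "(\<lambda>p. g (snd p, fst p)) \<in> borel_measurable borel"
      proof -
        have "(\<lambda>p. (snd p, fst p)) \<in> borel \<rightarrow>\<^sub>M (borel :: ('a \<times> 'a) measure)"
          by (intro borel_measurable_continuous_onI continuous_intros)
        from measurable_compose[OF this g_borel] show ?thesis .
      qed
      then show "(\<lambda>p. k' (fst p) (snd p)) \<in> borel_measurable borel"
        unfolding k'_def k0_def by simp
    qed (auto simp: k'_def k0_def add.commute)
    show "AE x in lborel. AE y in lborel. k x y = k' x y"
      using AE_not_in[OF N(2)] by eventually_elim (rule k'_eq)
    fix \<alpha> c_U assume U: "cond_U1 \<alpha> c_U k"
    show "cond_U1 \<alpha> c_U k'"
      unfolding cond_U1_def nn_integral_completion
    proof (intro allI impI)
      fix r :: real and x :: 'a assume "r > 0"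
      show "(\<integral>\<^sup>+y. ennreal (min (r\<^sup>2) ((dist y x)\<^sup>2) * k' x y) \<partial>lborel) \<le> ennreal (c_U * r powr (2 - \<alpha>))"
      proof (cases "x \<in> N")
        case True then show ?thesis by (simp add: k'_def)
      next
        case False
        have "(\<integral>\<^sup>+y. ennreal (min (r\<^sup>2) ((dist y x)\<^sup>2) * k' x y) \<partial>lborel) = (\<integral>\<^sup>+y. ennreal (min (r\<^sup>2) ((dist y x)\<^sup>2) * k x y) \<partial>lborel)"
          using k'_eq[OF False] by (intro nn_integral_cong_AE) (auto elim: eventually_mono)
        then show ?thesis using U \<open>r > 0\<close> unfolding cond_U1_def nn_integral_completion by simp
      qed
    qed
  qed
qed

text \<open>Lebesgue measure is complete, so f becomes measurable by agreeing almost everywhere with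
  a Borel function.\<close>

lemma integral_lebesgue_cong_AE:
  fixes f g :: "'a::euclidean_space \<Rightarrow> real"
  assumes [measurable]: "g \<in> borel_measurable borel" and ae: "AE x in lborel. f x = g x"
  shows "(\<integral>x. f x \<partial>lebesgue) = (\<integral>x. g x \<partial>lborel)"
proof -
  have gl: "g \<in> borel_measurable lebesgue" by (rule measurable_completion) simp
  have ae': "AE x in lebesgue. f x = g x" using ae by (rule AE_completion)
  have "AE x in lebesgue. g x = f x" using ae' by eventually_elim simp
  then have "f \<in> borel_measurable lebesgue" by (rule borel_measurable_AE[OF gl])
  then have "(\<integral>x. f x \<partial>lebesgue) = (\<integral>x. g x \<partial>lebesgue)" by (rule integral_cong_AE[OF _ gl ae'])
  also have "\<dots> = (\<integral>x. g x \<partial>lborel)" by (rule integral_completion) simp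
  finally show ?thesis .
qed

lemma lebesgue_borel_representative:
  fixes v :: "'a::euclidean_space \<Rightarrow> real"
  assumes "v \<in> borel_measurable lebesgue"
  obtains v' where "v' \<in> borel_measurable borel" "AE x in lborel. v x = v' x"
  using completion_ex_borel_measurable_real[OF assms] by auto

context symmetric_kernel begin

text \<open>\<open>energy_form\<close> is an iterated integral; finite energies make the integrand
  integrable on the product, and Fubini applies.\<close>

lemma energy_form_eq_form:
  assumes "finite_energy u'" "finite_energy v'" and kk: "AE x in lborel. AE y in lborel. k0 x y = k x y"
    and u: "AE x in lborel. u x = u' x" and v: "AE x in lborel. v x = v' x"
  shows "energy_form k0 u v = form u' v'"
proof -
  have [measurable]: "u' \<in> borel_measurable borel" "v' \<in> borel_measurable borel" using assms(1,2) by measurable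
  let ?f = "\<lambda>p. k (fst p) (snd p) * (incr u' p * incr v' p)"
  have fm [measurable]: "?f \<in> borel_measurable borel" by measurable
  have fm2: "?f \<in> borel_measurable (lborel \<Otimes>\<^sub>M lborel)" using fm by (simp add: lborel_prod)
  have int: "integrable lborel ?f"
    using integrable_incr_mult[OF assms(1,2)] unfolding jump_def
    by (subst (asm) integrable_density) (auto simp: k_nonneg)
  have form: "form u' v' = (\<integral>p. ?f p \<partial>lborel)"
    unfolding form_def jump_def by (subst integral_density) (auto simp: k_nonneg)
  have fst: "(\<integral>x. (\<integral>y. ?f (x, y) \<partial>lborel) \<partial>lborel) = form u' v'"
    unfolding form using lborel_pair.integral_fst'[of ?f] int by (simp add: lborel_prod)
  have sec: "(\<lambda>y. ?f (x, y)) \<in> borel_measurable borel" for x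
    using measurable_compose[OF measurable_Pair1'[of x lborel lborel] fm2] by simp
  have outer: "(\<lambda>x. \<integral>y. ?f (x, y) \<partial>lborel) \<in> borel_measurable borel"
    using lborel.borel_measurable_lebesgue_integral[of "\<lambda>x y. ?f (x, y)" lborel] fm2 by (simp add: case_prod_beta')
  have "energy_form k0 u v = (\<integral>x. (\<integral>y. ?f (x, y) \<partial>lborel) \<partial>lborel)"
    unfolding energy_form_def
  proof (rule integral_lebesgue_cong_AE[OF outer])
    show "AE x in lborel. (\<integral>y. (u y - u x) * (v y - v x) * k0 x y \<partial>lebesgue) = (\<integral>y. ?f (x, y) \<partial>lborel)"
      using kk u v
    proof eventually_elim
      case (elim x)
      show ?case
      proof (rule integral_lebesgue_cong_AE[OF sec])
        show "AE y in lborel. (u y - u x) * (v y - v x) * k0 x y = ?f (x, y)"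
          using elim(1) u v by eventually_elim (simp add: elim(2,3) incr_def)
      qed
    qed
  qed
  then show ?thesis using fst by (rule trans)
qed

end

section \<open>Harnack chains towards the pole\<close>

lemma cball_subset_of_infdist_frontier:
  fixes y :: "'a::euclidean_space"
  assumes "y \<in> \<Omega>" "0 \<le> s" "s < infdist y (frontier \<Omega>)"
  shows "cball y s \<subseteq> \<Omega>"
proof (rule ccontr)
  assume "\<not> cball y s \<subseteq> \<Omega>"
  then have "cball y s - \<Omega> \<noteq> {}" by blast
  moreover have "y \<in> cball y s \<inter> \<Omega>" using assms by simp
  then have "cball y s \<inter> \<Omega> \<noteq> {}" by blast
  ultimately have "cball y s \<inter> frontier \<Omega> \<noteq> {}"
    by (intro connected_Int_frontier convex_connected convex_cball)
  then obtain z where "z \<in> frontier \<Omega>" "dist y z \<le> s" by auto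
  then show False using infdist_le[of z "frontier \<Omega>" y] assms(3) by simp
qed

lemma exists_at_distance:
  fixes y :: "'a::euclidean_space"
  assumes "t \<ge> 0"
  obtains p where "dist y p = t"
proof -
  obtain e :: 'a where "norm e = 1" using vector_choose_size[of 1] by auto
  then have "dist y (y + t *\<^sub>R e) = t" using assms by (simp add: dist_norm)
  then show thesis by (rule that)
qed

text \<open>The radii shrink by 2/3, which exceeds 1/2, so the inner sphere of each annulus lies in
  the next one and a point p on it links the two. The first radius is 2/3 of |x - y|: the doubled
  ball has radius 4/3 |x - y|, which still contains x and stays strictly inside \<Omega>, whereas 2
  |x - y| may reach the frontier.\<close>

lemma harnack_chain:
  fixes y :: "'a::euclidean_space" and G :: "'a \<Rightarrow> 'a \<Rightarrow> ennreal"
  assumes H: "cond_H c_H \<Omega> G" and "y \<in> \<Omega>" and x: "0 < dist x y" "dist x y \<le> infdist y (frontier \<Omega>) / 2"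
    and "0 \<le> K" "c_H \<le> K"
  shows "z \<in> ball y (2 * (dist x y * (2/3) ^ Suc n)) - ball y (dist x y * (2/3) ^ Suc n) \<Longrightarrow> G z y \<le> ennreal (K ^ Suc n) * G x y"
proof (induction n arbitrary: z)
  let ?t = "\<lambda>n. dist x y * (2/3) ^ Suc n"
  have tpos: "?t n > 0" for n using x by simp
  have sub: "cball y (2 * ?t n) \<subseteq> \<Omega>" for n
  proof (rule cball_subset_of_infdist_frontier[OF \<open>y \<in> \<Omega>\<close>])
    show "0 \<le> 2 * ?t n" using tpos[of n] by simp
    have "(2/3 :: real) ^ Suc n \<le> (2/3) ^ 1" by (intro power_decreasing) auto
    then have "2 * ?t n \<le> 2 * (dist x y * (2/3))" using x by (intro mult_left_mono) auto
    also have "\<dots> < infdist y (frontier \<Omega>)" using x by linarith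
    finally show "2 * ?t n < infdist y (frontier \<Omega>)" .
  qed
  have comp: "G z y \<le> ennreal K * G w y" if "z \<in> ball y (2 * ?t n) - ball y (?t n)" "w \<in> ball y (2 * ?t n) - ball y (?t n)" for z w n
  proof -
    let ?A = "ball y (2 * ?t n) - ball y (?t n)"
    have "G z y \<le> (SUP x\<in>?A. G x y)" by (rule SUP_upper[OF that(1)])
    also have "\<dots> \<le> ennreal c_H * (INF x\<in>?A. G x y)"
      using H \<open>y \<in> \<Omega>\<close> tpos[of n] sub[of n] unfolding cond_H_def by blast
    also have "\<dots> \<le> ennreal K * G w y"
      using \<open>c_H \<le> K\<close> by (intro mult_mono ennreal_leI INF_lower[OF that(2)]) auto
    finally show ?thesis .
  qed
  {
    case 0
    have "x \<in> ball y (2 * ?t 0) - ball y (?t 0)" using x by (simp add: dist_commute)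
    from comp[OF 0 this] show ?case by simp
  next
    case (Suc n)
    obtain p where p: "dist y p = ?t n" using exists_at_distance[of "?t n" y] tpos[of n] by auto
    have "p \<in> ball y (2 * ?t n) - ball y (?t n)" using p tpos[of n] by simp
    from Suc.IH[OF this] have 1: "G p y \<le> ennreal (K ^ Suc n) * G x y" .
    have "p \<in> ball y (2 * ?t (Suc n)) - ball y (?t (Suc n))" using p tpos[of n] by simp
    from comp[OF Suc.prems this] have "G z y \<le> ennreal K * G p y" .
    also have "\<dots> \<le> ennreal K * (ennreal (K ^ Suc n) * G x y)" by (intro mult_left_mono 1) auto
    also have "\<dots> = ennreal (K ^ Suc (Suc n)) * G x y" using \<open>0 \<le> K\<close> by (simp add: ennreal_mult mult.assoc)
    finally show ?case .
  }
qed

text \<open>The least m with \<open>?t m \<le> dist y z\<close> locates an annulus containing z; m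
  \<le> n bounds the length of the chain, and K \<ge> 1 makes shorter chains cheaper.\<close>

lemma harnack_annulus:
  fixes y :: "'a::euclidean_space" and G :: "'a \<Rightarrow> 'a \<Rightarrow> ennreal"
  assumes H: "cond_H c_H \<Omega> G" and "y \<in> \<Omega>" and x: "0 < dist x y" "dist x y \<le> infdist y (frontier \<Omega>) / 2"
    and "1 \<le> K" "c_H \<le> K" and n: "(2/3) ^ Suc n \<le> \<epsilon>"
    and z: "z \<in> ball y (dist x y) - ball y (\<epsilon> * dist x y)"
  shows "G z y \<le> ennreal (K ^ Suc n) * G x y"
proof -
  let ?t = "\<lambda>n. dist x y * (2/3) ^ Suc n"
  define m where "m = (LEAST m. ?t m \<le> dist y z)"
  have "?t n \<le> dist y z"
  proof -
    have "?t n \<le> dist x y * \<epsilon>" by (rule mult_left_mono[OF n]) simp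
    also have "\<dots> \<le> dist y z" using z by (simp add: mult.commute)
    finally show ?thesis .
  qed
  then have m: "?t m \<le> dist y z" "m \<le> n" unfolding m_def by (rule LeastI, rule Least_le)
  \<comment> \<open>Minimality gives |y - z| < t_(m-1) = (3/2) t_m; for m = 0 the role of t_(m-1) is
    played by |x - y|.\<close>
  have "dist y z < 2 * ?t m"
  proof (cases m)
    case 0
    have "dist y z < dist x y" using z by simp
    moreover have "2 * ?t m = 4/3 * dist x y" using 0 by simp
    ultimately show ?thesis using zero_le_dist[of x y] by linarith
  next
    case (Suc j)
    then have "\<not> ?t j \<le> dist y z" using not_less_Least[of j "\<lambda>m. ?t m \<le> dist y z"] by (simp add: m_def)
    moreover have "2 * ?t m = 4/3 * ?t j" using Suc by simp
    ultimately show ?thesis using zero_le_dist[of y z] by linarith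
  qed
  with m have "z \<in> ball y (2 * ?t m) - ball y (?t m)" by simp
  from harnack_chain[OF H \<open>y \<in> \<Omega>\<close> x _ \<open>c_H \<le> K\<close> this] have "G z y \<le> ennreal (K ^ Suc m) * G x y" using \<open>1 \<le> K\<close> by simp
  also have "\<dots> \<le> ennreal (K ^ Suc n) * G x y"
    using \<open>1 \<le> K\<close> m(2) by (intro mult_right_mono ennreal_leI power_increasing) auto
  finally show ?thesis .
qed

section \<open>Almost everywhere versions of the energy space\<close>

context symmetric_kernel begin

lemma H0_imp_in_H0:
  assumes u: "u \<in> H0 \<Omega>" and kk: "AE x in lborel. AE y in lborel. k0 x y = k x y" and ae: "AE x in lborel. u' x = u x"
  shows "in_H0 k0 \<Omega> u'"
proof -
  have [measurable]: "u \<in> borel_measurable borel" by (rule H0D(4)[OF u])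
  have "energy_nn UNIV k0 u' = energy u"
    using energy_nn_cong_AE[OF kk ae] by (simp add: energy_nn_UNIV)
  moreover have "u' \<in> borel_measurable lebesgue"
  proof (rule borel_measurable_AE)
    show "u \<in> borel_measurable lebesgue" by (rule measurable_completion) simp
    show "AE x in lebesgue. u x = u' x" using AE_completion[OF ae] by eventually_elim simp
  qed
  moreover have "(\<integral>\<^sup>+x. ennreal ((u' x)\<^sup>2) \<partial>lborel) = (\<integral>\<^sup>+x. ennreal ((u x)\<^sup>2) \<partial>lborel)"
    using ae by (intro nn_integral_cong_AE) (auto elim: eventually_mono)
  moreover have "(\<integral>\<^sup>+x. ennreal ((u x)\<^sup>2) \<partial>lborel) < \<infinity>"
    using H0D(3)[OF u] by (simp add: integrable_iff_bounded)
  moreover have "AE x in lebesgue. x \<notin> \<Omega> \<longrightarrow> u' x = 0"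
    using AE_completion[OF ae] by eventually_elim (use H0D(2)[OF u] in auto)
  ultimately show ?thesis
    using H0D(1)[OF u] by (simp add: in_H0_def in_H_def L2_on_def nn_integral_completion finite_energy_def)
qed

lemma in_H0_representative:
  assumes v: "in_H0 k0 \<Omega> v" and kk: "AE x in lborel. AE y in lborel. k0 x y = k x y" and [measurable]: "\<Omega> \<in> sets borel"
  obtains w where "w \<in> H0 \<Omega>" "AE x in lborel. v x = w x"
proof -
  have vm: "v \<in> borel_measurable lebesgue" and vL: "(\<integral>\<^sup>+x. ennreal ((v x)\<^sup>2) \<partial>lborel) < \<infinity>"
    and vE: "energy_nn UNIV k0 v < \<infinity>" and v0: "AE x in lborel. x \<notin> \<Omega> \<longrightarrow> v x = 0"
    using v by (auto simp: in_H0_def in_H_def L2_on_def nn_integral_completion AE_completion_iff)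
  obtain v' where v' [measurable]: "v' \<in> borel_measurable borel" and ae: "AE x in lborel. v x = v' x"
    by (rule lebesgue_borel_representative[OF vm])
  define w where "w x = indicator \<Omega> x * v' x" for x
  have [measurable]: "w \<in> borel_measurable borel" unfolding w_def[abs_def] by measurable
  have aew: "AE x in lborel. v x = w x" using ae v0 by eventually_elim (auto simp: w_def indicator_def)
  have "energy w < \<infinity>" using vE energy_nn_cong_AE[OF kk aew] by (simp add: energy_nn_UNIV)
  moreover have "(\<integral>\<^sup>+x. ennreal ((v x)\<^sup>2) \<partial>lborel) = (\<integral>\<^sup>+x. ennreal ((w x)\<^sup>2) \<partial>lborel)"
    using aew by (intro nn_integral_cong_AE) (auto elim: eventually_mono)
  then have "integrable lborel (\<lambda>x. (w x)\<^sup>2)" using vL by (intro integrableI_nonneg) auto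
  ultimately have "w \<in> H0 \<Omega>" by (simp add: H0_def finite_energy_def w_def)
  then show thesis using aew by (rule that)
qed

end

section \<open>The lower bound for the Green function\<close>

theorem mainTheorem3:
  fixes \<alpha>0 c_l c_U c_H :: real
  assumes "DIM('a::euclidean_space) \<ge> 3"
    and "0 < \<alpha>0" and "\<alpha>0 < 2"
    and "c_l > 0" and "c_U > 0" and "c_H > 0"
  shows "\<exists>C>0. \<forall>(\<alpha>::real) (\<Omega>::'a set) k G.
           \<alpha>0 \<le> \<alpha> \<longrightarrow> \<alpha> < 2 \<longrightarrow> bounded \<Omega> \<longrightarrow> open \<Omega> \<longrightarrow>
           kernel_ok k \<longrightarrow> cond_E_ge \<alpha> c_l k \<longrightarrow> cond_U1 \<alpha> c_U k \<longrightarrow>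
           green_function k \<Omega> G \<longrightarrow> cond_H c_H \<Omega> G \<longrightarrow>
           (\<forall>x\<in>\<Omega>. \<forall>y\<in>\<Omega>. 0 < dist x y \<longrightarrow> dist x y \<le> infdist y (frontier \<Omega>) / 2 \<longrightarrow>
              ennreal (C * dist x y powr (\<alpha> - real DIM('a))) \<le> G x y)"
proof -
  let ?d = "real DIM('a)"
  obtain C_F where C_F: "C_F > 0" and FK: "\<forall>\<alpha> (k :: 'a \<Rightarrow> 'a \<Rightarrow> real) (u :: 'a \<Rightarrow> real) S. \<alpha>0 \<le> \<alpha> \<longrightarrow> \<alpha> < 2 \<longrightarrow> cond_E_ge \<alpha> c_l k \<longrightarrow>
     u \<in> borel_measurable borel \<longrightarrow> S \<in> sets borel \<longrightarrow> (\<forall>x. x \<notin> S \<longrightarrow> u x = 0) \<longrightarrow>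
     emeasure lborel S < \<infinity> \<longrightarrow> measure lborel S > 0 \<longrightarrow> (\<integral>\<^sup>+x. ennreal ((u x)\<^sup>2) \<partial>lborel) < \<infinity> \<longrightarrow>
     (\<integral>\<^sup>+x. ennreal ((u x)\<^sup>2) \<partial>lborel)
       \<le> ennreal (C_F * measure lborel S powr (\<alpha> / ?d)) * energy_nn UNIV k u"
    using faber_krahn[OF assms(2-4), where 'a = 'a] by (elim exE conjE)
  define e0 where "e0 = degiorgi_eps (256 * C_F * (2 * c_U + 1)) (\<alpha>0 / ?d)"
  define \<omega> where "\<omega> = unit_ball_vol ?d"
  define \<kappa> where "\<kappa> = e0 * (1/2) ^ DIM('a) / (4 * (8 * c_U + 1) * \<omega>)"
  define \<epsilon> where "\<epsilon> = min (1/2) (e0 * (1/2) ^ DIM('a) / (2 * \<omega>))"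
  have e0: "e0 > 0" using C_F assms by (simp add: e0_def degiorgi_eps_pos)
  have \<omega>: "\<omega> > 0" by (simp add: \<omega>_def)
  have \<kappa>: "\<kappa> > 0" using e0 \<omega> assms by (simp add: \<kappa>_def)
  have \<epsilon>: "\<epsilon> > 0" using e0 \<omega> by (simp add: \<epsilon>_def)
  \<comment> \<open>The length of the Harnack chain depends on \<epsilon> alone, hence not on
    \<alpha>, \<Omega> or |x - y|.\<close>
  obtain n where "(2/3 :: real) ^ n < \<epsilon>" using real_arch_pow_inv[OF \<epsilon>, of "2/3"] by auto
  then have n: "(2/3 :: real) ^ Suc n \<le> \<epsilon>" using power_decreasing[of n "Suc n" "2/3::real"] by linarith
  define K where "K = max 1 c_H"
  have K: "1 \<le> K" "c_H \<le> K" by (auto simp: K_def)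
  \<comment> \<open>Read off from the final inequality \<kappa> r^\<alpha> / 2 \<le> K^(n+1) t
    \<omega> r^d, solved for t = G x y.\<close>
  define C where "C = \<kappa> / (2 * K ^ Suc n * \<omega>)"
  have C: "C > 0" using \<kappa> K \<omega> by (simp add: C_def)
  show ?thesis
  proof (rule exI[of _ C], intro conjI C allI impI ballI)
    fix \<alpha> :: real and \<Omega> :: "'a set" and k G and x y
    assume \<alpha>: "\<alpha>0 \<le> \<alpha>" "\<alpha> < 2" and "open \<Omega>" and k: "kernel_ok k" and E: "cond_E_ge \<alpha> c_l k"
      and U: "cond_U1 \<alpha> c_U k" and G: "green_function k \<Omega> G" and H: "cond_H c_H \<Omega> G"
      and "x \<in> \<Omega>" and y: "y \<in> \<Omega>" and x: "0 < dist x y" "dist x y \<le> infdist y (frontier \<Omega>) / 2"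
    obtain k' where k': "symmetric_kernel k'" and kk: "AE x in lborel. AE y in lborel. k x y = k' x y" and U': "cond_U1 \<alpha> c_U k'"
      using kernel_regularization[OF k] U by metis
    have E': "cond_E_ge \<alpha> c_l k'"
      using E energy_nn_cong_AE[OF kk, of u u for u] by (simp add: cond_E_ge_def)
    interpret symmetric_kernel k' by (rule k')
    interpret elliptic_kernel k' \<alpha> c_U \<alpha>0 C_F c_l
    proof
      show "cond_U1 \<alpha> c_U k'" "cond_E_ge \<alpha> c_l k'" by fact+
      fix u :: "'a \<Rightarrow> real" and S
      assume "u \<in> borel_measurable borel" "S \<in> sets borel" "\<And>x. x \<notin> S \<Longrightarrow> u x = 0"
        "emeasure lborel S < \<infinity>" "measure lborel S > 0" "(\<integral>\<^sup>+x. ennreal ((u x)\<^sup>2) \<partial>lborel) < \<infinity>"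
      then show "(\<integral>\<^sup>+x. ennreal ((u x)\<^sup>2) \<partial>lborel) \<le> ennreal (C_F * measure lborel S powr (\<alpha> / ?d)) * energy u"
        using FK[rule_format, of \<alpha> k' u S] \<alpha> E' by (simp add: energy_nn_UNIV)
    qed (use \<alpha> assms C_F in auto)
    define r where "r = dist x y"
    have r: "r > 0" using x by (simp add: r_def)
    have [measurable]: "\<Omega> \<in> sets borel" using \<open>open \<Omega>\<close> by simp
    have sub: "ball y r \<subseteq> \<Omega>"
      using cball_subset_of_infdist_frontier[OF y, of r] r x by (force simp: r_def)
    define q where "q = r powr (- \<alpha>)"
    define A where "A = ball y r - ball y (\<epsilon> * r)"
    have [measurable]: "A \<in> sets borel" by (simp add: A_def)
    obtain \<phi> g where \<phi>: "\<phi> \<in> H0 \<Omega>" "\<And>x. 0 \<le> \<phi> x \<and> q * \<phi> x \<le> 1"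
      and eq: "\<And>v. v \<in> H0 \<Omega> \<Longrightarrow> form \<phi> v = (\<integral>x. (indicator A x - q * \<phi> x) * v x \<partial>lborel)"
      and g: "continuous_on \<Omega> g" "AE x in lborel. x \<in> \<Omega> \<longrightarrow> g x = \<phi> x" "\<kappa> * r powr \<alpha> / 2 \<le> g y"
      using continuous_test_function[OF \<open>open \<Omega>\<close> y r sub]
      unfolding A_def q_def \<kappa>_def \<epsilon>_def \<omega>_def e0_def by blast
    have [measurable]: "\<phi> \<in> borel_measurable borel" by (rule H0D(4)[OF \<phi>(1)])
    have q0: "q \<ge> 0" by (simp add: q_def)
    define \<psi> where "\<psi> x = indicator A x - q * \<phi> x" for x
    \<comment> \<open>An admissible function is continuous at every point of \<Omega> and vanishes
      outside, hence g inside and 0 outside; it equals \<phi> almost everywhere and so satisfies the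
      same weak equation.\<close>
    define \<phi>' where "\<phi>' x = (if x \<in> \<Omega> then g x else 0)" for x
    have ae: "AE x in lborel. \<phi>' x = \<phi> x"
      using g(2) by eventually_elim (use H0D(2)[OF \<phi>(1)] in \<open>auto simp: \<phi>'_def\<close>)
    have \<psi>_meas [measurable]: "\<psi> \<in> borel_measurable borel" unfolding \<psi>_def[abs_def] by measurable
    have A\<Omega>: "A \<subseteq> \<Omega>" using sub by (auto simp: A_def)
    have "(\<integral>x. enn2real (G x y) * \<psi> x \<partial>lebesgue) = \<phi>' y"
    proof -
      have "in_H0 k \<Omega> \<phi>'" by (rule H0_imp_in_H0[OF \<phi>(1) kk ae])
      moreover have "continuous_on \<Omega> \<phi>'"
        using g(1) by (subst continuous_on_cong[of \<Omega> \<Omega> \<phi>' g]) (auto simp: \<phi>'_def)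
      moreover have "Linf_on \<Omega> \<psi>"
        unfolding Linf_on_def
      proof (intro conjI exI[of _ 1])
        show "\<psi> \<in> borel_measurable lebesgue" by (rule measurable_completion) simp
        have "\<bar>\<psi> x\<bar> \<le> 1" for x using \<phi>(2)[of x] q0 by (auto simp: \<psi>_def indicator_def abs_le_iff intro: order_trans[of _ 0])
        then show "AE x in lebesgue. \<bar>\<psi> x\<bar> \<le> 1" by simp
        have "x \<notin> \<Omega> \<Longrightarrow> \<psi> x = 0" for x using A\<Omega> H0D(2)[OF \<phi>(1)] by (auto simp: \<psi>_def indicator_def)
        then show "AE x in lebesgue. x \<notin> \<Omega> \<longrightarrow> \<psi> x = 0" by simp
      qed
      moreover have "energy_form k \<phi>' v = (\<integral>x. \<psi> x * v x \<partial>lebesgue)" if v: "in_H0 k \<Omega> v" for v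
      proof -
        obtain w where w: "w \<in> H0 \<Omega>" "AE x in lborel. v x = w x"
          by (rule in_H0_representative[OF v kk]) auto
        have [measurable]: "w \<in> borel_measurable borel" by (rule H0D(4)[OF w(1)])
        have "energy_form k \<phi>' v = form \<phi> w"
          by (rule energy_form_eq_form[OF H0D(1)[OF \<phi>(1)] H0D(1)[OF w(1)] kk ae w(2)])
        also have "\<dots> = (\<integral>x. \<psi> x * w x \<partial>lborel)" unfolding \<psi>_def by (rule eq[OF w(1)])
        also have "\<dots> = (\<integral>x. \<psi> x * v x \<partial>lebesgue)"
          using w(2) by (intro integral_lebesgue_cong_AE[symmetric]) (auto elim: eventually_mono)
        finally show ?thesis .
      qed
      ultimately show ?thesis using G y unfolding green_function_def by blast
    qed
    then have lower: "\<kappa> * r powr \<alpha> / 2 \<le> (\<integral>x. enn2real (G x y) * \<psi> x \<partial>lebesgue)"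
      using g(3) y by (simp add: \<phi>'_def)
    show "ennreal (C * dist x y powr (\<alpha> - ?d)) \<le> G x y"
    proof (cases "G x y = \<infinity>")
      case False
      then obtain t where t: "G x y = ennreal t" "t \<ge> 0" by (cases "G x y") auto
      define B where "B = K ^ Suc n * t"
      have B: "B \<ge> 0" using K t by (simp add: B_def)
      have GB: "enn2real (G z y) \<le> B" if "z \<in> A" for z
      proof -
        have "G z y \<le> ennreal (K ^ Suc n) * G x y"
          using harnack_annulus[OF H y x K n] that by (simp add: A_def r_def)
        also have "\<dots> = ennreal B" using K t by (simp add: B_def ennreal_mult)
        finally show ?thesis using B by (rule enn2real_leI[rotated])
      qed
      have A_le: "measure lborel A \<le> \<omega> * r ^ DIM('a)"
      proof -
        have "measure lborel A \<le> measure lborel (ball y r)"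
          by (rule measure_mono_fmeasurable) (use emeasure_lborel_ball_finite[of y r] in \<open>auto simp: A_def fmeasurable_def\<close>)
        then show ?thesis using r by (simp add: content_ball \<omega>_def)
      qed
      have A_fin: "emeasure lborel A < \<infinity>"
        using emeasure_mono[of A "ball y r" lborel] emeasure_lborel_ball_finite[of y r]
        by (auto simp: A_def intro: le_less_trans)
      \<comment> \<open>Off A, \<psi> is -q \<phi> \<le> 0, so the values of G near the pole and at
        distance r or more can only lower the integral; comparing with the constant B on A is
        enough.\<close>
      have "(\<integral>x. enn2real (G x y) * \<psi> x \<partial>lebesgue) \<le> (\<integral>x. B * indicator A x \<partial>lebesgue)"
      proof (rule integral_mono')
        show "integrable lebesgue (\<lambda>x. B * indicator A x :: real)"
          using A_fin by (intro integrable_mult_right integrable_real_indicator) auto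
        show "enn2real (G z y) * \<psi> z \<le> B * indicator A z" for z
        proof (cases "z \<in> A")
          case True
          have "enn2real (G z y) * \<psi> z \<le> enn2real (G z y) * 1"
            using \<phi>(2)[of z] q0 True by (intro mult_left_mono) (auto simp: \<psi>_def)
          then show ?thesis using GB[OF True] True by simp
        next
          case False
          then show ?thesis using \<phi>(2)[of z] q0 by (simp add: \<psi>_def mult_nonneg_nonneg)
        qed
        show "0 \<le> B * indicator A z" for z using B by simp
      qed
      also have "\<dots> = B * measure lborel A"
        using A_fin by (subst integral_completion) auto
      also have "\<dots> \<le> B * (\<omega> * r ^ DIM('a))" by (rule mult_left_mono[OF A_le B])
      finally have "\<kappa> * r powr \<alpha> / 2 \<le> K ^ Suc n * t * (\<omega> * r ^ DIM('a))" using lower by (simp add: B_def)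
      moreover have "K ^ Suc n > 0" using K by simp
      moreover have "C * r powr (\<alpha> - ?d) = (\<kappa> * r powr \<alpha> / 2) / (K ^ Suc n * (\<omega> * r ^ DIM('a)))"
        using r by (simp add: C_def powr_diff powr_realpow)
      ultimately have "C * r powr (\<alpha> - ?d) \<le> t"
        using \<omega> r by (simp add: pos_divide_le_eq mult_ac del: power_Suc)
      then show ?thesis using t by (simp add: r_def ennreal_leI)
    qed simp
  qed
qed

end
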